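(* There is an algorithm that, given a $P_5$-free graph $G$ on $n$ vertices, computes the size of a minimum independent feedback vertex set of $G$ in $O(n^{16})$ time.
   Context: All graphs are finite, simple and undirected. $P_r$ denotes the path on $r$ vertices; a graph is $H$-free if it has no induced subgraph isomorphic to $H$. A feedback vertex set of $G$ is a set $S\subseteq V(G)$ such that $G-S$ is a forest; it is independent if $S$ is an independent set. A graph that has an independent feedback vertex set is called near-bipartite. *)

theory Defs
  imports "Graph_Theory.Graph_Theory" "HOL-Library.Landau_Symbols"
begin

section \<open>Graphs\<close>

text \<open>
  A finite simple undirected graph is a \<^locale>\<open>pair_graph\<close>: a finite, loop-free, symmetric
  digraph whose arcs are ordered pairs. An edge \<open>uv\<close> is the pair of arcs \<open>(u, v)\<close>, \<open>(v, u)\<close>.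
\<close>

definition path_graph :: "nat \<Rightarrow> nat pair_pre_digraph" where
  "path_graph r = \<lparr> pverts = {..<r},
     parcs = {(i, j). i < r \<and> j < r \<and> (j = Suc i \<or> i = Suc j)} \<rparr>"

definition induced_free :: "('a, 'b) pre_digraph \<Rightarrow> ('c, 'd) pre_digraph \<Rightarrow> bool" where
  "induced_free G F \<longleftrightarrow> \<not> (\<exists>H. induced_subgraph H G \<and> digraph_iso H F)"

text \<open>
  The library constant \<^const>\<open>forest\<close> is not usable here: in a symmetric digraph every edge gives
  a directed cycle \<open>u, v, u\<close>. The cycles of a simple undirected graph are exactly the directed
  cycles of length at least 3.
\<close>

definition undirected_forest :: "('a, 'b) pre_digraph \<Rightarrow> bool" where
  "undirected_forest G \<longleftrightarrow> \<not> (\<exists>p. pre_digraph.cycle G p \<and> length p \<ge> 3)"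

definition independent_set :: "('a, 'b) pre_digraph \<Rightarrow> 'a set \<Rightarrow> bool" where
  "independent_set G S \<longleftrightarrow> S \<subseteq> verts G \<and> (\<forall>u\<in>S. \<forall>v\<in>S. (u, v) \<notin> arcs_ends G)"

definition feedback_vertex_set :: "('a, 'b) pre_digraph \<Rightarrow> 'a set \<Rightarrow> bool" where
  "feedback_vertex_set G S \<longleftrightarrow> S \<subseteq> verts G \<and> undirected_forest (G \<restriction> (verts G - S))"

definition independent_fvs :: "('a, 'b) pre_digraph \<Rightarrow> 'a set \<Rightarrow> bool" where
  "independent_fvs G S \<longleftrightarrow> feedback_vertex_set G S \<and> independent_set G S"

definition near_bipartite :: "('a, 'b) pre_digraph \<Rightarrow> bool" where
  "near_bipartite G \<longleftrightarrow> (\<exists>S. independent_fvs G S)"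

text \<open>\<^const>\<open>None\<close> means that the graph has no independent feedback vertex set at all.\<close>

definition min_independent_fvs_size :: "('a, 'b) pre_digraph \<Rightarrow> nat option" where
  "min_independent_fvs_size G =
     (if near_bipartite G then Some (LEAST k. \<exists>S. independent_fvs G S \<and> card S = k) else None)"

section \<open>Random access machines\<close>

text \<open>
  The model of computation is the word RAM with unit cost, programmed in a structured language.
  A state consists of the registers and of a random access memory, both holding natural numbers.
  An expression \<open>Mem e\<close> reads the memory cell whose address is the value of \<open>e\<close>;
  \<open>Minus\<close> is truncated subtraction.
\<close>

type_synonym state = "(nat \<Rightarrow> nat) \<times> (nat \<Rightarrow> nat)"

datatype aexp = Const nat | Reg nat | Mem aexp
  | Plus aexp aexp | Minus aexp aexp | Times aexp aexp

datatype bexp = Less aexp aexp | Neg bexp | Conj bexp bexp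

datatype com = Skip
  | Assign nat aexp
  | Store aexp aexp
  | Seq com com
  | IfElse bexp com com
  | While bexp com

primrec aval :: "aexp \<Rightarrow> state \<Rightarrow> nat" where
  "aval (Const c) s = c"
| "aval (Reg x) s = fst s x"
| "aval (Mem e) s = snd s (aval e s)"
| "aval (Plus e1 e2) s = aval e1 s + aval e2 s"
| "aval (Minus e1 e2) s = aval e1 s - aval e2 s"
| "aval (Times e1 e2) s = aval e1 s * aval e2 s"

primrec bval :: "bexp \<Rightarrow> state \<Rightarrow> bool" where
  "bval (Less e1 e2) s \<longleftrightarrow> aval e1 s < aval e2 s"
| "bval (Neg b) s \<longleftrightarrow> \<not> bval b s"
| "bval (Conj b1 b2) s \<longleftrightarrow> bval b1 s \<and> bval b2 s"

text \<open>
  \<open>exec W c s t s'\<close>: started in state \<open>s\<close>, the program \<open>c\<close> halts in state \<open>s'\<close> after \<open>t\<close> steps,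
  and every number or address it writes is at most \<open>W\<close>. A run that would exceed \<open>W\<close> is stuck;
  without such a bound, unit cost multiplication would be unrealistically powerful.
  Each assignment, store and test is one step: the expressions in a program have constant size, so
  counting their individual operations would change the time only by a constant factor
  that depends on the program but not on its input.
\<close>

inductive exec :: "nat \<Rightarrow> com \<Rightarrow> state \<Rightarrow> nat \<Rightarrow> state \<Rightarrow> bool" for W :: nat where
  Skip: "exec W Skip s 1 s"
| Assign: "aval e s \<le> W \<Longrightarrow> exec W (Assign x e) s 1 ((fst s)(x := aval e s), snd s)"
| Store: "aval a s \<le> W \<Longrightarrow> aval e s \<le> W \<Longrightarrow>
    exec W (Store a e) s 1 (fst s, (snd s)(aval a s := aval e s))"
| Seq: "exec W c1 s1 t1 s2 \<Longrightarrow> exec W c2 s2 t2 s3 \<Longrightarrow> exec W (Seq c1 c2) s1 (t1 + t2) s3"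
| IfTrue: "bval b s \<Longrightarrow> exec W c1 s t s' \<Longrightarrow> exec W (IfElse b c1 c2) s (1 + t) s'"
| IfFalse: "\<not> bval b s \<Longrightarrow> exec W c2 s t s' \<Longrightarrow> exec W (IfElse b c1 c2) s (1 + t) s'"
| WhileFalse: "\<not> bval b s \<Longrightarrow> exec W (While b c) s 1 s"
| WhileTrue: "bval b s1 \<Longrightarrow> exec W c s1 t1 s2 \<Longrightarrow> exec W (While b c) s2 t2 s3 \<Longrightarrow>
    exec W (While b c) s1 (1 + t1 + t2) s3"

inductive_cases exec_SkipE: "exec W Skip s t s'"
inductive_cases exec_AssignE: "exec W (Assign x e) s t s'"
inductive_cases exec_StoreE: "exec W (Store a e) s t s'"
inductive_cases exec_SeqE: "exec W (Seq c1 c2) s t s'"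
inductive_cases exec_IfE: "exec W (IfElse b c1 c2) s t s'"
inductive_cases exec_WhileE: "exec W (While b c) s t s'"

lemma exec_deterministic:
  "exec W c s t s' \<Longrightarrow> exec W c s u s'' \<Longrightarrow> u = t \<and> s'' = s'"
proof (induction arbitrary: u s'' rule: exec.induct)
  case (Seq c1 s1 t1 s2 c2 t2 s3)
  from Seq.prems obtain v1 r v2 where "exec W c1 s1 v1 r" "exec W c2 r v2 s''" "u = v1 + v2"
    by (rule exec_SeqE)
  with Seq.IH show ?case by metis
next
  case (WhileTrue b s1 c t1 s2 t2 s3)
  from WhileTrue.prems \<open>bval b s1\<close> obtain v1 r v2
    where "exec W c s1 v1 r" "exec W (While b c) r v2 s''" "u = 1 + v1 + v2"
    by (cases rule: exec_WhileE) auto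
  with WhileTrue.IH show ?case by metis
next
  case (IfTrue b s c1 t s' c2)
  from IfTrue.prems \<open>bval b s\<close> obtain v where "exec W c1 s v s''" "u = 1 + v"
    by (cases rule: exec_IfE) auto
  with IfTrue.IH show ?case by metis
next
  case (IfFalse b s c2 t s' c1)
  from IfFalse.prems \<open>\<not> bval b s\<close> obtain v where "exec W c2 s v s''" "u = 1 + v"
    by (cases rule: exec_IfE) auto
  with IfFalse.IH show ?case by metis
next
  case (WhileFalse b s c)
  from WhileFalse.prems \<open>\<not> bval b s\<close> show ?case by (cases rule: exec_WhileE) auto
next
  case (Skip s)
  then show ?case by (cases rule: exec_SkipE) auto
next
  case (Assign e s x)
  from Assign.prems show ?case by (cases rule: exec_AssignE) auto
next
  case (Store a s e)
  from Store.prems show ?case by (cases rule: exec_StoreE) auto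
qed

text \<open>
  A graph with vertex set \<open>{0, \<dots>, n - 1}\<close> is given to a program by \<open>n\<close> in register 0 and the
  adjacency matrix in memory, row by row from address 0. All other cells are 0.
\<close>

definition graph_input :: "nat \<Rightarrow> nat pair_pre_digraph \<Rightarrow> state" where
  "graph_input n G =
     ((\<lambda>x. if x = 0 then n else 0),
      (\<lambda>a. if a < n * n \<and> (a div n, a mod n) \<in> parcs G then 1 else 0))"

text \<open>
  The result is read from registers 0 and 1: register 0 is 0 for the answer \<^const>\<open>None\<close>, and
  it is 1 for the answer \<open>Some k\<close>, with \<open>k\<close> in register 1.
\<close>

definition outputs :: "state \<Rightarrow> nat option \<Rightarrow> bool" where
  "outputs s r \<longleftrightarrow>
     (case r of None \<Rightarrow> fst s 0 = 0 | Some k \<Rightarrow> fst s 0 = 1 \<and> fst s 1 = k)"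

text \<open>
  For graphs in the class \<open>C\<close> on \<open>n\<close> vertices, \<open>c\<close> computes \<open>f\<close> in at most \<open>T n\<close> steps. The word
  length is logarithmic in \<open>n\<close>: all numbers are bounded by a fixed power of \<open>n + 2\<close>. Restricting the
  vertices to \<open>0, \<dots>, n - 1\<close> fixes the numbering that an input encoding needs; every finite graph
  is isomorphic to such a graph.
\<close>

definition computes_in_time ::
  "com \<Rightarrow> (nat pair_pre_digraph \<Rightarrow> bool) \<Rightarrow> (nat pair_pre_digraph \<Rightarrow> nat option) \<Rightarrow> (nat \<Rightarrow> nat) \<Rightarrow> bool"
where
  "computes_in_time c C f T \<longleftrightarrow>
     (\<exists>k. \<forall>n G. pair_graph G \<and> pverts G = {..<n} \<and> C G \<longrightarrow>
        (\<exists>t s. exec ((n + 2) ^ k) c (graph_input n G) t s \<and> t \<le> T n \<and> outputs s (f G)))"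

end

theory Submission
  imports Defs
begin

text \<open>
  A solution \<open>S\<close> leaves a forest \<open>F\<close>, whose trees have no induced \<open>P\<^sub>5\<close>, so each of them has at most
  two vertices of degree at least 2. A component \<open>C\<close> of the graph has no \<open>K\<^sub>4\<close> if it has a solution,
  and a connected graph without induced \<open>P\<^sub>5\<close> and \<open>K\<^sub>4\<close> has a dominating set \<open>D\<close> of at most three
  vertices. Guess \<open>D\<close>, which of its vertices are in \<open>S\<close>, and for every other vertex of \<open>D\<close> the
  vertices of degree at least 2 of its tree: at most nine vertices altogether. Every other vertex of
  \<open>F\<close> next to a guessed vertex of \<open>F\<close> is now known to be a leaf. Therefore every edge that has an end
  in \<open>S \<inter> D\<close>, or an unguessed end next to a guessed vertex of \<open>F\<close>, has exactly one end in \<open>S\<close>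
  (edges to the guessed vertices of \<open>F\<close> aside). In a connected component of the graph of these edges
  there are only two choices, and the choices in different components do not interact. So it suffices
  to take the smaller of the two wherever both are possible. Trying all \<open>(2 n)^9\<close> guesses for every
  component of the graph, and verifying what they produce, takes 14 nested loops.
\<close>

section \<open>Forests and independent feedback vertex sets\<close>

text \<open>The choices do not interact because admissibility is a list of local conditions, and one
  solution compatible with the guess certifies that every admissible set is a solution: next to
  \<open>A\<close> a vertex outside the set keeps at most one neighbour outside it, and elsewhere
  the complement of the set lies in the complement of the given solution. That solution is itself
  admissible, so on each component of the xor edges it coincides with one of the two classes; taking
  the smaller permitted class therefore never costs more. No guess is ever tested for being right.
  Only the resulting set is tested, so a wrong guess yields a genuine solution or nothing. The
  number nine is three times three: a vertex of the forest, its branching neighbour, and the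
  branching neighbour of that one contain all branching vertices adjacent to any of them. Domination
  is proved by adding the vertices of a component one at a time. For this induction the dominating
  set has to be connected as well, and a fourth vertex that enters it must be removed again; private
  neighbours show that this is possible.\<close>

text \<open>Equivalent to being a forest, since a finite graph of minimum degree 2 contains a cycle.\<close>

definition acyclic_on :: "('a \<Rightarrow> 'a \<Rightarrow> bool) \<Rightarrow> 'a set \<Rightarrow> bool" where
  "acyclic_on E F \<longleftrightarrow>
     (\<forall>X. X \<subseteq> F \<and> X \<noteq> {} \<longrightarrow> (\<exists>v\<in>X. \<forall>u\<in>X. \<forall>w\<in>X. E v u \<and> E v w \<longrightarrow> u = w))"

definition ifvs :: "('a \<Rightarrow> 'a \<Rightarrow> bool) \<Rightarrow> 'a set \<Rightarrow> 'a set \<Rightarrow> bool" where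
  "ifvs E C S \<longleftrightarrow> S \<subseteq> C \<and> (\<forall>u\<in>S. \<forall>v\<in>S. \<not> E u v) \<and> acyclic_on E (C - S)"

lemma acyclic_onD:
  assumes "acyclic_on E F" "X \<subseteq> F" "X \<noteq> {}"
  obtains v where "v \<in> X" "\<And>u w. u \<in> X \<Longrightarrow> w \<in> X \<Longrightarrow> E v u \<Longrightarrow> E v w \<Longrightarrow> u = w"
  using assms unfolding acyclic_on_def by meson

lemma not_acyclic_onD:
  assumes "\<not> acyclic_on E F"
  shows "\<exists>X\<subseteq>F. X \<noteq> {} \<and> (\<forall>v\<in>X. \<exists>u\<in>X. \<exists>w\<in>X. u \<noteq> w \<and> E v u \<and> E v w)"
  using assms unfolding acyclic_on_def by meson

lemma acyclic_on_mono: "acyclic_on E F \<Longrightarrow> X \<subseteq> F \<Longrightarrow> acyclic_on E X"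
  unfolding acyclic_on_def by (meson subset_trans)

text \<open>A set that meets \<open>X\<close> has a vertex of degree at most 1 within its part in
  \<open>X\<close>, and there is no edge to \<open>Y\<close> that could raise this degree. Any other
  set lies in \<open>Y\<close>.\<close>

lemma acyclic_on_split:
  assumes "acyclic_on E X" "acyclic_on E Y" and sep: "\<And>x y. x \<in> X \<Longrightarrow> y \<in> Y \<Longrightarrow> \<not> E x y"
  shows "acyclic_on E (X \<union> Y)"
  unfolding acyclic_on_def
proof (intro allI impI)
  fix Z assume Z: "Z \<subseteq> X \<union> Y \<and> Z \<noteq> {}"
  show "\<exists>v\<in>Z. \<forall>u\<in>Z. \<forall>w\<in>Z. E v u \<and> E v w \<longrightarrow> u = w"
  proof (cases "Z \<inter> X = {}")
    case True
    then have "Z \<subseteq> Y" using Z by auto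
    then show ?thesis using assms(2) Z unfolding acyclic_on_def by blast
  next
    case False
    then obtain v where v: "v \<in> Z \<inter> X"
      "\<And>u w. u \<in> Z \<inter> X \<Longrightarrow> w \<in> Z \<inter> X \<Longrightarrow> E v u \<Longrightarrow> E v w \<Longrightarrow> u = w"
      using acyclic_onD[OF assms(1), of "Z \<inter> X"] by blast
    have "E v u \<Longrightarrow> u \<in> Z \<Longrightarrow> u \<in> Z \<inter> X" for u using sep[of v u] v(1) Z by blast
    then show ?thesis using v by blast
  qed
qed

lemma ifvs_Un:
  assumes "ifvs E C S" "ifvs E D T" "C \<inter> D = {}"
    and "\<And>x y. x \<in> C \<Longrightarrow> y \<in> D \<Longrightarrow> \<not> E x y" "\<And>x y. x \<in> D \<Longrightarrow> y \<in> C \<Longrightarrow> \<not> E x y"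
  shows "ifvs E (C \<union> D) (S \<union> T)"
proof -
  have "C \<union> D - (S \<union> T) = (C - S) \<union> (D - T)" using assms(1,2,3) unfolding ifvs_def by blast
  moreover have "acyclic_on E ((C - S) \<union> (D - T))"
    using assms unfolding ifvs_def by (intro acyclic_on_split) auto
  ultimately show ?thesis using assms unfolding ifvs_def by (simp add: subset_eq ball_Un)
qed

lemma ifvs_restrict:
  assumes "ifvs E C S" "D \<subseteq> C"
  shows "ifvs E D (S \<inter> D)"
proof -
  have "D - S \<inter> D \<subseteq> C - S" using assms(2) by auto
  then show ?thesis using assms acyclic_on_mono[of E "C - S" "D - S \<inter> D"] unfolding ifvs_def by auto
qed

section \<open>Directed cycles of length at least 3 and minimum degree two\<close>

lemma pcas_nth:
  assumes "pcas u p v" "i < length p"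
  shows "fst (p ! i) = (if i = 0 then u else snd (p ! (i - 1)))"
  using assms
proof (induction p arbitrary: u i)
  case (Cons e p)
  then show ?case
  proof (cases i)
    case (Suc j)
    then show ?thesis using Cons.IH[of "snd e" j] Cons.prems by (cases j) auto
  qed auto
qed auto

lemma pcas_last: "pcas u p v \<Longrightarrow> p \<noteq> [] \<Longrightarrow> snd (last p) = v"
  by (induction p arbitrary: u) (auto split: if_splits)

lemma tl_pawalk_verts: "tl (pawalk_verts u p) = map snd p" if "pcas u p v"
  using that
proof (induction p arbitrary: u)
  case (Cons e p)
  then show ?case by (cases p) auto
qed auto

lemma pcas_zip: "pcas u (zip (u # ys) (ys @ [v])) v"
  by (induction ys arbitrary: u) auto

text \<open>A longest path exists because its vertices are distinct members of a finite set. Its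
  first vertex has a neighbour other than the second vertex; by maximality this neighbour is on the
  path and closes a cycle.\<close>

lemma cycle_of_min_degree_two:
  assumes "finite X" "X \<noteq> {}" and sym: "\<And>u v. E u v \<Longrightarrow> E v u" and irr: "\<And>u. \<not> E u u"
    and deg: "\<And>v. v \<in> X \<Longrightarrow> \<exists>u\<in>X. \<exists>w\<in>X. u \<noteq> w \<and> E v u \<and> E v w"
  obtains c where "length c \<ge> 3" "distinct c" "set c \<subseteq> X" "successively E c" "E (last c) (hd c)"
proof -
  let ?P = "\<lambda>c. distinct c \<and> set c \<subseteq> X \<and> c \<noteq> [] \<and> successively E c"
  obtain x where "x \<in> X" using assms(2) by auto
  then have ex: "?P [x]" by simp
  have bnd: "?P c \<Longrightarrow> length c \<le> card X" for c
    using card_mono[OF assms(1)] distinct_card by metis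
  have "\<exists>c. ?P c \<and> (\<forall>d. ?P d \<longrightarrow> length d \<le> length c)"
    by (rule ex_has_greatest_nat[where b = "Suc (card X)" and k = "[x]" and P = ?P, OF ex])
      (use bnd le_imp_less_Suc in blast)
  then obtain c where c: "?P c" and mx: "\<And>d. ?P d \<Longrightarrow> length d \<le> length c" by fast
  obtain v cs where vc: "c = v # cs" using c by (cases c) auto
  have vX: "v \<in> X" using c vc by auto
  obtain w where w: "w \<in> X" "E v w" "cs = [] \<or> w \<noteq> hd cs" using deg[OF vX] by metis
  have "w \<in> set c"
  proof (rule ccontr)
    assume "w \<notin> set c"
    then have "?P (w # c)" using c vc w sym by auto
    then show False using mx by fastforce
  qed
  moreover have "w \<noteq> v" using w irr by metis
  ultimately obtain i where i: "i < length cs" "cs ! i = w" using vc by (auto simp: in_set_conv_nth)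
  \<comment> \<open>\<open>w\<close> is not the second vertex of the path, so the closed segment has
    at least three vertices.\<close>
  have "i \<noteq> 0" using w(3) i by (cases cs; cases i) auto
  let ?d = "v # take (Suc i) cs"
  have "successively E ?d"
  proof -
    have "c = ?d @ drop (Suc i) cs" using vc by simp
    then show ?thesis using c by (metis successively_append_iff)
  qed
  moreover have "last ?d = w" using i by (simp add: take_Suc_conv_app_nth)
  moreover have "length ?d \<ge> 3" using i \<open>i \<noteq> 0\<close> by simp
  moreover have "set ?d \<subseteq> X" using c vc set_take_subset[of "Suc i" cs] by auto
  moreover have "distinct ?d" using c vc set_take_subset[of "Suc i" cs] by auto
  ultimately show ?thesis using that[of ?d] sym[OF w(2)] by simp
qed

text \<open>On a cycle of length at least 3, predecessor and successor of a vertex differ, so the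
  vertex set has minimum degree 2. The converse is \<open>cycle_of_min_degree_two\<close>.\<close>

lemma undirected_forest_iff_acyclic_on:
  assumes "pair_graph G" "W \<subseteq> pverts G"
  shows "undirected_forest (with_proj G \<restriction> W) \<longleftrightarrow> acyclic_on (\<lambda>u v. (u, v) \<in> parcs G) W"
proof -
  let ?E = "\<lambda>u v. (u, v) \<in> parcs G"
  interpret pair_graph G by fact
  have finW: "finite W" using assms(2) pair_finite_verts finite_subset by blast
  have symG: "(u, v) \<in> parcs G \<Longrightarrow> (v, u) \<in> parcs G" for u v
    using pair_sym_arcs by (auto simp: symmetric_def dest: symD)
  have irr: "(u, u) \<notin> parcs G" for u using pair_no_loops by fastforce
  define R where "R = \<lparr>pverts = W, parcs = {e \<in> parcs G. fst e \<in> W \<and> snd e \<in> W}\<rparr>"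
  have eq: "with_proj G \<restriction> W = with_proj R"
    by (simp add: R_def with_proj_def induce_subgraph_def)
  have cyc: "pre_digraph.cycle (with_proj R) p \<longleftrightarrow>
      (\<exists>u. u \<in> W \<and> set p \<subseteq> parcs R \<and> pcas u p u \<and> distinct (tl (pawalk_verts u p)) \<and> p \<noteq> [])" for p
    by (simp add: pre_digraph.cycle_def pre_digraph.awalk_def cas_with_proj_eq
        awalk_verts_with_proj_eq R_def)
  have "(\<exists>p. pre_digraph.cycle (with_proj R) p \<and> length p \<ge> 3) \<longleftrightarrow>
      \<not> acyclic_on ?E W" (is "?L = ?R")
  proof
    assume ?L
    then obtain p u where p: "length p \<ge> 3" "u \<in> W" "set p \<subseteq> parcs R" "pcas u p u"
      "distinct (tl (pawalk_verts u p))" using cyc by blast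
    define m where "m = length p"
    have d: "distinct (map snd p)" using tl_pawalk_verts p by metis
    have "p \<noteq> []" using p(1) by auto
    then have lst: "snd (p ! (m - 1)) = u" using pcas_last[OF p(4)] by (simp add: last_conv_nth m_def)
    show ?R
    proof
      assume ac: "acyclic_on ?E W"
      let ?X = "snd ` set p"
      have "?X \<subseteq> W" using p(3) by (auto simp: R_def)
      moreover have "?X \<noteq> {}" using p(1) by auto
      ultimately obtain v where v: "v \<in> ?X"
        "\<And>u w. u \<in> ?X \<Longrightarrow> w \<in> ?X \<Longrightarrow> (v, u) \<in> parcs G \<Longrightarrow> (v, w) \<in> parcs G \<Longrightarrow> u = w"
        using acyclic_onD[OF ac] by metis
      obtain i where i: "i < m" "snd (p ! i) = v" using v(1) by (auto simp: in_set_conv_nth m_def)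
      \<comment> \<open>Cyclically, arc \<open>i\<close> enters \<open>v\<close> and arc
        \<open>k\<close> leaves it; arc \<open>j\<close> ends in the predecessor of
        \<open>v\<close>. The two indices differ because the length is at least 3.\<close>
      define j where "j = (if i = 0 then m - 1 else i - 1)"
      define k where "k = (if i = m - 1 then 0 else i + 1)"
      have jk: "j < m" "k < m" "j \<noteq> k" using i(1) p(1) by (auto simp: j_def k_def m_def)
      have "p ! i = (snd (p ! j), v)"
        using pcas_nth[OF p(4), of i] i lst by (cases "p ! i") (auto simp: j_def m_def)
      moreover have "p ! k = (v, snd (p ! k))"
        using pcas_nth[OF p(4), of k] i jk lst by (cases "p ! k") (auto simp: k_def m_def split: if_splits)
      moreover have "p ! i \<in> parcs G" "p ! k \<in> parcs G"
        using p(3) i(1) jk(2) nth_mem unfolding m_def R_def by fastforce+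
      ultimately have "(v, snd (p ! j)) \<in> parcs G" "(v, snd (p ! k)) \<in> parcs G" using symG by auto
      then have "snd (p ! j) = snd (p ! k)" using v(2) jk by (simp add: m_def)
      then show False using d jk by (metis length_map m_def nth_eq_iff_index_eq nth_map)
    qed
  next
    assume ?R
    obtain X where "X \<subseteq> W \<and> X \<noteq> {} \<and>
        (\<forall>v\<in>X. \<exists>u\<in>X. \<exists>w\<in>X. u \<noteq> w \<and> (v, u) \<in> parcs G \<and> (v, w) \<in> parcs G)"
      by (rule exE[OF not_acyclic_onD[OF \<open>?R\<close>]])
    then have X: "X \<subseteq> W" "X \<noteq> {}"
      "\<And>v. v \<in> X \<Longrightarrow> \<exists>u\<in>X. \<exists>w\<in>X. u \<noteq> w \<and> (v, u) \<in> parcs G \<and> (v, w) \<in> parcs G"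
      by simp_all
    have "finite X" using X(1) finW finite_subset by blast
    obtain c where c: "length c \<ge> 3" "distinct c" "set c \<subseteq> X"
        "successively ?E c" "(last c, hd c) \<in> parcs G"
      by (rule cycle_of_min_degree_two[OF \<open>finite X\<close> X(2) symG irr X(3)])
    obtain u ys where uy: "c = u # ys" using c(1) by (cases c) auto
    \<comment> \<open>Pairing the vertices with their rotation by one position gives the arcs of the
      closed walk.\<close>
    define p where "p = zip (u # ys) (ys @ [u])"
    have cas: "pcas u p u" using pcas_zip p_def by metis
    have "set p \<subseteq> parcs R"
    proof
      fix e assume "e \<in> set p"
      then obtain i where i: "i < length c" "e = ((u # ys) ! i, (ys @ [u]) ! i)"
        by (auto simp: p_def set_zip uy)
      have "e \<in> parcs G"
      proof (cases "i < length ys")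
        case True
        then have "e = (c ! i, c ! Suc i)" using i uy by (simp add: nth_append)
        then show ?thesis using c(4) True uy by (auto simp: successively_conv_nth)
      next
        case False
        then have "i = length ys" using i uy by simp
        then have "e = (last c, hd c)" using i uy by (auto simp: last_conv_nth)
        then show ?thesis using c(5) by simp
      qed
      moreover have "fst e \<in> set (u # ys)" "snd e \<in> set (ys @ [u])"
        using i uy nth_mem[of i "u # ys"] nth_mem[of i "ys @ [u]"] by simp_all
      then have "fst e \<in> W" "snd e \<in> W" using c(3) X(1) uy by auto
      ultimately show "e \<in> parcs R" by (simp add: R_def)
    qed
    moreover have "distinct (tl (pawalk_verts u p))"
      using tl_pawalk_verts[OF cas] c(2) uy by (simp add: p_def map_snd_zip)
    moreover have "u \<in> W" using c(3) X uy by auto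
    moreover have "length p \<ge> 3" using c(1) uy by (simp add: p_def)
    moreover from this have "p \<noteq> []" by auto
    ultimately show ?L using cyc cas by blast
  qed
  then show ?thesis unfolding undirected_forest_def eq by blast
qed

lemma independent_fvs_iff_ifvs:
  assumes "pair_graph G"
  shows "independent_fvs (with_proj G) S \<longleftrightarrow> ifvs (\<lambda>u v. (u, v) \<in> parcs G) (pverts G) S"
  using undirected_forest_iff_acyclic_on[OF assms, of "pverts G - S"]
  unfolding independent_fvs_def feedback_vertex_set_def independent_set_def ifvs_def by auto

section \<open>Dominating sets of \<open>P\<^sub>5\<close>-free graphs\<close>

text \<open>Distinctness of the five vertices need not be demanded: any two of them are told apart
  by the pattern of edges and non-edges.\<close>

locale p5_free =
  fixes E :: "'a \<Rightarrow> 'a \<Rightarrow> bool"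
  assumes sym: "E u v \<Longrightarrow> E v u"
    and irrefl: "\<not> E u u"
    and no_P5: "\<not> (E a b \<and> E b c \<and> E c d \<and> E d e \<and>
      \<not> E a c \<and> \<not> E a d \<and> \<not> E a e \<and> \<not> E b d \<and> \<not> E b e \<and> \<not> E c e)"

lemma digraph_iso_path_graph_5:
  assumes wf: "wf_digraph H" and dist: "distinct [a, b, c, d, e]"
    and V: "verts H = {a, b, c, d, e}" and ht: "tail H = fst" "head H = snd"
    and arcs: "arcs H = {(a,b),(b,a),(b,c),(c,b),(c,d),(d,c),(d,e),(e,d)}"
  shows "digraph_iso H (with_proj (path_graph 5))"
proof -
  define f where "f = (\<lambda>x. if x = a then 0 else if x = b then 1 else if x = c then 2
    else if x = d then 3 else (4::nat))"
  define h where "h = \<lparr>iso_verts = f, iso_arcs = map_prod f f, iso_head = snd, iso_tail = fst\<rparr>"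
  have fs: "f a = 0" "f b = 1" "f c = 2" "f d = 3" "f e = 4" using dist by (auto simp: f_def)
  have inj: "inj_on f (verts H)" unfolding V inj_on_def using dist by (simp add: fs)
  have "inj_on (map_prod f f) (verts H \<times> verts H)" using inj by (rule map_prod_inj_on[OF _ inj])
  moreover have "arcs H \<subseteq> verts H \<times> verts H" by (simp add: arcs V)
  ultimately have injA: "inj_on (map_prod f f) (arcs H)" using inj_on_subset by blast
  have iso: "pre_digraph.digraph_isomorphism H h"
    unfolding pre_digraph.digraph_isomorphism_def using wf inj injA by (simp add: h_def ht)
  have "i < 5 \<longleftrightarrow> i = 0 \<or> i = 1 \<or> i = 2 \<or> i = 3 \<or> i = 4" for i :: nat by arith
  then have "{..<5::nat} = {0, 1, 2, 3, 4}" by (simp add: set_eq_iff)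
  then have verts5: "{..<5::nat} = f ` verts H" by (simp only: V image_insert image_empty fs)
  have "{(i, j). i < 5 \<and> j < (5::nat) \<and> (j = Suc i \<or> i = Suc j)}
    = {(0,1),(1,0),(1,2),(2,1),(2,3),(3,2),(3,4),(4,3)}" (is "?A = ?B")
  proof (rule set_eqI)
    fix p :: "nat \<times> nat"
    have B: "(i, Suc i) \<in> ?B \<and> (Suc i, i) \<in> ?B" if "Suc i < 5" for i
    proof -
      have "i = 0 \<or> i = 1 \<or> i = 2 \<or> i = 3" using that by arith
      then show ?thesis by (elim disjE) simp_all
    qed
    have "p \<in> ?B" if pA: "p \<in> ?A"
    proof -
      obtain i j where ij: "p = (i, j)" "i < 5" "j < 5" "j = Suc i \<or> i = Suc j" using pA by blast
      show ?thesis
      proof (cases "j = Suc i")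
        case True
        then show ?thesis using B[of i, THEN conjunct1] ij(3) by (simp only: ij(1))
      next
        case False
        then have "i = Suc j" using ij(4) by blast
        then show ?thesis using B[of j, THEN conjunct2] ij(2) by (simp only: ij(1))
      qed
    qed
    moreover have "p \<in> ?A" if "p \<in> ?B" using that by (elim insertE emptyE) simp_all
    ultimately show "p \<in> ?A \<longleftrightarrow> p \<in> ?B" by (rule iffI)
  qed
  also have "\<dots> = map_prod f f ` arcs H" unfolding arcs by (simp add: fs)
  finally have "with_proj (path_graph 5) = app_iso h H"
    using verts5 by (simp add: with_proj_def path_graph_def app_iso_def h_def)
  then show ?thesis using iso unfolding digraph_iso_def by blast
qed

lemma p5_free_if_induced_free:
  assumes G: "pair_graph G" and P5: "induced_free (with_proj G) (with_proj (path_graph 5))"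
  shows "p5_free (\<lambda>u v. (u, v) \<in> parcs G)"
proof -
  have symG: "(v, u) \<in> parcs G" if "(u, v) \<in> parcs G" for u v
    using that pair_sym_digraph.pair_sym_arcs[of G] G
    by (auto simp: pair_graph_def pair_pseudo_graph_def symmetric_def dest: symD)
  have irr: "(u, u) \<notin> parcs G" for u
    using pair_loopfree_digraph.pair_no_loops[of G "(u, u)"] G
    by (auto simp: pair_graph_def pair_digraph_def)
  have wf: "pair_wf_digraph G"
    using G by (simp add: pair_graph_def pair_pseudo_graph_def pair_sym_digraph_def)
  have False
    if e: "(a, b) \<in> parcs G" "(b, c) \<in> parcs G" "(c, d) \<in> parcs G" "(d, e) \<in> parcs G"
      and ne: "(a, c) \<notin> parcs G" "(a, d) \<notin> parcs G" "(a, e) \<notin> parcs G" "(b, d) \<notin> parcs G"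
        "(b, e) \<notin> parcs G" "(c, e) \<notin> parcs G" for a b c d e
  proof -
    note e' = e[THEN symG]
    have ne': "(c, a) \<notin> parcs G" "(d, a) \<notin> parcs G" "(e, a) \<notin> parcs G" "(d, b) \<notin> parcs G"
        "(e, b) \<notin> parcs G" "(e, c) \<notin> parcs G"
      using ne symG by blast+
    have dist: "distinct [a, b, c, d, e]" using e e' ne ne' irr by auto
    define V where "V = {a, b, c, d, e}"
    define H where "H = with_proj G \<restriction> V"
    have VG: "V \<subseteq> pverts G"
      using e pair_wf_digraph.in_arcsD1[OF wf] pair_wf_digraph.in_arcsD2[OF wf]
      by (auto simp: V_def)
    have wfG: "wf_digraph (with_proj G)"
      using pair_wf_digraph.arc_fst_in_verts[OF wf] pair_wf_digraph.arc_snd_in_verts[OF wf]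
      by (simp add: wf_digraph_def)
    have ind: "induced_subgraph H (with_proj G)"
      unfolding H_def by (rule wf_digraph.induced_induce[OF wfG]) (use VG in simp)
    have arcs_cases: "(x, y) \<in> parcs G \<and> x \<in> V \<and> y \<in> V \<longleftrightarrow>
        (x, y) \<in> {(a,b),(b,a),(b,c),(c,b),(c,d),(d,c),(d,e),(e,d)}" for x y
    proof
      assume "(x, y) \<in> parcs G \<and> x \<in> V \<and> y \<in> V"
      then have "x \<in> {a, b, c, d, e}" "y \<in> {a, b, c, d, e}" and xy: "(x, y) \<in> parcs G"
        by (simp_all add: V_def)
      then show "(x, y) \<in> {(a,b),(b,a),(b,c),(c,b),(c,d),(d,c),(d,e),(e,d)}"
        using ne ne' irr by (elim insertE emptyE) simp_all
    qed (use e e' in \<open>auto simp: V_def\<close>)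
    have "arcs H = {(a,b),(b,a),(b,c),(c,b),(c,d),(d,c),(d,e),(e,d)}"
    proof (rule set_eqI)
      fix p
      show "p \<in> arcs H \<longleftrightarrow> p \<in> {(a,b),(b,a),(b,c),(c,b),(c,d),(d,c),(d,e),(e,d)}"
        using arcs_cases[of "fst p" "snd p"] by (simp only: H_def induce_subgraph_arcs) simp
    qed
    then have "digraph_iso H (with_proj (path_graph 5))"
      using digraph_iso_path_graph_5[OF wf_digraphI_induced[OF ind] dist]
      by (simp add: H_def V_def)
    then show False using P5 ind unfolding induced_free_def by blast
  qed
  then show ?thesis using symG irr unfolding p5_free_def by blast
qed

section \<open>Private neighbours and connected dominating triples\<close>

definition has_private_nbr :: "('a \<Rightarrow> 'a \<Rightarrow> bool) \<Rightarrow> 'a set \<Rightarrow> 'a \<Rightarrow> bool" where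
  "has_private_nbr E X d \<longleftrightarrow> (\<exists>p. E p d \<and> (\<forall>c\<in>X - {d}. \<not> E p c))"

definition dominating :: "('a \<Rightarrow> 'a \<Rightarrow> bool) \<Rightarrow> 'a set \<Rightarrow> 'a set \<Rightarrow> bool" where
  "dominating E D W \<longleftrightarrow> (\<forall>v\<in>W. \<exists>d\<in>D. v = d \<or> E v d)"

text \<open>The order of the arguments witnesses that the triple is connected; repetitions are allowed.\<close>

definition connected_triple :: "('a \<Rightarrow> 'a \<Rightarrow> bool) \<Rightarrow> 'a \<Rightarrow> 'a \<Rightarrow> 'a \<Rightarrow> bool" where
  "connected_triple E x y z \<longleftrightarrow> (x = y \<or> E x y) \<and> (y = z \<or> E y z)"

definition triple_dominated :: "('a \<Rightarrow> 'a \<Rightarrow> bool) \<Rightarrow> 'a set \<Rightarrow> bool" where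
  "triple_dominated E W \<longleftrightarrow>
     (\<exists>x\<in>W. \<exists>y\<in>W. \<exists>z\<in>W. connected_triple E x y z \<and> dominating E {x, y, z} W)"

lemma triple_dominatedI:
  "x \<in> W \<Longrightarrow> y \<in> W \<Longrightarrow> z \<in> W \<Longrightarrow> connected_triple E x y z \<Longrightarrow> dominating E {x, y, z} W
    \<Longrightarrow> triple_dominated E W"
  unfolding triple_dominated_def by blast

context p5_free
begin

text \<open>The private neighbour of \<open>a\<close> prolongs the induced path \<open>a\<close>,
  \<open>b\<close>, \<open>c\<close>, \<open>d\<close> to an induced P5.\<close>

lemma no_priv_P4:
  assumes "distinct [a, b, c, d]" "E a b" "E b c" "E c d" "\<not> E a c" "\<not> E a d" "\<not> E b d"
    and privA: "has_private_nbr E X a" and privD: "has_private_nbr E X d"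
    and sub: "{a, b, c, d} \<subseteq> X"
  shows False
proof -
  have ne: "a \<noteq> b" "a \<noteq> c" "a \<noteq> d" "b \<noteq> c" "b \<noteq> d" "c \<noteq> d" using assms(1) by auto
  obtain p where p: "E p a" "\<not> E p b" "\<not> E p c" "\<not> E p d"
    using privA ne sub unfolding has_private_nbr_def by blast
  show False using no_P5[of p a b c d] assms p by blast
qed

text \<open>As \<open>E b c\<close> is left open, this covers the claw and the paw. Without an
  induced P5, \<open>r\<close> must be adjacent to \<open>p\<close> and \<open>q\<close>, while
  \<open>p\<close> and \<open>q\<close> are not adjacent. Then the paw has the induced path
  \<open>a\<close>, \<open>b\<close>, \<open>p\<close>, \<open>r\<close>, \<open>q\<close>, and the
  claw has \<open>p\<close>, \<open>b\<close>, \<open>a\<close>, \<open>c\<close>,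
  \<open>q\<close>.\<close>

lemma no_priv_claw:
  assumes "distinct [a, b, c, d]" "E a b" "E a c" "E a d" "\<not> E b d" "\<not> E c d"
    and privB: "has_private_nbr E X b" and privC: "has_private_nbr E X c" and privD: "has_private_nbr E X d"
    and sub: "{a, b, c, d} \<subseteq> X"
  shows False
proof -
  have ne: "a \<noteq> b" "a \<noteq> d" "a \<noteq> c" "b \<noteq> c" "c \<noteq> d" "b \<noteq> d" using assms(1) by auto
  obtain p where p: "E p b" "\<not> E p a" "\<not> E p c" "\<not> E p d"
    using privB ne sub unfolding has_private_nbr_def by blast
  obtain q where q: "E q c" "\<not> E q a" "\<not> E q b" "\<not> E q d"
    using privC ne sub unfolding has_private_nbr_def by blast
  obtain r where r: "E r d" "\<not> E r a" "\<not> E r b" "\<not> E r c"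
    using privD ne sub unfolding has_private_nbr_def by blast
  have "E r p" using no_P5[of p b a d r] assms p r sym by blast
  have "E r q" using no_P5[of q c a d r] assms q r sym by blast
  have "\<not> E p q" using no_P5[of d a b p q] assms p q sym by blast
  show False
  proof (cases "E b c")
    case True
    then show ?thesis using no_P5[of a b p r q] assms p q r \<open>E r p\<close> \<open>E r q\<close> \<open>\<not> E p q\<close> sym by blast
  next
    case False
    then show ?thesis using no_P5[of p b a c q] assms p q \<open>\<not> E p q\<close> sym by blast
  qed
qed

text \<open>As \<open>E a b\<close> is left open, this covers the four-cycle and the diamond. Here
  \<open>q\<close> and \<open>r\<close> must be adjacent and \<open>p\<close> is adjacent to
  neither, which leaves the induced path \<open>p\<close>, \<open>b\<close>, \<open>c\<close>,
  \<open>q\<close>, \<open>r\<close>.\<close>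

lemma no_priv_diamond:
  assumes "distinct [a, b, c, d]" "E a c" "E a d" "E b c" "E b d" "\<not> E c d"
    and privB: "has_private_nbr E X b" and privC: "has_private_nbr E X c" and privD: "has_private_nbr E X d"
    and sub: "{a, b, c, d} \<subseteq> X"
  shows False
proof -
  have ne: "a \<noteq> c" "a \<noteq> d" "b \<noteq> c" "b \<noteq> d" "a \<noteq> b" "c \<noteq> d" using assms(1) by auto
  obtain p where p: "E p b" "\<not> E p a" "\<not> E p c" "\<not> E p d"
    using privB ne sub unfolding has_private_nbr_def by blast
  obtain q where q: "E q c" "\<not> E q a" "\<not> E q b" "\<not> E q d"
    using privC ne sub unfolding has_private_nbr_def by blast
  obtain r where r: "E r d" "\<not> E r a" "\<not> E r b" "\<not> E r c"
    using privD ne sub unfolding has_private_nbr_def by blast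
  have "E q r" using no_P5[of q c a d r] assms q r sym by blast
  have "\<not> E r p" using no_P5[of c a d r p] assms p r sym by blast
  have "\<not> E q p" using no_P5[of d a c q p] assms p q sym by blast
  show False using no_P5[of p b c q r] assms p q r \<open>E q r\<close> \<open>\<not> E r p\<close> \<open>\<not> E q p\<close> sym by blast
qed

end

locale p5_k4_free = p5_free +
  assumes no_K4: "\<not> (E a b \<and> E a c \<and> E a d \<and> E b c \<and> E b d \<and> E c d)"
begin

text \<open>
  If no connected triple dominated \<open>W\<close>, then each of the four vertices whose removal keeps the other
  three connected would have a private neighbour. For each of the five connected graphs on four
  vertices other than \<open>K\<^sub>4\<close>, this produces an induced \<open>P\<^sub>5\<close>.
\<close>

lemma connected_triple_of_four:
  assumes dist: "distinct [x, y, z, w]" and xy: "E x y" and yz: "E y z"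
    and w: "E w x \<or> E w y \<or> E w z"
    and dom: "dominating E {x, y, z, w} W" and X: "{x, y, z, w} \<subseteq> W"
  shows "triple_dominated E W"
proof (rule ccontr)
  assume neg: "\<not> triple_dominated E W"
  let ?X = "{x, y, z, w}"
  \<comment> \<open>A vertex \<open>p\<close> missed by \<open>a\<close>, \<open>b\<close>,
    \<open>c\<close> can only be dominated by \<open>d\<close>, and it is not \<open>d\<close>
    itself, which has a neighbour among the three.\<close>
  have priv: "has_private_nbr E ?X d" if h1: "connected_triple E a b c" and h2: "?X = {a, b, c, d}" and h3: "E d a \<or> E d b \<or> E d c" for a b c d :: 'a
  proof -
    have "a \<in> W" "b \<in> W" "c \<in> W" using h2 X by auto
    then have "\<not> dominating E {a, b, c} W" using neg h1 unfolding triple_dominated_def by blast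
    then obtain p where p: "p \<in> W" "\<And>c'. c' \<in> {a, b, c} \<Longrightarrow> p \<noteq> c' \<and> \<not> E p c'"
      unfolding dominating_def by blast
    obtain d' where "d' \<in> {a, b, c, d}" "p = d' \<or> E p d'"
      using dom p(1) h2 unfolding dominating_def by metis
    then have "E p d" using p(2) h3 by blast
    moreover have "?X - {d} \<subseteq> {a, b, c}" using h2 by auto
    ultimately show ?thesis using p(2) unfolding has_private_nbr_def by blast
  qed
  have ne: "x \<noteq> y" "x \<noteq> z" "x \<noteq> w" "y \<noteq> z" "y \<noteq> w" "z \<noteq> w" using dist by auto
  have yx: "E y x" and zy: "E z y" using xy yz sym by auto
  have wsym: "E x w = E w x" "E y w = E w y" "E z w = E w z" using sym by blast+
  note defs = connected_triple_def
  have sets: "?X = {w, y, z, x}" "?X = {y, z, w, x}" "?X = {x, y, w, z}" "?X = {w, x, y, z}"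
    "?X = {x, z, w, y}" "?X = {z, x, w, y}" "?X = {x, w, z, y}" by auto
  have px1: "has_private_nbr E ?X x" if "E w y"
    using priv[of w y z x] sets(1) yz yx xy that unfolding defs by simp
  have px2: "has_private_nbr E ?X x" if "E w z"
    using priv[of y z w x] sets(2) yz xy that wsym unfolding defs by simp
  have pz1: "has_private_nbr E ?X z" if "E w y"
    using priv[of x y w z] sets(3) xy zy that wsym unfolding defs by simp
  have pz2: "has_private_nbr E ?X z" if "E w x"
    using priv[of w x y z] sets(4) xy zy that unfolding defs by simp
  have pw: "has_private_nbr E ?X w" using priv[of x y z w] xy yz w unfolding defs by simp
  have py1: "has_private_nbr E ?X y" if "E x z" "E w x"
    using priv[of z x w y] sets(6) sym[OF that(1)] yx that wsym unfolding defs by simp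
  have py2: "has_private_nbr E ?X y" if "E x z" "E w z"
    using priv[of x z w y] sets(5) yx that wsym unfolding defs by simp
  \<comment> \<open>The edge between \<open>x\<close> and \<open>z\<close> and the edges at
    \<open>w\<close> determine the graph on the four vertices. Apart from the complete graph, every
    case is an instance of one of the three preceding lemmas.\<close>
  show False
  proof (cases "E x z")
    case True
    then have zx: "E z x" using sym by auto
    note all = True zx xy yz yx zy
    consider "E w x" "E w y" "E w z" | "E w x" "E w y" "\<not> E w z" | "E w x" "\<not> E w y" "E w z"
      | "\<not> E w x" "E w y" "E w z" | "E w x" "\<not> E w y" "\<not> E w z" | "\<not> E w x" "E w y" "\<not> E w z"
      | "\<not> E w x" "\<not> E w y" "E w z" using w by blast
    then show False
    proof cases
      case 1 then show ?thesis using no_K4[of w x y z] all by blast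
    next
      case 2 then show ?thesis using all ne wsym px1 px2 pz1 pz2 pw py1 py2 by (intro no_priv_diamond[of x y z w ?X]) simp_all
    next
      case 3 then show ?thesis using all ne wsym px1 px2 pz1 pz2 pw py1 py2 by (intro no_priv_diamond[of x z y w ?X]) simp_all
    next
      case 4 then show ?thesis using all ne wsym px1 px2 pz1 pz2 pw py1 py2 by (intro no_priv_diamond[of y z x w ?X]) simp_all
    next
      case 5 then show ?thesis using all ne wsym px1 px2 pz1 pz2 pw py1 py2 by (intro no_priv_claw[of x y z w ?X]) simp_all
    next
      case 6 then show ?thesis using all ne wsym px1 px2 pz1 pz2 pw py1 py2 by (intro no_priv_claw[of y x z w ?X]) simp_all
    next
      case 7 then show ?thesis using all ne wsym px1 px2 pz1 pz2 pw py1 py2 by (intro no_priv_claw[of z x y w ?X]) simp_all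
    qed
  next
    case False
    then have zx: "\<not> E z x" using sym by auto
    note all = False zx xy yz yx zy
    consider "E w x" "E w y" "E w z" | "E w x" "E w y" "\<not> E w z" | "E w x" "\<not> E w y" "E w z"
      | "\<not> E w x" "E w y" "E w z" | "E w x" "\<not> E w y" "\<not> E w z" | "\<not> E w x" "E w y" "\<not> E w z"
      | "\<not> E w x" "\<not> E w y" "E w z" using w by blast
    then show False
    proof cases
      case 1 then show ?thesis using all ne wsym px1 px2 pz1 pz2 pw py1 py2 by (intro no_priv_diamond[of y w x z ?X]) simp_all
    next
      case 2 then show ?thesis using all ne wsym px1 px2 pz1 pz2 pw py1 py2 by (intro no_priv_claw[of y x w z ?X]) simp_all
    next
      case 3 then show ?thesis using all ne wsym px1 px2 pz1 pz2 pw py1 py2 by (intro no_priv_diamond[of y w x z ?X]) simp_all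
    next
      case 4 then show ?thesis using all ne wsym px1 px2 pz1 pz2 pw py1 py2 by (intro no_priv_claw[of y z w x ?X]) simp_all
    next
      case 5 then show ?thesis using all ne wsym px1 px2 pz1 pz2 pw py1 py2 by (intro no_priv_P4[of w x y z ?X]) simp_all
    next
      case 6 then show ?thesis using all ne wsym px1 px2 pz1 pz2 pw py1 py2 by (intro no_priv_claw[of y x z w ?X]) simp_all
    next
      case 7 then show ?thesis using all ne wsym px1 px2 pz1 pz2 pw py1 py2 by (intro no_priv_P4[of w z y x ?X]) simp_all
    qed
  qed
qed

text \<open>If the triple misses \<open>v\<close>, then adding \<open>w\<close> dominates
  \<open>v\<close>, and \<open>w\<close> is attached to the triple. A triple with a repetition has
  room for \<open>w\<close>; otherwise \<open>connected_triple_of_four\<close> reduces the four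
  vertices to three.\<close>

lemma triple_dominated_insert:
  assumes "triple_dominated E W" "w \<in> W" "E w v"
  shows "triple_dominated E (insert v W)"
proof -
  obtain x y z where t: "x \<in> W" "y \<in> W" "z \<in> W" "connected_triple E x y z" "dominating E {x, y, z} W"
    using assms(1) unfolding triple_dominated_def by blast
  show ?thesis
  proof (cases "\<exists>d\<in>{x, y, z}. v = d \<or> E v d")
    case True
    then have "dominating E {x, y, z} (insert v W)" using t(5) unfolding dominating_def by auto
    then show ?thesis using t unfolding triple_dominated_def by blast
  next
    case False
    obtain d where d: "d \<in> {x, y, z}" "w = d \<or> E w d" using t(5) assms(2) unfolding dominating_def by blast
    then have wd: "E w d" "w \<notin> {x, y, z}" using False sym[OF assms(3)] by blast+
    have dom: "dominating E {x, y, z, w} (insert v W)"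
      using t(5) sym[OF assms(3)] unfolding dominating_def by auto
    have two: "triple_dominated E (insert v W)" if "{x, y, z} = {p, q}" "p = q \<or> E p q" for p q
    proof -
      have "E w p \<or> E w q" using d(1) wd(1) that(1) by auto
      then have "connected_triple E w p q \<or> connected_triple E w q p"
        using that(2) sym[of p q] unfolding connected_triple_def by auto
      moreover have "{x, y, z, w} = {w, p, q}" using that(1) by auto
      then have "dominating E {w, p, q} (insert v W)" "dominating E {w, q, p} (insert v W)"
        using dom by (simp_all add: insert_commute)
      moreover have "p \<in> W" "q \<in> W" using that(1) t by auto
      ultimately show ?thesis
        using triple_dominatedI[of w "insert v W" p q E] triple_dominatedI[of w "insert v W" q p E] assms(2)
        by auto
    qed
    consider "x = y" | "y = z" | "x = z" | "distinct [x, y, z]" by auto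
    then show ?thesis
    proof cases
      case 1 then show ?thesis using two[of y z] t(4) unfolding connected_triple_def by auto
    next
      case 2 then show ?thesis using two[of x y] t(4) unfolding connected_triple_def by auto
    next
      case 3 then show ?thesis using two[of x y] t(4) unfolding connected_triple_def by auto
    next
      case 4
      then have "E x y" "E y z" using t(4) unfolding connected_triple_def by auto
      moreover have "E w x \<or> E w y \<or> E w z" using wd(1) d(1) by auto
      moreover have "distinct [x, y, z, w]" using 4 wd(2) by auto
      moreover have "{x, y, z, w} \<subseteq> insert v W" using t assms(2) by auto
      ultimately show ?thesis using connected_triple_of_four[of x y z w "insert v W"] dom by blast
    qed
  qed
qed

end

section \<open>Reconstructing an optimal solution from a bounded guess\<close>

text \<open>An independent set contains at most one of four mutually adjacent vertices, so a
  triangle would remain in the forest.\<close>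

lemma (in p5_free) no_K4_if_ifvs:
  assumes "ifvs E C S" "{a, b, c, d} \<subseteq> C" "E a b" "E a c" "E a d" "E b c" "E b d" "E c d"
  shows False
proof -
  have tri: False if h: "{x, y, z} \<subseteq> C - S" "E x y" "E x z" "E y z" for x y z
  proof -
    have "acyclic_on E (C - S)" using assms(1) unfolding ifvs_def by blast
    then obtain v where "v \<in> {x, y, z}"
      "\<And>u w. u \<in> {x, y, z} \<Longrightarrow> w \<in> {x, y, z} \<Longrightarrow> E v u \<Longrightarrow> E v w \<Longrightarrow> u = w"
      using h(1) acyclic_onD[of E "C - S" "{x, y, z}"] by blast
    then show False using h(2-4) sym irrefl by (metis insertCI insertE singletonD)
  qed
  have ind: "\<And>u v. E u v \<Longrightarrow> u \<in> S \<Longrightarrow> v \<notin> S" using assms(1) unfolding ifvs_def by blast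
  then consider "{b, c, d} \<subseteq> C - S" | "{a, c, d} \<subseteq> C - S" | "{a, b, d} \<subseteq> C - S" | "{a, b, c} \<subseteq> C - S"
    using assms(2-) by (metis Diff_iff insert_subset empty_subsetI)
  then show False using tri assms(3-) by cases blast+
qed

definition branching :: "('a \<Rightarrow> 'a \<Rightarrow> bool) \<Rightarrow> 'a set \<Rightarrow> 'a \<Rightarrow> bool" where
  "branching E F v \<longleftrightarrow> (\<exists>u\<in>F. \<exists>w\<in>F. u \<noteq> w \<and> E v u \<and> E v w)"

text \<open>A tree without an induced \<open>P\<^sub>5\<close> is a star or a double star.\<close>

lemma (in p5_free) branching_neighbour_unique:
  assumes ac: "acyclic_on E F" and F: "f \<in> F" "p \<in> F" "q \<in> F"
    and E: "E f p" "E f q" and br: "branching E F p" "branching E F q"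
  shows "p = q"
proof (rule ccontr)
  assume "p \<noteq> q"
  obtain p' where p': "p' \<in> F" "E p p'" "p' \<noteq> f" using br(1) unfolding branching_def by metis
  obtain q' where q': "q' \<in> F" "E q q'" "q' \<noteq> f" using br(2) unfolding branching_def by metis
  \<comment> \<open>Excluding sets of minimum degree 2 excludes cycles of length 3, 4 and 5. Hence
    the path \<open>p'\<close>, \<open>p\<close>, \<open>f\<close>, \<open>q\<close>,
    \<open>q'\<close> has neither chords nor coincidences.\<close>
  have no: False if "X \<subseteq> F" "X \<noteq> {}" "\<And>v. v \<in> X \<Longrightarrow> \<exists>u\<in>X. \<exists>w\<in>X. u \<noteq> w \<and> E v u \<and> E v w" for X
    using acyclic_onD[OF ac that(1,2)] that(3) by metis
  have c3: False if "E x y" "E y z" "E z x" "{x, y, z} \<subseteq> F" for x y z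
  proof -
    have "x \<noteq> y" "y \<noteq> z" "z \<noteq> x" using that irrefl by blast+
    then show False using that that(1-3)[THEN sym] by (intro no[of "{x, y, z}"]) auto
  qed
  have c4: False if "E x y" "E y z" "E z u" "E u x" "{x, y, z, u} \<subseteq> F" "x \<noteq> z" "y \<noteq> u" for x y z u
    using that that(1-4)[THEN sym] by (intro no[of "{x, y, z, u}"]) auto
  have c5: False if "E x y" "E y z" "E z u" "E u w" "E w x" "{x, y, z, u, w} \<subseteq> F"
      "distinct [x, y, z, u, w]" for x y z u w
    using that that(1-5)[THEN sym] by (intro no[of "{x, y, z, u, w}"]) auto
  note E' = E E[THEN sym] p'(2) p'(2)[THEN sym] q'(2) q'(2)[THEN sym]
  note F' = F p'(1) q'(1)
  have n1: "\<not> E p q" using c3[of p q f] F' E' by auto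
  have n2: "\<not> E p' f" using c3[of p p' f] F' E' by auto
  have n3: "\<not> E f q'" using c3[of q q' f] F' E' sym[of f q'] by auto
  have d1: "p' \<noteq> q" "q' \<noteq> p" using n1 E' by auto
  have d2: "p' \<noteq> q'" using c4[of f p p' q] F' E' p'(3) \<open>p \<noteq> q\<close> by auto
  have n4: "\<not> E p' q" using c4[of f p p' q] F' E' p'(3) \<open>p \<noteq> q\<close> by auto
  have n5: "\<not> E p q'" using c4[of f p q' q] F' E' q'(3) \<open>p \<noteq> q\<close> by auto
  have "f \<noteq> p" "f \<noteq> q" "p \<noteq> p'" "q \<noteq> q'" using E' irrefl by blast+
  then have n6: "\<not> E p' q'"
    using c5[of f p p' q' q] F' E' p'(3) q'(3) \<open>p \<noteq> q\<close> d1 d2 by auto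
  show False using no_P5[of p' p f q q'] n1 n2 n3 n4 n5 n6 E' by blast
qed

text \<open>\<open>c\<close> is the branching neighbour of \<open>f\<close>, if any, and
  \<open>e\<close> that of \<open>c\<close>. The chain ends there: if \<open>e\<close> differs from
  \<open>c\<close>, then \<open>c\<close> is branching and is the only branching neighbour of
  \<open>e\<close>.\<close>

lemma (in p5_free) branching_closure:
  assumes ac: "acyclic_on E F" and f: "f \<in> F"
  obtains c e where "c \<in> F" "e \<in> F" "f = c \<or> E f c" "c = e \<or> E c e"
    "\<And>x a. x \<in> F - {f, c, e} \<Longrightarrow> a \<in> {f, c, e} \<Longrightarrow> E x a \<Longrightarrow> \<not> branching E F x"
proof -
  \<comment> \<open>Without a branching neighbour the value is \<open>v\<close> itself, so the
    closure always has three entries, possibly repeated.\<close>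
  define g where "g v = (if \<exists>u\<in>F. E v u \<and> branching E F u
    then SOME u. u \<in> F \<and> E v u \<and> branching E F u else v)" for v
  have g: "g v \<in> F \<and> (v = g v \<or> E v (g v) \<and> branching E F (g v))" if "v \<in> F" for v
    using someI_ex[of "\<lambda>u. u \<in> F \<and> E v u \<and> branching E F u"] that unfolding g_def by auto
  have gu: "u = g v" if "u \<in> F" "v \<in> F" "E v u" "branching E F u" for u v
  proof -
    have "\<exists>u\<in>F. E v u \<and> branching E F u" using that by blast
    then have "g v \<in> F \<and> E v (g v) \<and> branching E F (g v)"
      using someI_ex[of "\<lambda>u. u \<in> F \<and> E v u \<and> branching E F u"] unfolding g_def by auto
    then show ?thesis using branching_neighbour_unique[OF ac \<open>v \<in> F\<close> that(1)] that by blast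
  qed
  define c e where "c = g f" and "e = g c"
  have c: "c \<in> F" "f = c \<or> E f c \<and> branching E F c" using g[OF f] c_def by auto
  have e: "e \<in> F" "c = e \<or> E c e \<and> branching E F e" using g[OF c(1)] e_def by auto
  show ?thesis
  proof (rule that[OF c(1) e(1)])
    fix x a assume x: "x \<in> F - {f, c, e}" and a: "a \<in> {f, c, e}" and xa: "E x a"
    show "\<not> branching E F x"
    proof
      assume br: "branching E F x"
      have ax: "E a x" using xa sym by blast
      consider "a = f" | "a = c" | "a = e" "c \<noteq> e" using a by blast
      then show False
      proof cases
        case 1 then show ?thesis using gu[of x f] x br ax f c_def by blast
      next
        case 2 then show ?thesis using gu[of x c] x br ax c e_def by blast
      next
        case 3
        then have "E c e" using e by blast
        \<comment> \<open>Otherwise \<open>e = g c = g f = c\<close>.\<close>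
        have "f \<noteq> c" using 3 c_def e_def by auto
        then have "branching E F c" using c by blast
        then have "c = x"
          using branching_neighbour_unique[OF ac e(1) c(1), of x] x br ax 3 \<open>E c e\<close> sym by blast
        then show False using x by blast
      qed
    qed
  qed (use c e in auto)
qed

text \<open>Complete graphs on four vertices are excluded only inside \<open>C\<close>, hence the
  restriction of the adjacency. It creates no induced P5, since all vertices of such a path lie on
  its edges and so belong to \<open>C\<close>.\<close>

lemma (in p5_free) p5_k4_free_restrict:
  assumes "ifvs E C S"
  shows "p5_k4_free (\<lambda>x y. E x y \<and> x \<in> C \<and> y \<in> C)"
proof unfold_locales
  fix a b c d e
  show "E b a \<and> b \<in> C \<and> a \<in> C" if "E a b \<and> a \<in> C \<and> b \<in> C"
    using that sym by blast
  show "\<not> (E a a \<and> a \<in> C \<and> a \<in> C)" using irrefl by blast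
  show "\<not> ((E a b \<and> a \<in> C \<and> b \<in> C) \<and> (E b c \<and> b \<in> C \<and> c \<in> C) \<and> (E c d \<and> c \<in> C \<and> d \<in> C) \<and>
      (E d e \<and> d \<in> C \<and> e \<in> C) \<and> \<not> (E a c \<and> a \<in> C \<and> c \<in> C) \<and> \<not> (E a d \<and> a \<in> C \<and> d \<in> C) \<and>
      \<not> (E a e \<and> a \<in> C \<and> e \<in> C) \<and> \<not> (E b d \<and> b \<in> C \<and> d \<in> C) \<and> \<not> (E b e \<and> b \<in> C \<and> e \<in> C) \<and>
      \<not> (E c e \<and> c \<in> C \<and> e \<in> C))"
    using no_P5[of a b c d e] by argo
  show "\<not> ((E a b \<and> a \<in> C \<and> b \<in> C) \<and> (E a c \<and> a \<in> C \<and> c \<in> C) \<and> (E a d \<and> a \<in> C \<and> d \<in> C) \<and>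
      (E b c \<and> b \<in> C \<and> c \<in> C) \<and> (E b d \<and> b \<in> C \<and> d \<in> C) \<and> (E c d \<and> c \<in> C \<and> d \<in> C))"
    using no_K4_if_ifvs[OF assms, of a b c d] by auto
qed

text \<open>Connectedness in the form that flooding produces and that the induction for domination
  consumes: every new vertex has a neighbour among the earlier ones.\<close>

inductive grown :: "('a \<Rightarrow> 'a \<Rightarrow> bool) \<Rightarrow> 'a \<Rightarrow> 'a set \<Rightarrow> bool" for E r where
  single: "grown E r {r}"
| extend: "grown E r W \<Longrightarrow> w \<in> W \<Longrightarrow> E w v \<Longrightarrow> grown E r (insert v W)"

lemma (in p5_free) triple_dominated_if_grown:
  assumes "grown E r C" "ifvs E C S"
  shows "triple_dominated E C"
proof -
  define E' where "E' = (\<lambda>x y. E x y \<and> x \<in> C \<and> y \<in> C)"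
  interpret C: p5_k4_free E' unfolding E'_def by (rule p5_k4_free_restrict[OF assms(2)])
  have "W \<subseteq> C \<Longrightarrow> triple_dominated E' W" if "grown E r W" for W
    using that
  proof induction
    case single
    show ?case unfolding triple_dominated_def connected_triple_def dominating_def by simp
  next
    case (extend W w v)
    then show ?case using C.triple_dominated_insert[of W w v] by (auto simp: E'_def)
  qed
  then have "triple_dominated E' C" using assms(1) by simp
  then obtain x y z where xyz: "x \<in> C" "y \<in> C" "z \<in> C" "connected_triple E' x y z"
    "dominating E' {x, y, z} C"
    unfolding triple_dominated_def by blast
  have "connected_triple E x y z" using xyz(4) unfolding connected_triple_def E'_def by blast
  moreover have "dominating E {x, y, z} C" using xyz(5) unfolding dominating_def E'_def by blast
  ultimately show ?thesis using triple_dominatedI xyz(1-3) by metis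
qed

section \<open>Admissible sets and the existence of a good guess\<close>

text \<open>
  A guess consists of vertices \<open>A\<close> outside and \<open>Z\<close> inside a solution. If \<open>A\<close> contains all branching
  vertices of the trees that it meets, then exactly one end of every edge below is in the solution.
\<close>

definition xor_edge :: "('a \<Rightarrow> 'a \<Rightarrow> bool) \<Rightarrow> 'a set \<Rightarrow> 'a set \<Rightarrow> 'a \<Rightarrow> 'a \<Rightarrow> bool" where
  "xor_edge E A Z x y \<longleftrightarrow> E x y \<and> x \<notin> A \<and> y \<notin> A \<and>
     (x \<in> Z \<or> y \<in> Z \<or> (\<exists>a\<in>A. E a x) \<or> (\<exists>a\<in>A. E a y))"

text \<open>A forest vertex outside \<open>A\<close> with two neighbours in \<open>A\<close> would
  be a branching vertex next to \<open>A\<close>, which a good guess has put into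
  \<open>A\<close>.\<close>

definition forced :: "('a \<Rightarrow> 'a \<Rightarrow> bool) \<Rightarrow> 'a set \<Rightarrow> 'a set \<Rightarrow> 'a \<Rightarrow> bool" where
  "forced E A Z x \<longleftrightarrow> x \<in> Z \<or> (\<exists>a\<in>A. \<exists>b\<in>A. a \<noteq> b \<and> E a x \<and> E b x)"

definition admissible :: "('a \<Rightarrow> 'a \<Rightarrow> bool) \<Rightarrow> 'a set \<Rightarrow> 'a set \<Rightarrow> 'a set \<Rightarrow> 'a set \<Rightarrow> bool" where
  "admissible E C A Z S \<longleftrightarrow> S \<inter> A = {} \<and> (\<forall>x\<in>C - A. forced E A Z x \<longrightarrow> x \<in> S) \<and>
     (\<forall>x\<in>C. \<forall>y\<in>C. xor_edge E A Z x y \<longrightarrow> (x \<in> S \<longleftrightarrow> y \<notin> S))"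

definition covered :: "('a \<Rightarrow> 'a \<Rightarrow> bool) \<Rightarrow> 'a set \<Rightarrow> 'a set \<Rightarrow> 'a set \<Rightarrow> bool" where
  "covered E C A Z \<longleftrightarrow> (\<forall>x\<in>C - A. x \<in> Z \<or> (\<exists>z\<in>Z. E z x) \<or> (\<exists>a\<in>A. E a x))"

text \<open>\<open>S\<close> only certifies the guess; \<open>T\<close> may be a different set. An
  edge inside \<open>T\<close> is not a xor edge, so its ends are outside \<open>Z\<close> and have
  no neighbour in \<open>A\<close>. By covering, an end then has a neighbour in \<open>Z\<close>,
  and that edge is a xor edge with both ends in \<open>T\<close>.\<close>

lemma (in p5_free) ifvs_if_admissible:
  assumes opt: "ifvs E C S" "A \<subseteq> C - S" "Z \<subseteq> S" and cov: "covered E C A Z"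
    and T: "T \<subseteq> C" "admissible E C A Z T"
  shows "ifvs E C T"
proof -
  have xor: "x \<in> T \<longleftrightarrow> y \<notin> T" if "x \<in> C" "y \<in> C" "xor_edge E A Z x y" for x y
    using T(2) that unfolding admissible_def by blast
  have frc: "x \<in> T" if "x \<in> C" "x \<notin> A" "forced E A Z x" for x
    using T(2) that unfolding admissible_def by blast
  have TA: "T \<inter> A = {}" using T(2) unfolding admissible_def by blast
  have SC: "S \<subseteq> C" using opt(1) unfolding ifvs_def by blast
  have ZT: "z \<in> T" if "z \<in> Z" for z
    using frc[of z] that opt(2,3) SC unfolding forced_def by blast
  have nbrZ: "x \<notin> T" if "x \<in> C" "z \<in> Z" "E z x" for x z
  proof (cases "x \<in> A")
    case False
    have "z \<in> C" "z \<notin> A" using that(2) opt(2,3) SC by blast+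
    then show ?thesis using xor[of z x] ZT[OF that(2)] that False unfolding xor_edge_def by blast
  qed (use TA in blast)
  have indep: "\<not> E x y" if "x \<in> T" "y \<in> T" for x y
  proof
    assume "E x y"
    have xy: "x \<in> C" "y \<in> C" "x \<notin> A" "y \<notin> A" using that TA T(1) by auto
    then have "\<not> xor_edge E A Z x y" using xor[of x y] that by blast
    then have "x \<notin> Z" "\<not> (\<exists>a\<in>A. E a x)" using \<open>E x y\<close> xy unfolding xor_edge_def by blast+
    then obtain z where "z \<in> Z" "E z x" using cov xy unfolding covered_def by blast
    then show False using nbrZ xy that by blast
  qed
  have "acyclic_on E (C - T)"
    unfolding acyclic_on_def
  proof (intro allI impI)
    fix W assume W: "W \<subseteq> C - T \<and> W \<noteq> {}"
    show "\<exists>v\<in>W. \<forall>u\<in>W. \<forall>w\<in>W. E v u \<and> E v w \<longrightarrow> u = w"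
    \<comment> \<open>Next to \<open>A\<close>, a vertex of \<open>W - A\<close> has no neighbour in
      \<open>W\<close> outside \<open>A\<close>, by the xor edges, and at most one in
      \<open>A\<close>, as it would be forced otherwise.\<close>
    proof (cases "\<exists>x\<in>W - A. \<exists>a\<in>A. E a x")
      case True
      then obtain x a where x: "x \<in> W" "x \<notin> A" "a \<in> A" "E a x" by blast
      have "u \<in> A" if "u \<in> W" "E x u" for u
      proof (rule ccontr)
        assume "u \<notin> A"
        then have "xor_edge E A Z x u" using that x unfolding xor_edge_def by blast
        then show False using xor[of x u] that x(1) W by blast
      qed
      moreover have "u = w" if "u \<in> A" "w \<in> A" "E x u" "E x w" for u w
      proof (rule ccontr)
        assume "u \<noteq> w"
        then have "forced E A Z x" using that sym[of x] unfolding forced_def by blast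
        then show False using frc[of x] x W by blast
      qed
      ultimately show ?thesis using x(1) by blast
    next
      case False
      \<comment> \<open>Every vertex of \<open>W - A\<close> now has a neighbour in
        \<open>Z\<close>, hence in \<open>S\<close>, and independence of \<open>S\<close> puts it
        into the original forest.\<close>
      have "W \<subseteq> C - S"
      proof
        fix x assume x: "x \<in> W"
        show "x \<in> C - S"
        proof (cases "x \<in> A")
          case True then show ?thesis using opt(2) by blast
        next
          case nA: False
          then have "x \<notin> Z" "\<not> (\<exists>a\<in>A. E a x)" using x False ZT W by blast+
          then obtain z where "z \<in> Z" "E z x" using cov nA x W unfolding covered_def by blast
          then have "x \<notin> S" using opt(1,3) unfolding ifvs_def by blast
          then show ?thesis using x W by blast
        qed
      qed
      then show ?thesis using opt(1) W unfolding ifvs_def acyclic_on_def by blast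
    qed
  qed
  then show ?thesis using T(1) indep unfolding ifvs_def by blast
qed

text \<open>A forest vertex outside \<open>A\<close> with a neighbour in \<open>A\<close> is a leaf,
  so that neighbour is its only one in the forest. All its other neighbours are in
  \<open>S\<close>.\<close>

lemma (in p5_free) admissible_if_branching_closed:
  assumes opt: "ifvs E C S" "A \<subseteq> C - S" "Z \<subseteq> S"
    and br: "\<And>x a. x \<in> (C - S) - A \<Longrightarrow> a \<in> A \<Longrightarrow> E x a \<Longrightarrow> \<not> branching E (C - S) x"
  shows "admissible E C A Z S"
proof -
  have ind: "\<not> E x y" if "x \<in> S" "y \<in> S" for x y using opt(1) that unfolding ifvs_def by blast
  have uniq: "u = w" if x: "x \<in> (C - S) - A" and "a \<in> A" "E a x" and u: "u \<in> C - S" "E x u"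
    and w: "w \<in> C - S" "E x w" for x a u w
    using br[OF x \<open>a \<in> A\<close> sym[OF \<open>E a x\<close>]] u w unfolding branching_def by blast
  have leaf: "y \<in> S" if "x \<in> (C - S) - A" "a \<in> A" "E a x" "y \<in> C - A" "E x y" for x y a
  proof (rule ccontr)
    assume "y \<notin> S"
    then have "y = a" using uniq[of x a y a] that opt(2) sym[OF that(3)] by blast
    then show False using that by blast
  qed
  have "x \<in> S" if x: "x \<in> C - A" and frc: "forced E A Z x" for x
  proof (rule ccontr)
    assume "x \<notin> S"
    then obtain a b where ab: "a \<in> A" "b \<in> A" "a \<noteq> b" "E a x" "E b x"
      using frc opt(3) unfolding forced_def by blast
    have "a = b" using uniq[of x a a b] ab sym[OF ab(4)] sym[OF ab(5)] x \<open>x \<notin> S\<close> opt(2) by blast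
    then show False using ab by blast
  qed
  moreover have "x \<in> S \<longleftrightarrow> y \<notin> S" if x: "x \<in> C" and y: "y \<in> C" and e: "xor_edge E A Z x y" for x y
  proof -
    have xy: "E x y" "E y x" "x \<notin> A" "y \<notin> A" using e sym unfolding xor_edge_def by blast+
    have "\<not> (x \<in> S \<and> y \<in> S)" using ind xy(1) by blast
    moreover have "x \<in> S \<or> y \<in> S"
    proof (rule ccontr)
      assume n: "\<not> (x \<in> S \<or> y \<in> S)"
      then have "x \<notin> Z" "y \<notin> Z" using opt(3) by blast+
      then consider a where "a \<in> A" "E a x" | a where "a \<in> A" "E a y"
        using e unfolding xor_edge_def by blast
      then show False
        by cases (use leaf[of x _ y] leaf[of y _ x] xy x y n in blast)+
    qed
    ultimately show ?thesis by blast
  qed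
  ultimately show ?thesis using opt(2) unfolding admissible_def by blast
qed

text \<open>Each vertex of a dominating triple contributes three signed entries: itself three times
  if it is in \<open>S\<close>, and its branching closure otherwise. The closure property survives
  the union because it concerns one member of \<open>A\<close> at a time.\<close>

lemma (in p5_free) good_guess_exists:
  assumes opt: "ifvs E C S" and dom: "triple_dominated E C"
    and closed: "\<And>x y. x \<in> C \<Longrightarrow> E x y \<Longrightarrow> y \<in> C"
  obtains L where "length L = 9" "set L \<subseteq> UNIV \<times> C"
    and "{v. (True, v) \<in> set L} \<subseteq> C - S" "{v. (False, v) \<in> set L} \<subseteq> S"
    and "covered E C {v. (True, v) \<in> set L} {v. (False, v) \<in> set L}"
    and "admissible E C {v. (True, v) \<in> set L} {v. (False, v) \<in> set L} S"
proof -
  let ?F = "C - S"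
  have ac: "acyclic_on E ?F" and SC: "S \<subseteq> C" using opt unfolding ifvs_def by blast+
  define P where "P d l \<longleftrightarrow> length l = 3 \<and> (\<exists>s. (s, d) \<in> set l) \<and>
      (\<forall>s v. (s, v) \<in> set l \<longrightarrow> (if s then v \<in> ?F else v \<in> S)) \<and>
      (\<forall>x a. x \<in> ?F \<longrightarrow> (True, x) \<notin> set l \<longrightarrow> (True, a) \<in> set l \<longrightarrow> E x a \<longrightarrow> \<not> branching E ?F x)"
    for d l
  have "\<exists>l. P d l" if "d \<in> C" for d
  proof (cases "d \<in> S")
    case True
    then show ?thesis unfolding P_def by (intro exI[of _ "[(False, d), (False, d), (False, d)]"]) auto
  next
    case False
    then have d: "d \<in> ?F" using that by blast
    obtain c e where ce: "c \<in> ?F" "e \<in> ?F"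
      "\<And>x a. x \<in> ?F - {d, c, e} \<Longrightarrow> a \<in> {d, c, e} \<Longrightarrow> E x a \<Longrightarrow> \<not> branching E ?F x"
      using branching_closure[OF ac d] by metis
    let ?l = "[(True, d), (True, c), (True, e)]"
    have "\<forall>x a. x \<in> ?F \<longrightarrow> (True, x) \<notin> set ?l \<longrightarrow> (True, a) \<in> set ?l \<longrightarrow> E x a \<longrightarrow> \<not> branching E ?F x"
      using ce(3) by simp
    then show ?thesis using ce(1,2) d unfolding P_def by (intro exI[of _ ?l]) auto
  qed
  then obtain f where "\<forall>d\<in>C. P d (f d)" by metis
  then have f: "\<And>d. d \<in> C \<Longrightarrow> length (f d) = 3" "\<And>d. d \<in> C \<Longrightarrow> \<exists>s. (s, d) \<in> set (f d)"
    "\<And>d s v. d \<in> C \<Longrightarrow> (s, v) \<in> set (f d) \<Longrightarrow> if s then v \<in> ?F else v \<in> S"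
    "\<And>d x a. d \<in> C \<Longrightarrow> x \<in> ?F \<Longrightarrow> (True, x) \<notin> set (f d) \<Longrightarrow> (True, a) \<in> set (f d) \<Longrightarrow> E x a
      \<Longrightarrow> \<not> branching E ?F x"
    unfolding P_def by blast+
  obtain x y z where xyz: "x \<in> C" "y \<in> C" "z \<in> C" "dominating E {x, y, z} C"
    using dom unfolding triple_dominated_def by blast
  define L where "L = f x @ f y @ f z"
  define A Z where "A = {v. (True, v) \<in> set L}" and "Z = {v. (False, v) \<in> set L}"
  have inL: "p \<in> set L \<Longrightarrow> \<exists>d\<in>C. p \<in> set (f d) \<and> set (f d) \<subseteq> set L" for p
    unfolding L_def using xyz by auto
  have AF: "A \<subseteq> ?F" unfolding A_def using inL f(3) by fastforce
  have ZS: "Z \<subseteq> S" unfolding Z_def using inL f(3) by fastforce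
  have "set L \<subseteq> UNIV \<times> C"
  proof
    fix p assume "p \<in> set L"
    moreover obtain s v where p: "p = (s, v)" by (cases p)
    ultimately have "v \<in> A \<or> v \<in> Z" unfolding A_def Z_def by (cases s) simp_all
    then show "p \<in> UNIV \<times> C" using AF ZS SC p by auto
  qed
  moreover have "length L = 9" unfolding L_def using f(1) xyz by simp
  moreover have "covered E C A Z"
    unfolding covered_def
  proof
    fix v assume v: "v \<in> C - A"
    then obtain d where d: "d \<in> {x, y, z}" "v = d \<or> E v d" using xyz(4) unfolding dominating_def by blast
    then obtain s where "(s, d) \<in> set L" using f(2) xyz unfolding L_def by fastforce
    then have "d \<in> A \<or> d \<in> Z" unfolding A_def Z_def by (cases s) auto
    then show "v \<in> Z \<or> (\<exists>z\<in>Z. E z v) \<or> (\<exists>a\<in>A. E a v)" using d(2) v sym[of v d] by blast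
  qed
  moreover have "admissible E C A Z S"
  proof (rule admissible_if_branching_closed[OF opt AF ZS])
    fix v a assume v: "v \<in> ?F - A" and a: "a \<in> A" and e: "E v a"
    obtain d where d: "d \<in> C" "(True, a) \<in> set (f d)" "set (f d) \<subseteq> set L"
      using inL[of "(True, a)"] a unfolding A_def by blast
    have "(True, v) \<notin> set (f d)" using v d(3) unfolding A_def by blast
    then show "\<not> branching E ?F v" using f(4)[OF d(1) _ _ d(2) e] v by blast
  qed
  ultimately show ?thesis using that[of L] AF ZS unfolding A_def Z_def by blast
qed

section \<open>Loop programs\<close>

text \<open>
  In loop programs the number of iterations of every loop is known when it is entered, and numbers
  grow only by increments. Hence the running time is bounded by a polynomial whose degree is the
  nesting depth of the loops, and the size of all numbers is bounded by the running time.
  A state consists of the registers and of two arrays; the graph is a parameter.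
\<close>

type_synonym lstate = "(nat \<Rightarrow> nat) \<times> (nat \<Rightarrow> nat \<Rightarrow> nat)"

datatype atom = Cst nat | Rg nat | Cell nat nat

datatype test = TLess atom atom | TAdj nat nat | TShift nat nat | TNot test | TAnd test test

datatype lcom = LSkip
  | LAssign nat atom
  | LInc nat
  | LStore nat nat atom
  | LSeq lcom lcom
  | LIf test lcom lcom
  | LFor nat nat lcom

definition upd :: "nat \<Rightarrow> nat \<Rightarrow> lstate \<Rightarrow> lstate" where
  "upd x v s = ((fst s)(x := v), snd s)"

primrec loop :: "nat \<Rightarrow> (nat \<Rightarrow> 's \<Rightarrow> 's) \<Rightarrow> 's \<Rightarrow> 's" where
  "loop 0 f s = s"
| "loop (Suc i) f s = f i (loop i f s)"

primrec atom_val :: "atom \<Rightarrow> lstate \<Rightarrow> nat" where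
  "atom_val (Cst c) s = c"
| "atom_val (Rg x) s = fst s x"
| "atom_val (Cell k x) s = snd s k (fst s x)"

context
  fixes E :: "nat \<Rightarrow> nat \<Rightarrow> bool" and n :: nat
begin

primrec test_val :: "test \<Rightarrow> lstate \<Rightarrow> bool" where
  "test_val (TLess a b) s \<longleftrightarrow> atom_val a s < atom_val b s"
| "test_val (TAdj x y) s \<longleftrightarrow> E (fst s x) (fst s y)"
| "test_val (TShift x y) s \<longleftrightarrow> fst s x = fst s y + n"
| "test_val (TNot b) s \<longleftrightarrow> \<not> test_val b s"
| "test_val (TAnd b c) s \<longleftrightarrow> test_val b s \<and> test_val c s"

text \<open>After \<open>LFor\<close> the counter holds \<open>a * n\<close>, as it does after the
  compiled \<open>While\<close>.\<close>

primrec run :: "lcom \<Rightarrow> lstate \<Rightarrow> lstate" where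
  "run LSkip s = s"
| "run (LAssign x a) s = upd x (atom_val a s) s"
| "run (LInc x) s = upd x (Suc (fst s x)) s"
| "run (LStore k x a) s = (fst s, (snd s)(k := (snd s k)(fst s x := atom_val a s)))"
| "run (LSeq c d) s = run d (run c s)"
| "run (LIf b c d) s = (if test_val b s then run c s else run d s)"
| "run (LFor x a c) s = upd x (a * n) (loop (a * n) (\<lambda>i s. run c (upd x i s)) s)"

end

primrec writes :: "lcom \<Rightarrow> nat set" where
  "writes LSkip = {}"
| "writes (LAssign x a) = {x}"
| "writes (LInc x) = {x}"
| "writes (LStore k x a) = {}"
| "writes (LSeq c d) = writes c \<union> writes d"
| "writes (LIf b c d) = writes c \<union> writes d"
| "writes (LFor x a c) = insert x (writes c)"

primrec stores :: "lcom \<Rightarrow> nat set" where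
  "stores LSkip = {}"
| "stores (LAssign x a) = {}"
| "stores (LInc x) = {}"
| "stores (LStore k x a) = {k}"
| "stores (LSeq c d) = stores c \<union> stores d"
| "stores (LIf b c d) = stores c \<union> stores d"
| "stores (LFor x a c) = stores c"

lemma fst_upd [simp]: "fst (upd x v s) = (fst s)(x := v)" and snd_upd [simp]: "snd (upd x v s) = snd s"
  by (simp_all add: upd_def)

lemma loop_inv:
  assumes "I 0 s" "\<And>i s. i < m \<Longrightarrow> I i s \<Longrightarrow> I (Suc i) (f i s)"
  shows "I m (loop m f s)"
proof -
  have "j \<le> m \<Longrightarrow> I j (loop j f s)" for j
    by (induction j) (simp_all add: assms)
  then show ?thesis by simp
qed

lemma run_For_inv:
  assumes "I 0 s" "\<And>i s. i < a * n \<Longrightarrow> I i s \<Longrightarrow> I (Suc i) (run E n c (upd x i s))"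
  obtains s' where "run E n (LFor x a c) s = upd x (a * n) s'" "I (a * n) s'"
  using loop_inv[of I s "a * n" "\<lambda>i s. run E n c (upd x i s)"] assms that by simp

lemma run_frame: "x \<notin> writes c \<Longrightarrow> fst (run E n c s) x = fst s x"
proof (induction c arbitrary: s)
  case (LFor y a c)
  then have "fst (loop (a * n) (\<lambda>i s. run E n c (upd y i s)) s) x = fst s x"
    by (intro loop_inv[where I = "\<lambda>i s'. fst s' x = fst s x"]) auto
  then show ?case using LFor.prems by simp
qed auto

lemma run_array_frame: "k \<notin> stores c \<Longrightarrow> snd (run E n c s) k = snd s k"
proof (induction c arbitrary: s)
  case (LFor y a c)
  then have "snd (loop (a * n) (\<lambda>i s. run E n c (upd y i s)) s) k = snd s k"
    by (intro loop_inv[where I = "\<lambda>i s'. snd s' k = snd s k"]) auto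
  then show ?case by simp
qed auto

primrec depth :: "lcom \<Rightarrow> nat" where
  "depth LSkip = 0"
| "depth (LAssign x a) = 0"
| "depth (LInc x) = 0"
| "depth (LStore k x a) = 0"
| "depth (LSeq c d) = max (depth c) (depth d)"
| "depth (LIf b c d) = max (depth c) (depth d)"
| "depth (LFor x a c) = Suc (depth c)"

text \<open>For \<open>LFor\<close> these are the initial assignment and the failing test, and in
  each round a test and an increment besides the body. A conditional is charged for both branches,
  so that the bound does not depend on the state.\<close>

primrec steps :: "nat \<Rightarrow> lcom \<Rightarrow> nat" where
  "steps n LSkip = 1"
| "steps n (LAssign x a) = 1"
| "steps n (LInc x) = 1"
| "steps n (LStore k x a) = 1"
| "steps n (LSeq c d) = steps n c + steps n d"
| "steps n (LIf b c d) = 1 + steps n c + steps n d"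
| "steps n (LFor x a c) = 2 + (a * n) * (steps n c + 2)"

lemma steps_polynomial: "\<exists>K. \<forall>n. steps n c \<le> K * Suc n ^ depth c"
proof (induction c)
  case (LSeq c d)
  then obtain K L where K: "\<And>n. steps n c \<le> K * Suc n ^ depth c" "\<And>n. steps n d \<le> L * Suc n ^ depth d" by blast
  have "steps n c + steps n d \<le> (K + L) * Suc n ^ max (depth c) (depth d)" for n
  proof -
    have "K * Suc n ^ depth c \<le> K * Suc n ^ max (depth c) (depth d)"
      "L * Suc n ^ depth d \<le> L * Suc n ^ max (depth c) (depth d)"
      by (intro mult_left_mono power_increasing; simp)+
    then show ?thesis using K[of n] unfolding add_mult_distrib by linarith
  qed
  then show ?case by auto
next
  case (LIf b c d)
  then obtain K L where K: "\<And>n. steps n c \<le> K * Suc n ^ depth c" "\<And>n. steps n d \<le> L * Suc n ^ depth d" by blast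
  have "1 + steps n c + steps n d \<le> (1 + K + L) * Suc n ^ max (depth c) (depth d)" for n
  proof -
    have "K * Suc n ^ depth c \<le> K * Suc n ^ max (depth c) (depth d)"
      "L * Suc n ^ depth d \<le> L * Suc n ^ max (depth c) (depth d)"
      by (intro mult_left_mono power_increasing; simp)+
    moreover have "1 \<le> Suc n ^ max (depth c) (depth d)" by simp
    ultimately show ?thesis using K[of n] unfolding add_mult_distrib mult_1 by linarith
  qed
  then show ?case by (metis depth.simps(6) steps.simps(6))
next
  case (LFor x a c)
  then obtain K where K: "\<And>n. steps n c \<le> K * Suc n ^ depth c" by blast
  have "2 + (a * n) * (steps n c + 2) \<le> (2 + a * (K + 2)) * Suc n ^ Suc (depth c)" for n
  proof -
    have p: "1 \<le> Suc n ^ depth c" "1 \<le> Suc n ^ Suc (depth c)" by (rule one_le_power, simp)+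
    have "a * n \<le> a * Suc n" by simp
    moreover have "steps n c + 2 \<le> (K + 2) * Suc n ^ depth c"
      using K[of n] p(1) unfolding add_mult_distrib by linarith
    ultimately have "(a * n) * (steps n c + 2) \<le> (a * Suc n) * ((K + 2) * Suc n ^ depth c)"
      by (rule mult_le_mono)
    also have "\<dots> = (a * (K + 2)) * Suc n ^ Suc (depth c)" by (simp only: power_Suc mult_ac)
    finally show ?thesis using p(2) unfolding add_mult_distrib by linarith
  qed
  then show ?case by (metis depth.simps(7) steps.simps(7))
qed (rule exI[of _ 1], simp)+

section \<open>Translation to the random access machine\<close>

primrec acompile :: "atom \<Rightarrow> aexp" where
  "acompile (Cst c) = Const c"
| "acompile (Rg x) = Reg x"
| "acompile (Cell k x) = Mem (Plus (Times (Reg 0) (Reg 0)) (Plus (Times (Const 2) (Reg x)) (Const k)))"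

text \<open>The range tests in \<open>TAdj\<close> matter: a guess register may hold
  \<open>n + v\<close>, for which the address computed from it would not be that of a matrix entry
  in the intended row and column.\<close>

primrec tcompile :: "test \<Rightarrow> bexp" where
  "tcompile (TLess a b) = Less (acompile a) (acompile b)"
| "tcompile (TAdj x y) = Conj (Less (Reg x) (Reg 0)) (Conj (Less (Reg y) (Reg 0))
     (Less (Const 0) (Mem (Plus (Times (Reg x) (Reg 0)) (Reg y)))))"
| "tcompile (TShift x y) = Conj (Neg (Less (Reg x) (Plus (Reg y) (Reg 0))))
     (Neg (Less (Plus (Reg y) (Reg 0)) (Reg x)))"
| "tcompile (TNot b) = Neg (tcompile b)"
| "tcompile (TAnd b c) = Conj (tcompile b) (tcompile c)"

primrec compile :: "lcom \<Rightarrow> com" where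
  "compile LSkip = Skip"
| "compile (LAssign x a) = Assign x (acompile a)"
| "compile (LInc x) = Assign x (Plus (Reg x) (Const 1))"
| "compile (LStore k x a) =
     Store (Plus (Times (Reg 0) (Reg 0)) (Plus (Times (Const 2) (Reg x)) (Const k))) (acompile a)"
| "compile (LSeq c d) = Seq (compile c) (compile d)"
| "compile (LIf b c d) = IfElse (tcompile b) (compile c) (compile d)"
| "compile (LFor x a c) = Seq (Assign x (Const 0))
     (While (Less (Reg x) (Times (Const a) (Reg 0)))
       (Seq (compile c) (Assign x (Plus (Reg x) (Const 1)))))"

primrec cell_ok :: "atom \<Rightarrow> bool" where
  "cell_ok (Cst c) \<longleftrightarrow> True"
| "cell_ok (Rg x) \<longleftrightarrow> True"
| "cell_ok (Cell k x) \<longleftrightarrow> k < 2"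

primrec aok :: "nat \<Rightarrow> atom \<Rightarrow> bool" where
  "aok B (Cst c) \<longleftrightarrow> c \<le> B"
| "aok B (Rg x) \<longleftrightarrow> True"
| "aok B (Cell k x) \<longleftrightarrow> k < 2"

primrec tok :: "test \<Rightarrow> bool" where
  "tok (TLess a b) \<longleftrightarrow> cell_ok a \<and> cell_ok b"
| "tok (TAdj x y) \<longleftrightarrow> True"
| "tok (TShift x y) \<longleftrightarrow> True"
| "tok (TNot b) \<longleftrightarrow> tok b"
| "tok (TAnd b c) \<longleftrightarrow> tok b \<and> tok c"

text \<open>Register 0 must keep the number of vertices, which determines all addresses.\<close>

primrec cok :: "nat \<Rightarrow> lcom \<Rightarrow> bool" where
  "cok B LSkip \<longleftrightarrow> True"
| "cok B (LAssign x a) \<longleftrightarrow> x \<noteq> 0 \<and> aok B a"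
| "cok B (LInc x) \<longleftrightarrow> x \<noteq> 0"
| "cok B (LStore k x a) \<longleftrightarrow> k < 2 \<and> aok B a"
| "cok B (LSeq c d) \<longleftrightarrow> cok B c \<and> cok B d"
| "cok B (LIf b c d) \<longleftrightarrow> tok b \<and> cok B c \<and> cok B d"
| "cok B (LFor x a c) \<longleftrightarrow> x \<noteq> 0 \<and> x \<notin> writes c \<and> cok B c"

text \<open>The two arrays are interleaved behind the adjacency matrix, cell \<open>i\<close> of
  array \<open>k\<close> at address \<open>n * n + 2 * i + k\<close>. Thus neither array needs a
  length.\<close>

definition conc :: "(nat \<Rightarrow> nat \<Rightarrow> bool) \<Rightarrow> nat \<Rightarrow> lstate \<Rightarrow> state" where
  "conc E n s = (fst s, \<lambda>a. if a < n * n then (if E (a div n) (a mod n) then 1 else 0)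
     else snd s ((a - n * n) mod 2) ((a - n * n) div 2))"

lemma fst_conc [simp]: "fst (conc E n s) = fst s"
  by (simp add: conc_def)

lemma conc_upd: "conc E n (upd x v s) = ((fst s)(x := v), snd (conc E n s))"
  by (simp add: conc_def fun_eq_iff)

definition bounded_by :: "nat \<Rightarrow> lstate \<Rightarrow> bool" where
  "bounded_by B s \<longleftrightarrow> (\<forall>x. fst s x \<le> B) \<and> (\<forall>k i. snd s k i \<le> B)"

lemma bounded_by_mono: "bounded_by B s \<Longrightarrow> B \<le> B' \<Longrightarrow> bounded_by B' s"
  unfolding bounded_by_def using le_trans by blast

lemma bounded_by_upd: "bounded_by B s \<Longrightarrow> v \<le> B \<Longrightarrow> bounded_by B (upd x v s)"
  unfolding bounded_by_def by simp

lemma cok_mono: "cok B c \<Longrightarrow> B \<le> B' \<Longrightarrow> cok B' c"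
proof -
  have "aok B a \<Longrightarrow> B \<le> B' \<Longrightarrow> aok B' a" for a by (cases a) auto
  then show "cok B c \<Longrightarrow> B \<le> B' \<Longrightarrow> cok B' c" by (induction c) auto
qed

lemma cok_0_notin_writes: "cok B c \<Longrightarrow> 0 \<notin> writes c"
  by (induction c) auto

lemma cell_ok_if_aok: "aok B a \<Longrightarrow> cell_ok a"
  by (cases a) auto

lemma aval_acompile:
  assumes "cell_ok a" "fst s 0 = n"
  shows "aval (acompile a) (conc E n s) = atom_val a s"
  using assms by (cases a) (auto simp: conc_def)

lemma atom_val_bounded: "aok B a \<Longrightarrow> bounded_by B s \<Longrightarrow> atom_val a s \<le> B"
  by (cases a) (auto simp: bounded_by_def)

lemma bval_tcompile:
  assumes "tok b" "fst s 0 = n" "\<And>x y. E x y \<Longrightarrow> x < n \<and> y < n"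
  shows "bval (tcompile b) (conc E n s) = test_val E n b s"
  using assms(1)
proof (induction b)
  case (TLess a b)
  then show ?case using aval_acompile[OF _ assms(2)] by simp
next
  case (TAdj x y)
  have "i * n + j < n * n \<and> (i * n + j) div n = i \<and> (i * n + j) mod n = j" if "i < n" "j < n" for i j
  proof -
    have "n \<noteq> 0" using that by simp
    have "i * n + j < i * n + n" using that by simp
    also have "\<dots> \<le> n * n" using that mult_le_mono1[of "Suc i" n n] by simp
    finally show ?thesis using that \<open>n \<noteq> 0\<close> by simp
  qed
  then show ?case using assms(2,3)
    by (cases "fst s x < n \<and> fst s y < n") (auto simp: conc_def)
next
  case (TShift x y)
  then show ?case using assms(2) by (auto simp: conc_def)
qed auto

lemma conc_store:
  assumes "k < 2"
  shows "(fst s, (snd (conc E n s))(n * n + (2 * i + k) := v)) =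
    conc E n (fst s, (snd s)(k := (snd s k)(i := v)))"
proof -
  have "(snd (conc E n s))(n * n + (2 * i + k) := v) =
      snd (conc E n (fst s, (snd s)(k := (snd s k)(i := v))))"
  proof
    fix a
    show "((snd (conc E n s))(n * n + (2 * i + k) := v)) a =
        snd (conc E n (fst s, (snd s)(k := (snd s k)(i := v)))) a"
    proof (cases "a < n * n")
      case False
      define j where "j = a - n * n"
      have a: "a = n * n + j" using False j_def by simp
      show ?thesis
      proof (cases "j = 2 * i + k")
        case True
        then have "j mod 2 = k" "j div 2 = i" using assms by simp_all
        then show ?thesis using True by (simp add: conc_def a)
      next
        case False
        have "j = 2 * (j div 2) + j mod 2" by simp
        then have "j mod 2 \<noteq> k \<or> j div 2 \<noteq> i" using False by metis
        then show ?thesis using False by (auto simp: conc_def a)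
      qed
    qed (simp add: conc_def)
  qed
  then show ?thesis by (simp add: conc_def)
qed

text \<open>\<open>B\<close> varies in the induction because it grows along the program: no step
  raises the largest number by more than 1. Addresses exceed twice such a number by at most
  \<open>n * n + 1\<close>, which explains the condition on \<open>W\<close>.\<close>

lemma exec_compile:
  assumes E: "\<And>x y. E x y \<Longrightarrow> x < n \<and> y < n"
  shows "cok B c \<Longrightarrow> fst s 0 = n \<Longrightarrow> bounded_by B s \<Longrightarrow> n * n + 2 * (B + steps n c) + 2 \<le> W \<Longrightarrow>
    bounded_by (B + steps n c) (run E n c s) \<and>
    (\<exists>t\<le>steps n c. exec W (compile c) (conc E n s) t (conc E n (run E n c s)))"
proof (induction c arbitrary: s B)
  case LSkip
  then show ?case using exec.Skip[of W] bounded_by_mono[of B s "B + 1"] by (intro conjI exI[of _ 1]) simp_all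
next
  case (LAssign x a)
  have v: "aval (acompile a) (conc E n s) = atom_val a s" "atom_val a s \<le> B"
    using LAssign.prems aval_acompile[of a s n E] cell_ok_if_aok[of B a] atom_val_bounded[of B a s] by auto
  then have "exec W (Assign x (acompile a)) (conc E n s) 1 (conc E n (upd x (atom_val a s) s))"
    using exec.Assign[of "acompile a" "conc E n s" W x] LAssign.prems by (simp add: conc_upd)
  moreover have "bounded_by (B + 1) (upd x (atom_val a s) s)"
    using bounded_by_upd bounded_by_mono LAssign.prems v(2) by (meson le_add1 le_trans)
  ultimately show ?case using v by (intro conjI exI[of _ 1]) simp_all
next
  case (LInc x)
  have v: "Suc (fst s x) \<le> B + 1" using LInc.prems(3) by (simp add: bounded_by_def)
  then have "exec W (Assign x (Plus (Reg x) (Const 1))) (conc E n s) 1 (conc E n (upd x (Suc (fst s x)) s))"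
    using exec.Assign[of "Plus (Reg x) (Const 1)" "conc E n s" W x] LInc.prems by (simp add: conc_upd)
  moreover have "bounded_by (B + 1) (upd x (Suc (fst s x)) s)"
    using bounded_by_upd bounded_by_mono LInc.prems v by (meson le_add1)
  ultimately show ?case using v by (intro conjI exI[of _ 1]) simp_all
next
  case (LStore k x a)
  let ?e = "Plus (Times (Reg 0) (Reg 0)) (Plus (Times (Const 2) (Reg x)) (Const k))"
  have v: "aval (acompile a) (conc E n s) = atom_val a s" "atom_val a s \<le> B" and k: "k < 2"
    using LStore.prems aval_acompile[of a s n E] cell_ok_if_aok[of B a] atom_val_bounded[of B a s] by auto
  have ad: "aval ?e (conc E n s) = n * n + (2 * fst s x + k)" using LStore.prems by (simp add: conc_upd)
  have "fst s x \<le> B" using LStore.prems(3) by (simp add: bounded_by_def)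
  then have W: "n * n + (2 * fst s x + k) \<le> W" "atom_val a s \<le> W" using LStore.prems(4) k v by auto
  have "exec W (Store ?e (acompile a)) (conc E n s) 1
      (fst (conc E n s), (snd (conc E n s))(n * n + (2 * fst s x + k) := atom_val a s))"
    using exec.Store[of ?e "conc E n s" W "acompile a"] W unfolding ad v(1) by simp
  moreover have "bounded_by (B + 1) (run E n (LStore k x a) s)"
    using LStore.prems(3) v(2) by (auto simp: bounded_by_def le_SucI)
  ultimately show ?case using conc_store[OF k, of s E n "fst s x" "atom_val a s"]
    by (intro conjI exI[of _ 1]) (simp_all add: conc_upd)
next
  case (LSeq c d)
  let ?s = "run E n c s"
  have 1: "bounded_by (B + steps n c) ?s"
    and "\<exists>t\<le>steps n c. exec W (compile c) (conc E n s) t (conc E n ?s)"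
    using LSeq.IH(1)[of B s] LSeq.prems by auto
  then obtain t where t: "t \<le> steps n c" "exec W (compile c) (conc E n s) t (conc E n ?s)" by blast
  have "fst ?s 0 = n" using LSeq.prems run_frame cok_0_notin_writes by (metis cok.simps(5))
  then have 2: "bounded_by (B + steps n c + steps n d) (run E n d ?s)"
    and "\<exists>t\<le>steps n d. exec W (compile d) (conc E n ?s) t (conc E n (run E n d ?s))"
    using LSeq.IH(2)[of "B + steps n c" ?s] LSeq.prems 1 cok_mono[of B d "B + steps n c"] by auto
  then obtain u where "u \<le> steps n d" "exec W (compile d) (conc E n ?s) u (conc E n (run E n d ?s))" by blast
  then have "exec W (compile (LSeq c d)) (conc E n s) (t + u) (conc E n (run E n (LSeq c d) s))"
    "t + u \<le> steps n (LSeq c d)" using t exec.Seq by auto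
  then show ?case using 2 by (auto simp: add.assoc)
next
  case (LIf b c d)
  have b: "bval (tcompile b) (conc E n s) = test_val E n b s"
    using bval_tcompile[OF _ _ E] LIf.prems by auto
  define e where "e = (if test_val E n b s then c else d)"
  have e: "steps n e \<le> steps n c + steps n d" "run E n (LIf b c d) s = run E n e s" by (simp_all add: e_def)
  have "bounded_by (B + steps n e) (run E n e s) \<and>
      (\<exists>t\<le>steps n e. exec W (compile e) (conc E n s) t (conc E n (run E n e s)))"
    using LIf.IH[of B s] LIf.prems by (simp add: e_def)
  then obtain t where bnd: "bounded_by (B + steps n e) (run E n e s)" and "t \<le> steps n e"
    and exec: "exec W (compile e) (conc E n s) t (conc E n (run E n e s))" by blast
  have "exec W (compile (LIf b c d)) (conc E n s) (1 + t) (conc E n (run E n e s))"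
  proof (cases "test_val E n b s")
    case True
    then show ?thesis using exec.IfTrue[of "tcompile b"] exec b by (simp add: e_def)
  next
    case False
    then show ?thesis using exec.IfFalse[of "tcompile b"] exec b by (simp add: e_def)
  qed
  moreover have "bounded_by (B + steps n (LIf b c d)) (run E n e s)"
    using bounded_by_mono[OF bnd] e(1) by simp
  ultimately show ?case unfolding e(2) using \<open>t \<le> steps n e\<close> e(1)
    by (intro conjI exI[of _ "1 + t"]) simp_all
next
  case (LFor x a c)
  let ?m = "a * n" and ?T = "steps n c"
  let ?f = "\<lambda>i s. run E n c (upd x i s)"
  let ?L = "\<lambda>i. loop i ?f s"
  let ?b = "Less (Reg x) (Times (Const a) (Reg 0))"
  let ?body = "Seq (compile c) (Assign x (Plus (Reg x) (Const 1)))"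
  let ?S = "\<lambda>i. conc E n (upd x i (?L i))"
  have x: "x \<noteq> 0" "x \<notin> writes c" and c: "cok B c" using LFor.prems by auto
  have W: "n * n + 2 * (B + ?m * ?T + 2 + 2 * ?m) + 2 \<le> W"
    using LFor.prems(4) by (simp add: algebra_simps)
  have room: "N + 2 * (B + m + q + T) + 2 \<le> W" if "q + T \<le> y" "N + 2 * (B + y + 2 + 2 * m) + 2 \<le> W"
    for N m q T y :: nat
  proof -
    have "B + m + q + T \<le> B + y + 2 + 2 * m" using that(1) by simp
    then have "N + 2 * (B + m + q + T) + 2 \<le> N + 2 * (B + y + 2 + 2 * m) + 2"
      by (intro add_right_mono add_left_mono mult_le_mono2)
    then show ?thesis using that(2) by (rule le_trans)
  qed
  have room': "Suc i \<le> W" if "i < m" "N + 2 * (B + y + 2 + 2 * m) + 2 \<le> W" for i N m y :: nat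
  proof -
    have "Suc i \<le> N + 2 * (B + y + 2 + 2 * m) + 2" using that(1) by simp
    then show ?thesis using that(2) by (rule le_trans)
  qed
  \<comment> \<open>The counter accounts for \<open>?m\<close>, and each completed round raises the
    bound by at most \<open>?T\<close>.\<close>
  have inv: "fst (?L i) 0 = n \<and> bounded_by (B + ?m + i * ?T) (?L i)" if "i \<le> ?m" for i
    using that
  proof (induction i)
    case 0
    then show ?case using LFor.prems bounded_by_mono[of B s] by simp
  next
    case (Suc i)
    have "fst (upd x i (?L i)) 0 = n" using Suc x by simp
    moreover have "bounded_by (B + ?m + i * ?T) (upd x i (?L i))"
      using Suc by (intro bounded_by_upd) auto
    moreover have "i * ?T + ?T \<le> ?m * ?T" using Suc.prems mult_le_mono1[of "Suc i" ?m ?T] by simp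
    then have "n * n + 2 * (B + ?m + i * ?T + ?T) + 2 \<le> W" by (rule room[OF _ W])
    moreover have "cok (B + ?m + i * ?T) c" using c by (rule cok_mono) simp
    ultimately have "bounded_by (B + ?m + i * ?T + ?T) (run E n c (upd x i (?L i)))"
      using LFor.IH by blast
    moreover have "fst (run E n c (upd x i (?L i))) 0 = n"
      using run_frame[of 0 c] cok_0_notin_writes[OF c] Suc x by simp
    ultimately show ?case by (simp add: algebra_simps)
  qed
  have body: "\<exists>t\<le>?T + 1. exec W ?body (?S i) t (?S (Suc i))" if "i < ?m" for i
  proof -
    have iT: "i * ?T + ?T \<le> ?m * ?T" using that mult_le_mono1[of "Suc i" ?m ?T] by simp
    then have "n * n + 2 * (B + ?m + i * ?T + ?T) + 2 \<le> W" by (rule room[OF _ W])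
    moreover have "cok (B + ?m + i * ?T) c" using c by (rule cok_mono) simp
    moreover have "bounded_by (B + ?m + i * ?T) (upd x i (?L i))"
      using inv[of i] that by (intro bounded_by_upd) auto
    moreover have "fst (upd x i (?L i)) 0 = n" using inv[of i] that x by simp
    ultimately obtain t where t: "t \<le> ?T" "exec W (compile c) (?S i) t (conc E n (?L (Suc i)))"
      using LFor.IH[of "B + ?m + i * ?T" "upd x i (?L i)"] by auto
    have fx: "fst (?L (Suc i)) x = i" using run_frame[OF x(2)] by simp
    have "Suc i \<le> W" by (rule room'[OF that W])
    then have inc: "exec W (Assign x (Plus (Reg x) (Const 1))) (conc E n (?L (Suc i))) 1 (?S (Suc i))"
      using exec.Assign[of "Plus (Reg x) (Const 1)" "conc E n (?L (Suc i))" W x] fx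
      by (simp add: conc_upd)
    show ?thesis using exec.Seq[OF t(2) inc] t(1) by (intro exI[of _ "t + 1"] conjI) simp_all
  qed
  have guard: "bval ?b (?S i) \<longleftrightarrow> i < ?m" if "i \<le> ?m" for i
    using inv[OF that] x by (simp add: conc_upd)
  \<comment> \<open>Induction on the number \<open>j\<close> of rounds still to be made, since a run
    of \<open>While\<close> is composed from its end.\<close>
  have "\<exists>t\<le>1 + j * (?T + 2). exec W (While ?b ?body) (?S (?m - j)) t (?S ?m)" if "j \<le> ?m" for j
    using that
  proof (induction j)
    case 0
    then show ?case using exec.WhileFalse[of ?b "?S ?m" W ?body] guard[of ?m] by auto
  next
    case (Suc j)
    then obtain t where t: "t \<le> 1 + j * (?T + 2)" "exec W (While ?b ?body) (?S (?m - j)) t (?S ?m)" by auto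
    have "?m - Suc j < ?m" "Suc (?m - Suc j) = ?m - j" using Suc.prems by auto
    then obtain u where u: "u \<le> ?T + 1" "exec W ?body (?S (?m - Suc j)) u (?S (?m - j))"
      using body[of "?m - Suc j"] by metis
    have "exec W (While ?b ?body) (?S (?m - Suc j)) (1 + u + t) (?S ?m)"
      using exec.WhileTrue[OF _ u(2) t(2)] guard[of "?m - Suc j"] \<open>?m - Suc j < ?m\<close> by simp
    then show ?case using u(1) t(1) by (intro exI[of _ "1 + u + t"]) simp
  qed
  from this[of ?m] obtain t where t: "t \<le> 1 + ?m * (?T + 2)"
    "exec W (While ?b ?body) (?S 0) t (?S ?m)" by auto
  have init: "exec W (Assign x (Const 0)) (conc E n s) 1 (?S 0)"
    using exec.Assign[of "Const 0" "conc E n s" W x] by (simp add: conc_upd)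
  have "exec W (compile (LFor x a c)) (conc E n s) (1 + t) (conc E n (run E n (LFor x a c) s))"
    using exec.Seq[OF init t(2)] by simp
  moreover have "bounded_by (B + steps n (LFor x a c)) (run E n (LFor x a c) s)"
  proof -
    have "bounded_by (B + ?m + ?m * ?T) (upd x ?m (?L ?m))" using inv[of ?m] by (intro bounded_by_upd) auto
    then show ?thesis by simp (erule bounded_by_mono, simp add: algebra_simps)
  qed
  ultimately show ?case using t(1) by (intro conjI exI[of _ "1 + t"]) simp_all
qed

section \<open>Reasoning about loops\<close>

declare run.simps(7) [simp del]

definition agree :: "nat set \<Rightarrow> nat set \<Rightarrow> lstate \<Rightarrow> lstate \<Rightarrow> bool" where
  "agree X K s s' \<longleftrightarrow> (\<forall>z. z \<notin> X \<longrightarrow> fst s' z = fst s z) \<and> (\<forall>k. k \<notin> K \<longrightarrow> snd s' k = snd s k)"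

lemma agree_refl: "agree X K s s"
  by (simp add: agree_def)

lemma agree_trans: "agree X K s s' \<Longrightarrow> agree X K s' s'' \<Longrightarrow> agree X K s s''"
  by (simp add: agree_def)

lemma agree_mono: "agree X K s s' \<Longrightarrow> X \<subseteq> X' \<Longrightarrow> K \<subseteq> K' \<Longrightarrow> agree X' K' s s'"
  unfolding agree_def by blast

lemma agree_run: "agree (writes c) (stores c) s (run E n c s)"
  by (simp add: agree_def run_frame run_array_frame)

lemma agree_upd: "x \<in> X \<Longrightarrow> agree X K s s' \<Longrightarrow> agree X K s (upd x v s')"
  by (auto simp: agree_def)

abbreviation agree_For :: "nat \<Rightarrow> lcom \<Rightarrow> lstate \<Rightarrow> lstate \<Rightarrow> bool" where
  "agree_For x c \<equiv> agree (insert x (writes c)) (stores c)"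

lemma agree_For_step: "agree_For x c s s' \<Longrightarrow> agree_For x c s (run E n c (upd x i s'))"
proof -
  assume "agree_For x c s s'"
  then have "agree_For x c s (upd x i s')" by (simp add: agree_upd)
  moreover have "agree_For x c (upd x i s') (run E n c (upd x i s'))"
    by (rule agree_mono[OF agree_run]) auto
  ultimately show ?thesis by (rule agree_trans)
qed

text \<open>The frame condition is part of the rule, so that an invariant only has to describe the
  intended effect of the body.\<close>

lemma run_For_rule:
  assumes "I 0 s" "\<And>i s'. i < a * n \<Longrightarrow> agree_For x c s s' \<Longrightarrow> I i s' \<Longrightarrow>
      I (Suc i) (run E n c (upd x i s'))"
  obtains s' where "run E n (LFor x a c) s = upd x (a * n) s'" "agree_For x c s s'" "I (a * n) s'"
proof -
  obtain s' where "run E n (LFor x a c) s = upd x (a * n) s'"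
    "agree_For x c s s' \<and> I (a * n) s'"
    by (rule run_For_inv[of "\<lambda>i s'. agree_For x c s s' \<and> I i s'" s a n E c x])
      (use assms agree_refl agree_For_step in blast)+
  then show ?thesis using that by blast
qed

text \<open>Round \<open>i\<close> finds cell \<open>i\<close> in its original state, because every
  round changes only its own cell.\<close>

lemma run_For_map:
  assumes "\<And>i s'. i < a * n \<Longrightarrow> agree_For x c s s' \<Longrightarrow>
    snd (run E n c (upd x i s')) k = (snd s' k)(i := g i (snd s' k i))"
  shows "snd (run E n (LFor x a c) s) k = (\<lambda>v. if v < a * n then g v (snd s k v) else snd s k v)"
proof -
  obtain s' where "run E n (LFor x a c) s = upd x (a * n) s'"
    "snd s' k = (\<lambda>v. if v < a * n then g v (snd s k v) else snd s k v)"
    by (rule run_For_rule[of "\<lambda>i s'. snd s' k = (\<lambda>v. if v < i then g v (snd s k v) else snd s k v)"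
          s a n x c E]) (auto simp: assms fun_eq_iff less_Suc_eq)
  then show ?thesis by simp
qed

lemma run_For_count:
  assumes "z \<noteq> x" "\<And>i s'. i < a * n \<Longrightarrow> agree_For x c s s' \<Longrightarrow>
    fst (run E n c (upd x i s')) z = (if P i then Suc (fst s' z) else fst s' z)"
  shows "fst (run E n (LFor x a c) s) z = fst s z + card {i. i < a * n \<and> P i}"
proof -
  have "{j. j < Suc i \<and> P j} = (if P i then insert i {j. j < i \<and> P j} else {j. j < i \<and> P j})" for i
    by (auto simp: less_Suc_eq)
  then have "card {j. j < Suc i \<and> P j} = (if P i then Suc (card {j. j < i \<and> P j}) else card {j. j < i \<and> P j})"
    for i by simp
  note card = this
  let ?I = "\<lambda>i s'. fst s' z = fst s z + card {j. j < i \<and> P j}"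
  obtain s' where "run E n (LFor x a c) s = upd x (a * n) s'" "?I (a * n) s'"
  proof (rule run_For_rule[of ?I s a n x c E])
    fix i s' assume i: "i < a * n" "agree_For x c s s'" and I: "?I i s'"
    show "?I (Suc i) (run E n c (upd x i s'))" using assms(2)[OF i] I card[of i] by simp
  qed auto
  then show ?thesis using assms(1) by simp
qed

lemma run_For_flag:
  assumes "z \<noteq> x" "\<And>i s'. i < a * n \<Longrightarrow> agree_For x c s s' \<Longrightarrow>
    fst (run E n c (upd x i s')) z = (if P i then v else fst s' z)"
  shows "fst (run E n (LFor x a c) s) z = (if \<exists>i<a * n. P i then v else fst s z)"
proof -
  obtain s' where "run E n (LFor x a c) s = upd x (a * n) s'"
    "fst s' z = (if \<exists>i<a * n. P i then v else fst s z)"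
    by (rule run_For_rule[of "\<lambda>i s'. fst s' z = (if \<exists>j<i. P j then v else fst s z)"
          s a n x c E]) (auto simp: assms less_Suc_eq)
  then show ?thesis using assms(1) by simp
qed

text \<open>
  A pass over all indices performs the steps that it finds enabled. If it changes nothing, then no
  step was enabled. As every step decreases a measure that is at most \<open>n\<close>, nothing is enabled after
  \<open>n\<close> passes.
\<close>

lemma run_For_pass:
  assumes "\<And>i s'. i < a * n \<Longrightarrow> agree_For x c s s' \<Longrightarrow>
      snd (run E n c (upd x i s')) k = snd s' k \<and> \<not> en i (snd s' k) \<or>
      step\<^sup>+\<^sup>+ (snd s' k) (snd (run E n c (upd x i s')) k)"
  shows "snd (run E n (LFor x a c) s) k = snd s k \<and> (\<forall>i<a * n. \<not> en i (snd s k)) \<or>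
      step\<^sup>+\<^sup>+ (snd s k) (snd (run E n (LFor x a c) s) k)"
proof -
  let ?I = "\<lambda>i s'. snd s' k = snd s k \<and> (\<forall>j<i. \<not> en j (snd s k)) \<or> step\<^sup>+\<^sup>+ (snd s k) (snd s' k)"
  obtain s' where "run E n (LFor x a c) s = upd x (a * n) s'" "?I (a * n) s'"
  proof (rule run_For_rule[of ?I s a n x c E])
    fix i s' assume i: "i < a * n" "agree_For x c s s'" and I: "?I i s'"
    show "?I (Suc i) (run E n c (upd x i s'))"
      using assms[OF i] I by (auto simp: less_Suc_eq intro: tranclp_trans)
  qed auto
  then show ?thesis by simp
qed

lemma run_For_rounds:
  assumes pass: "\<And>i s'. i < a * n \<Longrightarrow> agree_For x c s s' \<Longrightarrow>
      snd (run E n c (upd x i s')) k = snd s' k \<and> stuck (snd s' k) \<or>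
      step\<^sup>+\<^sup>+ (snd s' k) (snd (run E n c (upd x i s')) k)"
    and dec: "\<And>a a'. step a a' \<Longrightarrow> \<mu> a' < (\<mu> a :: nat)"
    and stuck: "\<And>a a'. step a a' \<Longrightarrow> \<not> stuck a" "\<And>a. \<mu> a = 0 \<Longrightarrow> stuck a"
    and small: "\<mu> (snd s k) \<le> a * n"
  shows "step\<^sup>*\<^sup>* (snd s k) (snd (run E n (LFor x a c) s) k) \<and> stuck (snd (run E n (LFor x a c) s) k)"
proof -
  have dec': "step\<^sup>+\<^sup>+ a a' \<Longrightarrow> \<mu> a' < \<mu> a" for a a'
    by (induction rule: tranclp_induct) (use dec less_trans in blast)+
  have stuck': "step\<^sup>+\<^sup>+ a a' \<Longrightarrow> \<not> stuck a" for a a'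
    using stuck(1) tranclpD[of step a a'] by blast
  \<comment> \<open>As long as a step is enabled, every round has lowered the measure at least once;
    so measure plus round number stays within the number of rounds.\<close>
  let ?I = "\<lambda>i s'. step\<^sup>*\<^sup>* (snd s k) (snd s' k) \<and> (stuck (snd s' k) \<or> \<mu> (snd s' k) + i \<le> a * n)"
  obtain s' where s': "run E n (LFor x a c) s = upd x (a * n) s'" "?I (a * n) s'"
  proof (rule run_For_rule[of ?I s a n x c E])
    show "?I 0 s" using small by simp
    fix i s' assume i: "i < a * n" "agree_For x c s s'" and I: "?I i s'"
    let ?a = "snd s' k" and ?a' = "snd (run E n c (upd x i s')) k"
    show "?I (Suc i) (run E n c (upd x i s'))"
    proof (cases "step\<^sup>+\<^sup>+ ?a ?a'")
      case True
      then have "\<mu> ?a + i \<le> a * n" using I stuck' by blast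
      then have "\<mu> ?a' + Suc i \<le> a * n" using dec'[OF True] by simp
      then show ?thesis using I True by (metis rtranclp_trans tranclp_into_rtranclp)
    next
      case False
      then show ?thesis using pass[OF i] I by auto
    qed
  qed auto
  then have "stuck (snd s' k)" using stuck(2) by auto
  then show ?thesis using s' by simp
qed

section \<open>The program\<close>

definition TEq :: "atom \<Rightarrow> atom \<Rightarrow> test" where
  "TEq a b = TAnd (TNot (TLess a b)) (TNot (TLess b a))"

definition TOr :: "test \<Rightarrow> test \<Rightarrow> test" where
  "TOr a b = TNot (TAnd (TNot a) (TNot b))"

definition TEx :: "'a list \<Rightarrow> ('a \<Rightarrow> test) \<Rightarrow> test" where
  "TEx xs t = foldr (\<lambda>x. TOr (t x)) xs (TLess (Cst 0) (Cst 0))"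

lemma test_val_TEq [simp]: "test_val E n (TEq a b) s \<longleftrightarrow> atom_val a s = atom_val b s"
  by (auto simp: TEq_def)

lemma test_val_TOr [simp]: "test_val E n (TOr a b) s \<longleftrightarrow> test_val E n a s \<or> test_val E n b s"
  by (auto simp: TOr_def)

lemma test_val_TEx [simp]: "test_val E n (TEx xs t) s \<longleftrightarrow> (\<exists>x\<in>set xs. test_val E n (t x) s)"
  by (induction xs) (auto simp: TEx_def)

lemma tok_TEq [simp]: "tok (TEq a b) \<longleftrightarrow> cell_ok a \<and> cell_ok b"
  by (auto simp: TEq_def)

lemma tok_TOr [simp]: "tok (TOr a b) \<longleftrightarrow> tok a \<and> tok b"
  by (simp add: TOr_def)

lemma tok_TEx [simp]: "tok (TEx xs t) \<longleftrightarrow> (\<forall>x\<in>set xs. tok (t x))"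
  by (induction xs) (auto simp: TEx_def)

primrec LSeqs :: "lcom list \<Rightarrow> lcom" where
  "LSeqs [] = LSkip"
| "LSeqs (c # cs) = LSeq c (LSeqs cs)"

text \<open>
  The registers 4, \dots, 12 hold the guess: a value \<open>v < n\<close> stands for \<open>v \<in> A\<close> and a value \<open>n + v\<close>
  with \<open>v < n\<close> stands for \<open>v \<in> Z\<close>.
\<close>

definition guess_regs :: "nat list" where
  "guess_regs = [4..<13]"

definition in_A :: "nat \<Rightarrow> test" where
  "in_A x = TEx guess_regs (\<lambda>g. TEq (Rg g) (Rg x))"

definition in_Z :: "nat \<Rightarrow> test" where
  "in_Z x = TEx guess_regs (\<lambda>g. TShift g x)"

definition nbr_A :: "nat \<Rightarrow> test" where
  "nbr_A x = TEx guess_regs (\<lambda>g. TAdj g x)"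

definition xor_test :: test where
  "xor_test = TAnd (TAdj 16 17) (TAnd (TNot (in_A 16)) (TAnd (TNot (in_A 17))
     (TOr (TOr (in_Z 16) (in_Z 17)) (TOr (nbr_A 16) (nbr_A 17)))))"

definition forced_test :: test where
  "forced_test = TOr (in_Z 16) (TEx guess_regs (\<lambda>g. TEx guess_regs (\<lambda>h.
     TAnd (TNot (TEq (Rg g) (Rg h))) (TAnd (TAdj g 16) (TAdj h 16)))))"

definition guess_A :: "nat \<Rightarrow> (nat \<Rightarrow> nat) \<Rightarrow> nat set" where
  "guess_A n \<rho> = {v. v < n \<and> (\<exists>g\<in>set guess_regs. \<rho> g = v)}"

definition guess_Z :: "nat \<Rightarrow> (nat \<Rightarrow> nat) \<Rightarrow> nat set" where
  "guess_Z n \<rho> = {v. v < n \<and> (\<exists>g\<in>set guess_regs. \<rho> g = v + n)}"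

text \<open>With \<open>p\<close> and \<open>q\<close> different, the labels alternate along edges
  and give a two-colouring; with equal labels this is plain reachability. Conflicts are not detected
  here: a set that is not a solution fails the later check.\<close>

definition flood :: "nat \<Rightarrow> test \<Rightarrow> atom \<Rightarrow> atom \<Rightarrow> lcom" where
  "flood k t p q = LFor 15 1 (LFor 16 1 (LFor 17 1
     (LIf (TAnd t (TAnd (TEq (Cell k 16) p) (TEq (Cell k 17) (Cst 0)))) (LStore k 17 q)
       (LIf (TAnd t (TAnd (TEq (Cell k 16) q) (TEq (Cell k 17) (Cst 0)))) (LStore k 17 p) LSkip))))"

definition flood_step :: "nat \<Rightarrow> (nat \<Rightarrow> nat \<Rightarrow> bool) \<Rightarrow> nat \<Rightarrow> nat \<Rightarrow> (nat \<Rightarrow> nat) \<Rightarrow> (nat \<Rightarrow> nat) \<Rightarrow> bool" where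
  "flood_step n R p q a a' \<longleftrightarrow> (\<exists>x<n. \<exists>y<n. R x y \<and> a y = 0 \<and>
     (a x = p \<and> a' = a(y := q) \<or> a x = q \<and> a' = a(y := p)))"

definition flood_closed :: "nat \<Rightarrow> (nat \<Rightarrow> nat \<Rightarrow> bool) \<Rightarrow> nat \<Rightarrow> nat \<Rightarrow> (nat \<Rightarrow> nat) \<Rightarrow> bool" where
  "flood_closed n R p q a \<longleftrightarrow> (\<forall>x<n. \<not> (\<exists>y<n. R x y \<and> (a x = p \<or> a x = q) \<and> a y = 0))"

text \<open>Only unlabelled cells are overwritten, and labels are not 0. So the number of unlabelled
  vertices decreases with every step, and \<open>n\<close> rounds suffice. The hypotheses say that
  test and labels do not depend on anything that flooding changes, except for the two vertices under
  consideration.\<close>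

lemma run_flood:
  assumes R: "\<And>s'. agree {15, 16, 17} {k} s s' \<Longrightarrow> test_val E n t s' \<longleftrightarrow> R (fst s' 16) (fst s' 17)"
    and p: "\<And>s'. agree {15, 16, 17} {k} s s' \<Longrightarrow> atom_val pa s' = p" "p \<noteq> 0"
    and q: "\<And>s'. agree {15, 16, 17} {k} s s' \<Longrightarrow> atom_val qa s' = q" "q \<noteq> 0"
  shows "(flood_step n R p q)\<^sup>*\<^sup>* (snd s k) (snd (run E n (flood k t pa qa) s) k) \<and>
    flood_closed n R p q (snd (run E n (flood k t pa qa) s) k)"
proof -
  let ?c = "LIf (TAnd t (TAnd (TEq (Cell k 16) pa) (TEq (Cell k 17) (Cst 0)))) (LStore k 17 qa)
       (LIf (TAnd t (TAnd (TEq (Cell k 16) qa) (TEq (Cell k 17) (Cst 0)))) (LStore k 17 pa) LSkip)"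
  let ?ag = "agree {15, 16, 17} {k}" and ?step = "flood_step n R p q"
  let ?P = "\<lambda>stuck r r'. snd r' k = snd r k \<and> stuck \<or> ?step\<^sup>+\<^sup>+ (snd r k) (snd r' k)"
  let ?en = "\<lambda>x y a. R x y \<and> (a x = p \<or> a x = q) \<and> a y = (0::nat)"
  have sets: "stores ?c = {k}" "writes ?c = {}" by auto
  have c: "?P (\<not> ?en x y (snd s' k)) s' (run E n ?c (upd 17 y (upd 16 x s')))"
    if "x < n" "y < n" "?ag s s'" for x y s'
  proof -
    let ?s = "upd 17 y (upd 16 x s')"
    have ag: "?ag s ?s" using that(3) by (intro agree_upd) auto
    show ?thesis
    proof (cases "?en x y (snd s' k)")
      case True
      then have "?step (snd s' k) (snd (run E n ?c ?s) k)"
        using R[OF ag] p(1)[OF ag] q(1)[OF ag] that(1,2) unfolding flood_step_def by fastforce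
      then show ?thesis by blast
    next
      case False
      then have "run E n ?c ?s = ?s" using R[OF ag] p(1)[OF ag] q(1)[OF ag] by auto
      then show ?thesis using False by simp
    qed
  qed
  have y: "?P (\<not> (\<exists>y<n. ?en x y (snd s' k))) s' (run E n (LFor 17 1 ?c) (upd 16 x s'))"
    if "x < n" "?ag s s'" for x s'
  proof -
    have "?P (\<forall>y<1 * n. \<not> ?en x y (snd (upd 16 x s') k)) (upd 16 x s') (run E n (LFor 17 1 ?c) (upd 16 x s'))"
    proof (rule run_For_pass)
      fix y s'' assume y: "y < 1 * n" and ag: "agree_For 17 ?c (upd 16 x s') s''"
      have "?ag s (upd 16 x s')" using that(2) by (intro agree_upd) auto
      moreover have "?ag (upd 16 x s') s''" using ag by (rule agree_mono) (auto simp: sets)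
      ultimately have "?ag s s''" by (rule agree_trans)
      moreover have "upd 16 x s'' = s''" using ag unfolding sets agree_def upd_def
        by (cases s'') (auto simp: fun_eq_iff)
      ultimately show "?P (\<not> ?en x y (snd s'' k)) s'' (run E n ?c (upd 17 y s''))"
        using c[of x y s''] that(1) y by simp
    qed
    then show ?thesis unfolding snd_upd mult_1 by blast
  qed
  have closed_iff: "flood_closed n R p q a \<longleftrightarrow> (\<forall>x<n. \<not> (\<exists>y<n. ?en x y a))" for a
    by (rule flood_closed_def)
  have setsy: "stores (LFor 17 1 ?c) = {k}" "writes (LFor 17 1 ?c) = {17}" by auto
  have x: "?P (flood_closed n R p q (snd s' k)) s' (run E n (LFor 16 1 (LFor 17 1 ?c)) (upd 15 i s'))"
    if "?ag s s'" for i s'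
  proof -
    let ?c' = "LFor 17 1 ?c"
    have "?P (\<forall>x<1 * n. \<not> (\<exists>y<n. ?en x y (snd (upd 15 i s') k))) (upd 15 i s') (run E n (LFor 16 1 ?c') (upd 15 i s'))"
    proof (rule run_For_pass)
      fix x s'' assume x: "x < 1 * n" and ag: "agree_For 16 ?c' (upd 15 i s') s''"
      have "?ag s (upd 15 i s')" using that by (intro agree_upd) auto
      moreover have "?ag (upd 15 i s') s''"
        using ag by (rule agree_mono) (auto simp: setsy)
      ultimately have "?ag s s''" by (rule agree_trans)
      then show "?P (\<not> (\<exists>y<n. ?en x y (snd s'' k))) s'' (run E n ?c' (upd 16 x s''))"
        using y[of x s''] x by simp
    qed
    then show ?thesis unfolding closed_iff snd_upd mult_1 .
  qed
  let ?mu = "\<lambda>a. card {v. v < n \<and> a v = (0::nat)}"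
  let ?c'' = "LFor 16 1 (LFor 17 1 ?c)"
  have setsx: "stores ?c'' = {k}" "writes ?c'' = {16, 17}" by auto
  show ?thesis
    unfolding flood_def
  proof (rule run_For_rounds[where \<mu> = ?mu])
    fix i s' assume "agree_For 15 ?c'' s s'"
    then have "?ag s s'" by (rule agree_mono) (auto simp: setsx)
    then show "?P (flood_closed n R p q (snd s' k)) s' (run E n ?c'' (upd 15 i s'))" by (rule x)
  next
    fix a a' assume st: "?step a a'"
    then obtain y v where y: "y < n" "a y = 0" "v \<noteq> 0" "a' = a(y := v)"
      using p(2) q(2) unfolding flood_step_def by blast
    then have "{v. v < n \<and> a' v = 0} \<subset> {v. v < n \<and> a v = 0}" by auto
    then show "?mu a' < ?mu a" by (intro psubset_card_mono) auto
    show "\<not> flood_closed n R p q a" using st unfolding flood_step_def flood_closed_def by blast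
  next
    fix a :: "nat \<Rightarrow> nat" assume "?mu a = 0"
    then have "{v. v < n \<and> a v = 0} = {}" by simp
    then show "flood_closed n R p q a" unfolding flood_closed_def by blast
  next
    have "?mu (snd s k) \<le> card {..<n}" by (rule card_mono) auto
    then show "?mu (snd s k) \<le> 1 * n" by simp
  qed
qed

text \<open>Acyclicity is tested by repeated removal of vertices of degree at most 1. Colour 5 marks
  removed vertices; it only has to differ from the other colours.\<close>

definition strip :: lcom where
  "strip = LFor 15 1 (LFor 16 1 (LIf (TEq (Cell 1 16) (Cst 2))
     (LSeq (LAssign 18 (Cst 0)) (LSeq
       (LFor 17 1 (LIf (TAnd (TAdj 16 17) (TEq (Cell 1 17) (Cst 2))) (LInc 18) LSkip))
       (LIf (TLess (Rg 18) (Cst 2)) (LStore 1 16 (Cst 5)) LSkip))) LSkip))"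

definition strippable :: "nat \<Rightarrow> (nat \<Rightarrow> nat \<Rightarrow> bool) \<Rightarrow> nat \<Rightarrow> (nat \<Rightarrow> nat) \<Rightarrow> bool" where
  "strippable n E x a \<longleftrightarrow> x < n \<and> a x = 2 \<and> card {y. y < n \<and> E x y \<and> a y = 2} < 2"

definition strip_step :: "nat \<Rightarrow> (nat \<Rightarrow> nat \<Rightarrow> bool) \<Rightarrow> (nat \<Rightarrow> nat) \<Rightarrow> (nat \<Rightarrow> nat) \<Rightarrow> bool" where
  "strip_step n E a a' \<longleftrightarrow> (\<exists>x. strippable n E x a \<and> a' = a(x := 5))"

lemma run_strip:
  "(strip_step n E)\<^sup>*\<^sup>* (snd s 1) (snd (run E n strip s) 1) \<and>
    (\<forall>x<n. \<not> strippable n E x (snd (run E n strip s) 1))"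
proof -
  let ?count = "LFor 17 1 (LIf (TAnd (TAdj 16 17) (TEq (Cell 1 17) (Cst 2))) (LInc 18) LSkip)"
  let ?c = "LIf (TEq (Cell 1 16) (Cst 2)) (LSeq (LAssign 18 (Cst 0)) (LSeq ?count
       (LIf (TLess (Rg 18) (Cst 2)) (LStore 1 16 (Cst 5)) LSkip))) LSkip"
  let ?P = "\<lambda>stuck r r'. snd r' 1 = snd r 1 \<and> stuck \<or> (strip_step n E)\<^sup>+\<^sup>+ (snd r 1) (snd r' 1)"
  have c: "?P (\<not> strippable n E x (snd s' 1)) s' (run E n ?c (upd 16 x s'))" if "x < n" for x s'
  proof (cases "snd s' 1 x = 2")
    case True
    define s1 where "s1 = upd 18 0 (upd 16 x s')"
    define s2 where "s2 = run E n ?count s1"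
    have "agree_For 17 (LIf (TAnd (TAdj 16 17) (TEq (Cell 1 17) (Cst 2))) (LInc 18) LSkip) s1 s'' \<Longrightarrow>
        fst s'' 16 = x \<and> snd s'' 1 = snd s' 1" for s''
      by (simp add: agree_def s1_def)
    then have "fst s2 18 = fst s1 18 + card {y. y < 1 * n \<and> E x y \<and> snd s' 1 y = 2}"
      unfolding s2_def by (intro run_For_count) auto
    then have 18: "fst s2 18 = card {y. y < n \<and> E x y \<and> snd s' 1 y = 2}" by (simp add: s1_def)
    have fr: "snd s2 1 = snd s' 1" "fst s2 16 = x"
      unfolding s2_def using run_array_frame[of 1 ?count] run_frame[of 16 ?count] by (simp_all add: s1_def)
    have "run E n ?c (upd 16 x s') = run E n (LIf (TLess (Rg 18) (Cst 2)) (LStore 1 16 (Cst 5)) LSkip) s2"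
      using True unfolding s2_def s1_def by simp
    then have "snd (run E n ?c (upd 16 x s')) 1 =
        (if card {y. y < n \<and> E x y \<and> snd s' 1 y = 2} < 2 then (snd s' 1)(x := 5) else snd s' 1)"
      using 18 fr by simp
    then show ?thesis using that True unfolding strip_step_def strippable_def by auto
  next
    case False
    then show ?thesis by (simp add: strippable_def)
  qed
  let ?mu = "\<lambda>a. card {v. v < n \<and> a v = (2::nat)}"
  show ?thesis
    unfolding strip_def
  proof (rule run_For_rounds[where \<mu> = ?mu and stuck = "\<lambda>a. \<forall>x<n. \<not> strippable n E x a"])
    fix i s'
    have "?P (\<forall>x<1 * n. \<not> strippable n E x (snd (upd 15 i s') 1)) (upd 15 i s') (run E n (LFor 16 1 ?c) (upd 15 i s'))"
      by (rule run_For_pass) (use c in simp)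
    then show "?P (\<forall>x<n. \<not> strippable n E x (snd s' 1)) s' (run E n (LFor 16 1 ?c) (upd 15 i s'))" by simp
  next
    fix a a' assume st: "strip_step n E a a'"
    then obtain x where x: "strippable n E x a" "a' = a(x := 5)" unfolding strip_step_def by blast
    then have "{v. v < n \<and> a' v = 2} \<subset> {v. v < n \<and> a v = 2}" by (auto simp: strippable_def)
    then show "?mu a' < ?mu a" by (intro psubset_card_mono) auto
    show "\<not> (\<forall>x<n. \<not> strippable n E x a)" using x(1) unfolding strippable_def by blast
  next
    fix a :: "nat \<Rightarrow> nat" assume "?mu a = 0"
    then have "{v. v < n \<and> a v = 2} = {}" by simp
    then show "\<forall>x<n. \<not> strippable n E x a" unfolding strippable_def by blast
  next
    have "?mu (snd s 1) \<le> card {..<n}" by (rule card_mono) auto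
    then show "?mu (snd s 1) \<le> 1 * n" by simp
  qed
qed

section \<open>Correctness of the colouring\<close>

lemma flood_closedD:
  "flood_closed n R p q a \<Longrightarrow> x < n \<Longrightarrow> y < n \<Longrightarrow> R x y \<Longrightarrow> a x = p \<or> a x = q \<Longrightarrow> a y \<noteq> 0"
  by (auto simp: flood_closed_def)

text \<open>In a set that contains \<open>x\<close>, the vertex \<open>x\<close> has degree at most
  1; any other set survives the removal of \<open>x\<close>.\<close>

lemma acyclic_on_strip:
  assumes "strippable n E x a" "acyclic_on E {v. v < n \<and> (a(x := 5)) v = 2}"
  shows "acyclic_on E {v. v < n \<and> a v = 2}"
  unfolding acyclic_on_def
proof (intro allI impI)
  fix X assume X: "X \<subseteq> {v. v < n \<and> a v = 2} \<and> X \<noteq> {}"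
  show "\<exists>v\<in>X. \<forall>u\<in>X. \<forall>w\<in>X. E v u \<and> E v w \<longrightarrow> u = w"
  proof (cases "x \<in> X")
    case True
    have "u = w" if "u \<in> X" "w \<in> X" "E x u" "E x w" for u w
    proof (rule ccontr)
      assume "u \<noteq> w"
      have "{u, w} \<subseteq> {y. y < n \<and> E x y \<and> a y = 2}" using that X by auto
      then have "card {u, w} \<le> card {y. y < n \<and> E x y \<and> a y = 2}" by (intro card_mono) auto
      then show False using assms(1) \<open>u \<noteq> w\<close> unfolding strippable_def by simp
    qed
    then show ?thesis using True by blast
  next
    case False
    then have "X \<subseteq> {v. v < n \<and> (a(x := 5)) v = 2}" using X by auto
    then show ?thesis using assms(2) X unfolding acyclic_on_def by blast
  qed
qed

text \<open>If everything is removed, putting the vertices back in reverse order preserves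
  acyclicity. If the removal gets stuck earlier, a nonempty set of minimum degree 2 remains.\<close>

lemma acyclic_on_iff_stripped:
  assumes "(strip_step n E)\<^sup>*\<^sup>* a b" and stuck: "\<forall>x<n. \<not> strippable n E x b"
  shows "(\<forall>x<n. b x \<noteq> 2) \<longleftrightarrow> acyclic_on E {v. v < n \<and> a v = 2}"
proof
  assume "\<forall>x<n. b x \<noteq> 2"
  then have "{v. v < n \<and> b v = 2} = {}" by auto
  then have "acyclic_on E {v. v < n \<and> b v = 2}" unfolding acyclic_on_def by (metis subset_empty)
  with assms(1) show "acyclic_on E {v. v < n \<and> a v = 2}"
    by (induction rule: converse_rtranclp_induct)
      (auto simp: strip_step_def intro: acyclic_on_strip)
next
  assume ac: "acyclic_on E {v. v < n \<and> a v = 2}"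
  have "b v = 2 \<longrightarrow> a v = 2" for v
    using assms(1) by (induction rule: rtranclp_induct) (auto simp: strip_step_def split: if_splits)
  then have sub: "{v. v < n \<and> b v = 2} \<subseteq> {v. v < n \<and> a v = 2}" by blast
  show "\<forall>x<n. b x \<noteq> 2"
  proof (rule ccontr)
    assume "\<not> (\<forall>x<n. b x \<noteq> 2)"
    then have "{v. v < n \<and> b v = 2} \<noteq> {}" by blast
    then obtain v where v: "v \<in> {v. v < n \<and> b v = 2}"
      "\<And>u w. u \<in> {v. v < n \<and> b v = 2} \<Longrightarrow> w \<in> {v. v < n \<and> b v = 2} \<Longrightarrow> E v u \<Longrightarrow> E v w \<Longrightarrow> u = w"
      using acyclic_onD[OF ac sub] by blast
    have "card {y. y < n \<and> E v y \<and> b y = 2} \<le> 1"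
      unfolding One_nat_def by (subst card_le_Suc0_iff_eq) (use v(2) in auto)
    then show False using stuck v(1) unfolding strippable_def by auto
  qed
qed

text \<open>
  A class can be the solution side only if the other class has no forced vertex; if both can be, the
  smaller one is taken. If neither can be, the result is irrelevant.
\<close>

definition first_chosen :: "nat \<Rightarrow> (nat \<Rightarrow> bool) \<Rightarrow> (nat \<Rightarrow> nat) \<Rightarrow> bool" where
  "first_chosen n fc b \<longleftrightarrow> \<not> (\<exists>v<n. b v = 4 \<and> fc v) \<and>
     ((\<exists>v<n. b v = 3 \<and> fc v) \<or> card {v. v < n \<and> b v = 3} \<le> card {v. v < n \<and> b v = 4})"

lemma first_chosenI:
  "\<not> (\<exists>v<n. b v = 4 \<and> fc v) \<Longrightarrow> v < n \<Longrightarrow> b v = 3 \<Longrightarrow> fc v \<Longrightarrow> first_chosen n fc b"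
  by (auto simp: first_chosen_def)

lemma first_chosenD:
  "first_chosen n fc b \<Longrightarrow> \<not> (\<exists>v<n. b v = 3 \<and> fc v) \<Longrightarrow>
    card {v. v < n \<and> b v = 3} \<le> card {v. v < n \<and> b v = 4}"
  by (simp add: first_chosen_def)

lemma not_first_chosenD:
  "\<not> first_chosen n fc b \<Longrightarrow> \<not> (\<exists>v<n. b v = 4 \<and> fc v) \<Longrightarrow>
    card {v. v < n \<and> b v = 4} \<le> card {v. v < n \<and> b v = 3}"
  by (simp add: first_chosen_def)

definition relabelled :: "nat \<Rightarrow> nat \<Rightarrow> nat \<Rightarrow> (nat \<Rightarrow> nat) \<Rightarrow> nat \<Rightarrow> nat" where
  "relabelled n p q b = (\<lambda>v. if v < n then (if b v = 3 then p else if b v = 4 then q else b v) else b v)"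

text \<open>
  The colours 1 and 2 stand for membership in the computed set and in its complement; 3 and 4 are the
  two classes of the component that is being explored.
\<close>

definition colour_inv ::
  "nat \<Rightarrow> (nat \<Rightarrow> nat \<Rightarrow> bool) \<Rightarrow> nat set \<Rightarrow> nat set \<Rightarrow> nat set \<Rightarrow> nat set \<Rightarrow> nat \<Rightarrow> (nat \<Rightarrow> nat) \<Rightarrow> bool"
where
  "colour_inv n E C A Z S i a \<longleftrightarrow>
     (\<forall>v. a v = 0 \<or> a v = 1 \<or> a v = 2) \<and> (\<forall>v. a v \<noteq> 0 \<longrightarrow> v \<in> C - A) \<and>
     (\<forall>v<i. v \<in> C - A \<longrightarrow> a v \<noteq> 0) \<and>
     (\<forall>x y. xor_edge E A Z x y \<longrightarrow> a x \<noteq> 0 \<longrightarrow> a y \<noteq> 0 \<and> (a x = 1 \<longleftrightarrow> a y \<noteq> 1)) \<and>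
     (\<forall>x. a x \<noteq> 0 \<longrightarrow> forced E A Z x \<longrightarrow> a x = 1) \<and>
     card {v. v < n \<and> a v = 1} \<le> card {v. v < n \<and> v \<in> S \<and> a v \<noteq> 0}"

text \<open>On the explored component, \<open>S\<close> coincides with class 3 if \<open>u\<close>
  is in \<open>S\<close>, and with class 4 otherwise. As \<open>S\<close> contains all forced
  vertices, the other class contains none. So the class of \<open>S\<close> is a permitted choice,
  and the chosen class is no larger.\<close>

lemma colour_inv_step:
  fixes E :: "nat \<Rightarrow> nat \<Rightarrow> bool"
  assumes inv: "colour_inv n E C A Z S u a"
    and sym: "\<And>x y. E x y \<Longrightarrow> E y x"
    and C: "C \<subseteq> {..<n}" "\<And>x y. x \<in> C \<Longrightarrow> E x y \<Longrightarrow> y \<in> C"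
    and adm: "admissible E C A Z S"
    and u: "u \<in> C - A" "a u = 0"
    and flood: "(flood_step n (xor_edge E A Z) 3 4)\<^sup>*\<^sup>* (a(u := 3)) b"
      "flood_closed n (xor_edge E A Z) 3 4 b"
    and a': "a' = (if first_chosen n (forced E A Z) b then relabelled n 1 2 b else relabelled n 2 1 b)"
  shows "colour_inv n E C A Z S (Suc u) a'"
proof -
  let ?R = "xor_edge E A Z"
  have i1: "\<And>v. a v = 0 \<or> a v = 1 \<or> a v = 2" and i2: "\<And>v. a v \<noteq> 0 \<Longrightarrow> v \<in> C - A"
    and i3: "\<And>v. v < u \<Longrightarrow> v \<in> C - A \<Longrightarrow> a v \<noteq> 0"
    and i4: "\<And>x y. ?R x y \<Longrightarrow> a x \<noteq> 0 \<Longrightarrow> a y \<noteq> 0"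
    and i5: "\<And>x y. ?R x y \<Longrightarrow> a x \<noteq> 0 \<Longrightarrow> a x = 1 \<longleftrightarrow> a y \<noteq> 1"
    and i6: "\<And>x. a x \<noteq> 0 \<Longrightarrow> forced E A Z x \<Longrightarrow> a x = 1"
    and i7: "card {v. v < n \<and> a v = 1} \<le> card {v. v < n \<and> v \<in> S \<and> a v \<noteq> 0}"
    using inv unfolding colour_inv_def by metis+
  have Rsym: "?R y x" if "?R x y" for x y using that sym unfolding xor_edge_def by blast
  have RC: "y \<in> C - A" if "?R x y" "x \<in> C" for x y using that C(2) unfolding xor_edge_def by blast
  have RS: "x \<in> S \<longleftrightarrow> y \<notin> S" if "?R x y" "x \<in> C" for x y
    using that RC[OF that] adm unfolding admissible_def by blast
  have fS: "v \<in> S" if "forced E A Z v" "v \<in> C - A" for v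
    using that adm unfolding admissible_def by blast
  \<comment> \<open>Old colours survive the flooding, and class 3 consists of vertices on the same
    side of \<open>S\<close> as \<open>u\<close>, class 4 of vertices on the other side.\<close>
  have F: "(a v \<noteq> 0 \<longrightarrow> b v = a v) \<and> (a v = 0 \<longrightarrow> b v = 0 \<or> b v = 3 \<or> b v = 4) \<and>
      (b v = 3 \<or> b v = 4 \<longrightarrow> v \<in> C - A \<and> (b v = 3 \<longleftrightarrow> (v \<in> S \<longleftrightarrow> u \<in> S)))" for v
    using flood(1)
  proof (induction arbitrary: v rule: rtranclp_induct)
    case base
    show ?case using u i1[of v] by auto
  next
    case (step b c)
    obtain x y where xy: "?R x y" "b y = 0" and
      bc: "b x = 3 \<and> c = b(y := 4) \<or> b x = 4 \<and> c = b(y := 3)"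
      using step.hyps(2) unfolding flood_step_def by blast
    have x: "x \<in> C - A" "b x = 3 \<longleftrightarrow> (x \<in> S \<longleftrightarrow> u \<in> S)" using step.IH[of x] bc by blast+
    have y: "y \<in> C - A" "x \<in> S \<longleftrightarrow> y \<notin> S" using RC[OF xy(1)] RS[OF xy(1)] x(1) by blast+
    have ay: "a y = 0" using step.IH[of y] xy(2) i1[of y] by auto
    show ?case
    proof (cases "v = y")
      case True
      from bc show ?thesis
      proof (elim disjE conjE)
        assume "b x = 3" "c = b(y := 4)"
        then have "c v = 4" "(y \<in> S) \<noteq> (u \<in> S)" using True x(2) y(2) by auto
        then show ?thesis using True ay y(1) by simp
      next
        assume "b x = 4" "c = b(y := 3)"
        then have "c v = 3" "(y \<in> S) = (u \<in> S)" using True x(2) y(2) by auto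
        then show ?thesis using True ay y(1) by simp
      qed
    next
      case False
      then have "c v = b v" using bc by auto
      then show ?thesis using step.IH[of v] by (simp only:)
    qed
  qed
  have F1: "b v = a v" if "a v \<noteq> 0" for v using F[of v] that by simp
  have F2: "b v = 0 \<or> b v = 3 \<or> b v = 4" if "a v = 0" for v using F[of v] that by simp
  have F3: "v \<in> C - A" if "b v = 3 \<or> b v = 4" for v using F[of v] that by simp
  have F4: "v \<in> S \<longleftrightarrow> u \<in> S" if "b v = 3" for v using F[of v] that by simp
  have F5: "v \<in> S \<longleftrightarrow> u \<notin> S" if "b v = 4" for v using F[of v] that by auto
  have bn: "v < n" if "b v \<noteq> 0" for v
    using F1[of v] F2[of v] F3[of v] i2[of v] that C(1) by (cases "a v = 0") auto
  have bu: "b u \<noteq> 0"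
  proof -
    have "b u = 3" using flood(1)
    proof (induction rule: rtranclp_induct)
      case (step b c)
      then show ?case unfolding flood_step_def by auto
    qed simp
    then show ?thesis by simp
  qed
  have a34: "a v \<noteq> 3 \<and> a v \<noteq> 4" for v using i1[of v] by auto
  have K0: "a v = 0" if "b v = 3 \<or> b v = 4" for v using F1[of v] a34[of v] that by metis
  \<comment> \<open>Flooding leaves no uncoloured xor neighbour of \<open>x\<close>, and a neighbour
    coloured earlier would have had \<open>x\<close> coloured with it. The two ends are told apart
    by \<open>S\<close>.\<close>
  have KR: "(b y = 3 \<or> b y = 4) \<and> (b x = 3 \<longleftrightarrow> b y \<noteq> 3)" if "?R x y" "b x = 3 \<or> b x = 4" for x y
  proof -
    have xC: "x \<in> C - A" using F3[OF that(2)] .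
    have "y < n" using RC[OF that(1)] xC C(1) by blast
    moreover have "x < n" using xC C(1) by blast
    ultimately have "b y \<noteq> 0" using flood_closedD[OF flood(2)] that by metis
    moreover have "a y = 0" using i4[OF Rsym[OF that(1)]] K0[OF that(2)] by blast
    ultimately have y: "b y = 3 \<or> b y = 4" using F2[of y] by simp
    have "x \<in> S \<longleftrightarrow> y \<notin> S" using RS[OF that(1)] xC by blast
    then have "b x = 3 \<longleftrightarrow> b y \<noteq> 3" using y that(2) F4[of x] F4[of y] F5[of x] F5[of y] by auto
    then show ?thesis using y by simp
  qed
  define ch where "ch \<longleftrightarrow> first_chosen n (forced E A Z) b"
  define k where "k = (if ch then 3 else (4::nat))"
  have a'v: "a' v = (if b v = 3 \<or> b v = 4 then (if b v = k then 1 else 2) else a v)" for v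

  proof (cases "b v = 3 \<or> b v = 4")
    case True
    then show ?thesis using bn[of v] unfolding a' ch_def[symmetric] relabelled_def k_def by auto
  next
    case False
    then have "b v = a v" using F1[of v] F2[of v] by (cases "a v = 0") auto
    then show ?thesis using False unfolding a' ch_def[symmetric] relabelled_def by auto
  qed
  have nz: "a' v \<noteq> 0 \<longleftrightarrow> b v \<noteq> 0" for v using F1[of v] F2[of v] a'v[of v] by (cases "a v = 0") auto
  have k34: "k = 3 \<or> k = 4" by (simp add: k_def)
  \<comment> \<open>Forced vertices in both classes would make \<open>S\<close> meet both, whereas
    it contains one class and misses the other.\<close>
  have frc: "b v = k" if "forced E A Z v" "b v = 3 \<or> b v = 4" for v
  proof (rule ccontr)
    assume ne: "b v \<noteq> k"
    have vn: "v < n" using bn that(2) by auto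
    have vS: "v \<in> S" using fS[OF that(1) F3[OF that(2)]] .
    show False
    proof (cases ch)
      case True
      then have "b v = 4" using ne that(2) by (simp add: k_def)
      then show False using True that(1) vn unfolding ch_def first_chosen_def by blast
    next
      case False
      then have bv: "b v = 3" using ne that(2) by (simp add: k_def)
      then have "\<exists>w<n. b w = 4 \<and> forced E A Z w"
        using first_chosenI[of n b "forced E A Z" v] vn that(1) False unfolding ch_def by metis
      then obtain w where w: "w < n" "b w = 4" "forced E A Z w" by metis
      moreover have "w \<in> S" using fS[OF w(3)] F3[of w] w(2) by simp
      ultimately show False using F4[of v] F5[of w] vS bv by simp
    qed
  qed
  let ?K = "\<lambda>j. {v. v < n \<and> b v = j}"
  have SK: "{v. v < n \<and> v \<in> S \<and> (b v = 3 \<or> b v = 4)} = (if u \<in> S then ?K 3 else ?K 4)"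
  proof -
    have "v \<in> S \<and> (b v = 3 \<or> b v = 4) \<longleftrightarrow> (if u \<in> S then b v = 3 else b v = 4)" for v
      using F4[of v] F5[of v] by auto
    then show ?thesis by auto
  qed
  have le: "card (?K k) \<le> card {v. v < n \<and> v \<in> S \<and> (b v = 3 \<or> b v = 4)}"
  proof (cases "u \<in> S")
    case True
    have none: "\<not> (\<exists>v<n. b v = 4 \<and> forced E A Z v)"
    proof
      assume "\<exists>v<n. b v = 4 \<and> forced E A Z v"
      then obtain v where v: "b v = 4" "forced E A Z v" by blast
      then have "v \<in> S" using fS[of v] F3[of v] by simp
      then show False using F5[of v] v True by simp
    qed
    have "card (?K 4) \<le> card (?K 3)" if "\<not> ch"
      using not_first_chosenD[OF that[unfolded ch_def] none] .
    then show ?thesis using True unfolding SK by (simp add: k_def)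
  next
    case False
    have none: "\<not> (\<exists>v<n. b v = 3 \<and> forced E A Z v)"
    proof
      assume "\<exists>v<n. b v = 3 \<and> forced E A Z v"
      then obtain v where v: "b v = 3" "forced E A Z v" by blast
      then have "v \<in> S" using fS[of v] F3[of v] by simp
      then show False using F4[of v] v False by simp
    qed
    have "card (?K 3) \<le> card (?K 4)" if ch
      using first_chosenD[OF that[unfolded ch_def] none] .
    then show ?thesis using False unfolding SK by (simp add: k_def)
  qed
  have "{v. v < n \<and> a' v = 1} = {v. v < n \<and> a v = 1} \<union> ?K k"
    using a'v K0 k34 by (auto split: if_splits)
  then have "card {v. v < n \<and> a' v = 1} \<le> card {v. v < n \<and> a v = 1} + card (?K k)"
    by (simp add: card_Un_le)
  also have "\<dots> \<le> card {v. v < n \<and> v \<in> S \<and> a v \<noteq> 0} + card {v. v < n \<and> v \<in> S \<and> (b v = 3 \<or> b v = 4)}"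
    using i7 le by (rule add_le_mono)
  also have "\<dots> = card ({v. v < n \<and> v \<in> S \<and> a v \<noteq> 0} \<union> {v. v < n \<and> v \<in> S \<and> (b v = 3 \<or> b v = 4)})"
    by (rule card_Un_disjoint[symmetric]) (use K0 in auto)
  also have "{v. v < n \<and> v \<in> S \<and> a v \<noteq> 0} \<union> {v. v < n \<and> v \<in> S \<and> (b v = 3 \<or> b v = 4)} =
      {v. v < n \<and> v \<in> S \<and> a' v \<noteq> 0}"
  proof -
    have "a v \<noteq> 0 \<or> b v = 3 \<or> b v = 4 \<longleftrightarrow> a' v \<noteq> 0" for v
      using F1[of v] F2[of v] nz[of v] by (cases "a v = 0") auto
    then show ?thesis by blast
  qed
  finally have 7: "card {v. v < n \<and> a' v = 1} \<le> card {v. v < n \<and> v \<in> S \<and> a' v \<noteq> 0}" .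
  have 1: "a' v = 0 \<or> a' v = 1 \<or> a' v = 2" for v using a'v[of v] i1[of v] by auto
  have 2: "v \<in> C - A" if "a' v \<noteq> 0" for v
    using that a'v[of v] i2[of v] F3[of v] by (cases "b v = 3 \<or> b v = 4") auto
  have 3: "a' v \<noteq> 0" if "v < Suc u" "v \<in> C - A" for v
  proof (cases "v = u")
    case True then show ?thesis using bu nz by simp
  next
    case False
    then have "a v \<noteq> 0" using i3[of v] that by simp
    then show ?thesis using F1[of v] nz[of v] by simp
  qed
  have 45: "a' y \<noteq> 0 \<and> (a' x = 1 \<longleftrightarrow> a' y \<noteq> 1)" if R: "?R x y" and "a' x \<noteq> 0" for x y
  proof (cases "b x = 3 \<or> b x = 4")
    case True
    then have "b y = 3 \<or> b y = 4" "b x = 3 \<longleftrightarrow> b y \<noteq> 3" using KR[OF R True] by simp_all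
    then show ?thesis using True a'v[of x] a'v[of y] k34 by auto
  next
    case False
    then have ax: "a x \<noteq> 0" "a' x = a x" using that(2) a'v[of x] by auto
    then have "a y \<noteq> 0" using i4[OF R] by blast
    then have "a' y = a y" using a'v[of y] K0[of y] by auto
    then show ?thesis using ax \<open>a y \<noteq> 0\<close> i5[OF R] by auto
  qed
  have 6: "a' x = 1" if "a' x \<noteq> 0" "forced E A Z x" for x
    using frc[OF that(2)] a'v[of x] i6[of x] that by (cases "b x = 3 \<or> b x = 4") auto
  show ?thesis unfolding colour_inv_def using 1 2 3 45 6 7 by blast
qed

text \<open>Once all of \<open>C - A\<close> is coloured, the vertices of colour 1 form an
  admissible set, which need not be \<open>S\<close>, and \<open>ifvs_if_admissible\<close> applies
  to it.\<close>

lemma ifvs_if_colour_inv: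
  fixes E :: "nat \<Rightarrow> nat \<Rightarrow> bool"
  assumes "p5_free E" and opt: "ifvs E C S" "A \<subseteq> C - S" "Z \<subseteq> S" and cov: "covered E C A Z" and adm: "admissible E C A Z S"
    and C: "C \<subseteq> {..<n}" and inv: "colour_inv n E C A Z S n a"
  shows "ifvs E C {v \<in> C - A. a v = 1} \<and> card {v \<in> C - A. a v = 1} \<le> card S"
proof
  let ?T = "{v \<in> C - A. a v = 1}"
  have i2: "\<And>v. a v \<noteq> 0 \<Longrightarrow> v \<in> C - A" and i3: "\<And>v. v < n \<Longrightarrow> v \<in> C - A \<Longrightarrow> a v \<noteq> 0"
    and i5: "\<And>x y. xor_edge E A Z x y \<Longrightarrow> a x \<noteq> 0 \<Longrightarrow> a x = 1 \<longleftrightarrow> a y \<noteq> 1"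
    and i6: "\<And>x. a x \<noteq> 0 \<Longrightarrow> forced E A Z x \<Longrightarrow> a x = 1"
    and i7: "card {v. v < n \<and> a v = 1} \<le> card {v. v < n \<and> v \<in> S \<and> a v \<noteq> 0}"
    using inv unfolding colour_inv_def by metis+
  have nz: "a v \<noteq> 0" if "v \<in> C - A" for v using i3[of v] that C by blast
  have adm': "admissible E C A Z ?T"
    unfolding admissible_def
  proof (intro conjI ballI impI)
    fix x assume "x \<in> C - A" "forced E A Z x"
    then show "x \<in> ?T" using i6[of x] nz[of x] by simp
  next
    fix x y assume xy: "x \<in> C" "y \<in> C" "xor_edge E A Z x y"
    then have "x \<in> C - A" "y \<in> C - A" unfolding xor_edge_def by blast+
    then show "x \<in> ?T \<longleftrightarrow> y \<notin> ?T" using i5[OF xy(3)] nz by simp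
  qed blast
  have "?T \<subseteq> C" by blast
  then show "ifvs E C ?T" by (rule p5_free.ifvs_if_admissible[OF assms(1) opt cov _ adm'])
  have "?T = {v. v < n \<and> a v = 1}"
  proof (rule set_eqI)
    fix v
    show "v \<in> ?T \<longleftrightarrow> v \<in> {v. v < n \<and> a v = 1}" using i2[of v] C by auto
  qed
  then have "card ?T \<le> card {v. v < n \<and> v \<in> S \<and> a v \<noteq> 0}" using i7 by simp
  also have "\<dots> \<le> card S"
  proof (rule card_mono)
    show "finite S" using opt(1) C finite_subset unfolding ifvs_def by (metis finite_lessThan)
  qed blast
  finally show "card ?T \<le> card S" .
qed

declare One_nat_def [simp del]

section \<open>Specifications of the parts of the program\<close>

text \<open>
  Registers: 1 sum of the optima of the finished components; 2 becomes 1 if one of them has no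
  solution; 3 root and 24 tag of the current component; 13 its best size so far, valid if 25 is 1;
  14 start of the exploration; 15, 16, 17 loop counters; 18, 19 sizes of the two classes (18 is also
  the degree in \<open>strip\<close>); 20, 21 whether they contain a forced vertex; 22 verdict of the check and
  23 size of the checked set. Array 0 holds the tags of the components, array 1 the colours.
\<close>

definition tally :: lcom where
  "tally = LFor 16 1 (LSeq
     (LIf (TEq (Cell 1 16) (Cst 3)) (LSeq (LInc 18) (LIf forced_test (LAssign 20 (Cst 1)) LSkip)) LSkip)
     (LIf (TEq (Cell 1 16) (Cst 4)) (LSeq (LInc 19) (LIf forced_test (LAssign 21 (Cst 1)) LSkip)) LSkip))"

definition relabel :: "nat \<Rightarrow> nat \<Rightarrow> lcom" where
  "relabel p q = LFor 16 1 (LIf (TEq (Cell 1 16) (Cst 3)) (LStore 1 16 (Cst p))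
     (LIf (TEq (Cell 1 16) (Cst 4)) (LStore 1 16 (Cst q)) LSkip))"

definition choose_class :: lcom where
  "choose_class = LIf (TAnd (TEq (Rg 21) (Cst 0)) (TOr (TEq (Rg 20) (Cst 1)) (TNot (TLess (Rg 19) (Rg 18)))))
     (relabel 1 2) (relabel 2 1)"

definition explore :: lcom where
  "explore = LSeqs [LStore 1 14 (Cst 3), flood 1 xor_test (Cst 3) (Cst 4),
     LAssign 18 (Cst 0), LAssign 19 (Cst 0), LAssign 20 (Cst 0), LAssign 21 (Cst 0), tally, choose_class]"

definition colour :: lcom where
  "colour = LSeq (LFor 16 1 (LStore 1 16 (Cst 0)))
     (LFor 14 1 (LIf (TAnd (TEq (Cell 0 14) (Rg 24)) (TAnd (TNot (in_A 14)) (TEq (Cell 1 14) (Cst 0))))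
       explore LSkip))"

text \<open>After a wrong guess the colours mean nothing. Here every vertex of the component is put
  on one of two sides, so that \<open>check\<close> decides about a set and its full
  complement.\<close>

definition normalise :: lcom where
  "normalise = LFor 16 1 (LIf (TEq (Cell 0 16) (Rg 24))
     (LIf (TAnd (TNot (in_A 16)) (TEq (Cell 1 16) (Cst 1))) LSkip (LStore 1 16 (Cst 2)))
     (LStore 1 16 (Cst 0)))"

definition check :: lcom where
  "check = LSeqs [LAssign 22 (Cst 1), LAssign 23 (Cst 0),
     LFor 16 1 (LIf (TEq (Cell 1 16) (Cst 1)) (LInc 23) LSkip),
     LFor 16 1 (LFor 17 1 (LIf (TAnd (TAdj 16 17)
       (TAnd (TEq (Cell 1 16) (Cst 1)) (TEq (Cell 1 17) (Cst 1)))) (LAssign 22 (Cst 0)) LSkip)),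
     strip,
     LFor 16 1 (LIf (TEq (Cell 1 16) (Cst 2)) (LAssign 22 (Cst 0)) LSkip)]"

definition try_guess :: lcom where
  "try_guess = LSeqs [colour, normalise, check,
     LIf (TAnd (TEq (Rg 22) (Cst 1)) (TOr (TEq (Rg 25) (Cst 0)) (TLess (Rg 23) (Rg 13))))
       (LSeq (LAssign 13 (Rg 23)) (LAssign 25 (Cst 1))) LSkip]"

primrec guesses :: "nat list \<Rightarrow> lcom \<Rightarrow> lcom" where
  "guesses [] c = c"
| "guesses (g # gs) c = LFor g 2 (guesses gs c)"

definition component :: lcom where
  "component = LSeqs [LAssign 24 (Rg 3), LInc 24, LStore 0 3 (Rg 24),
     flood 0 (TAdj 16 17) (Rg 24) (Rg 24), LAssign 25 (Cst 0), LAssign 13 (Cst 0),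
     guesses guess_regs try_guess,
     LIf (TEq (Rg 25) (Cst 0)) (LAssign 2 (Cst 1)) LSkip,
     LFor 16 1 (LIf (TLess (Rg 16) (Rg 13)) (LInc 1) LSkip)]"

definition main :: lcom where
  "main = LFor 3 1 (LIf (TEq (Cell 0 3) (Cst 0)) component LSkip)"

lemma writes_flood [simp]: "writes (flood k t p q) = {15, 16, 17}"
  by (simp add: flood_def)

lemma stores_flood [simp]: "stores (flood k t p q) = {k}"
  by (simp add: flood_def)

lemma writes_stores_strip [simp]: "writes strip = {15, 16, 17, 18}" "stores strip = {1}"
  by (auto simp: strip_def)

lemma writes_stores_tally [simp]: "writes tally = {16, 18, 19, 20, 21}" "stores tally = {}"
  by (auto simp: tally_def)

lemma writes_stores_relabel [simp]: "writes (relabel p q) = {16}" "stores (relabel p q) = {1}"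
  by (auto simp: relabel_def)

lemma writes_stores_explore [simp]:
  "writes explore = {15, 16, 17, 18, 19, 20, 21}" "stores explore = {1}"
  by (auto simp: explore_def choose_class_def)

lemma writes_stores_colour [simp]:
  "writes colour = {14, 15, 16, 17, 18, 19, 20, 21}" "stores colour = {1}"
  by (auto simp: colour_def)

lemma writes_stores_normalise [simp]: "writes normalise = {16}" "stores normalise = {1}"
  by (auto simp: normalise_def)

lemma writes_stores_check [simp]:
  "writes check = {15, 16, 17, 18, 22, 23}" "stores check = {1}"
  by (auto simp: check_def)

lemma writes_stores_try_guess [simp]:
  "writes try_guess = {13, 14, 15, 16, 17, 18, 19, 20, 21, 22, 23, 25}" "stores try_guess = {1}"
  by (auto simp: try_guess_def)

lemma writes_guesses [simp]: "writes (guesses gs c) = set gs \<union> writes c"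
  by (induction gs) auto

lemma stores_guesses [simp]: "stores (guesses gs c) = stores c"
  by (induction gs) auto

lemma set_guess_regs: "g \<in> set guess_regs \<longleftrightarrow> 4 \<le> g \<and> g < 13"
  by (auto simp: guess_regs_def)

lemma guess_agree:
  assumes "agree X K s s'" "\<forall>g\<in>X. g < 4 \<or> 13 \<le> g"
  shows "guess_A n (fst s') = guess_A n (fst s)" "guess_Z n (fst s') = guess_Z n (fst s)"
proof -
  have "fst s' g = fst s g" if "g \<in> set guess_regs" for g
  proof -
    have "g \<notin> X" using that assms(2) unfolding set_guess_regs by (metis not_le)
    then show ?thesis using assms(1) by (simp add: agree_def)
  qed
  then show "guess_A n (fst s') = guess_A n (fst s)" "guess_Z n (fst s') = guess_Z n (fst s)"
    unfolding guess_A_def guess_Z_def by auto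
qed

context
  fixes E :: "nat \<Rightarrow> nat \<Rightarrow> bool" and n :: nat
  assumes E_less: "\<forall>x y. E x y \<longrightarrow> x < n \<and> y < n"
begin

lemma test_in_A: "fst s x < n \<Longrightarrow> test_val E n (in_A x) s \<longleftrightarrow> fst s x \<in> guess_A n (fst s)"
  by (auto simp: in_A_def guess_A_def)

lemma test_in_Z: "fst s x < n \<Longrightarrow> test_val E n (in_Z x) s \<longleftrightarrow> fst s x \<in> guess_Z n (fst s)"
  by (auto simp: in_Z_def guess_Z_def)

text \<open>Registers coding members of \<open>Z\<close> do no harm here: their values are at least
  \<open>n\<close>, and \<open>E\<close> relates only smaller numbers.\<close>

lemma test_nbr_A: "test_val E n (nbr_A x) s \<longleftrightarrow> (\<exists>a\<in>guess_A n (fst s). E a (fst s x))"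
  using E_less by (auto simp: nbr_A_def guess_A_def)

lemma test_xor:
  "test_val E n xor_test s \<longleftrightarrow> xor_edge E (guess_A n (fst s)) (guess_Z n (fst s)) (fst s 16) (fst s 17)"
proof (cases "E (fst s 16) (fst s 17)")
  case True
  then have "fst s 16 < n" "fst s 17 < n" using E_less by blast+
  then show ?thesis by (simp add: xor_test_def xor_edge_def test_in_A test_in_Z test_nbr_A disj_assoc)
qed (simp add: xor_test_def xor_edge_def)

lemma test_forced:
  "fst s 16 < n \<Longrightarrow>
    test_val E n forced_test s \<longleftrightarrow> forced E (guess_A n (fst s)) (guess_Z n (fst s)) (fst s 16)"
proof -
  assume "fst s 16 < n"
  moreover have "(\<exists>g\<in>set guess_regs. \<exists>h\<in>set guess_regs. fst s g \<noteq> fst s h \<and> E (fst s g) (fst s 16) \<and> E (fst s h) (fst s 16))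
    \<longleftrightarrow> (\<exists>a\<in>guess_A n (fst s). \<exists>b\<in>guess_A n (fst s). a \<noteq> b \<and> E a (fst s 16) \<and> E b (fst s 16))"
    (is "?L \<longleftrightarrow> ?R")
  proof
    assume ?L then show ?R unfolding guess_A_def using E_less by blast
  next
    assume ?R then show ?L unfolding guess_A_def by blast
  qed
  ultimately show ?thesis by (simp add: forced_test_def forced_def test_in_Z)
qed

lemma run_relabel: "snd (run E n (relabel p q) s) 1 = relabelled n p q (snd s 1)"
proof -
  let ?g = "\<lambda>v w. if w = 3 then p else if w = 4 then q else (w::nat)"
  have "snd (run E n (relabel p q) s) 1 = (\<lambda>v. if v < 1 * n then ?g v (snd s 1 v) else snd s 1 v)"
    unfolding relabel_def by (rule run_For_map[where g = ?g]) auto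
  then show ?thesis by (simp add: relabelled_def)
qed

lemma run_tally:
  assumes "fst s 18 = 0" "fst s 19 = 0" "fst s 20 = 0" "fst s 21 = 0"
  defines "b \<equiv> snd s 1" and "fc \<equiv> forced E (guess_A n (fst s)) (guess_Z n (fst s))"
  shows "fst (run E n tally s) 18 = card {v. v < n \<and> b v = 3}"
    "fst (run E n tally s) 19 = card {v. v < n \<and> b v = 4}"
    "fst (run E n tally s) 20 = (if \<exists>v<n. b v = 3 \<and> fc v then 1 else 0)"
    "fst (run E n tally s) 21 = (if \<exists>v<n. b v = 4 \<and> fc v then 1 else 0)"
proof -
  let ?c = "LSeq
     (LIf (TEq (Cell 1 16) (Cst 3)) (LSeq (LInc 18) (LIf forced_test (LAssign 20 (Cst 1)) LSkip)) LSkip)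
     (LIf (TEq (Cell 1 16) (Cst 4)) (LSeq (LInc 19) (LIf forced_test (LAssign 21 (Cst 1)) LSkip)) LSkip)"
  have ft: "test_val E n forced_test s' \<longleftrightarrow> fc (fst s' 16)"
    if "agree {16, 18, 19, 20, 21} {} s s'" "fst s' 16 < n" for s'
    using that test_forced[of s'] guess_agree[OF that(1)] by (simp add: fc_def)
  have step: "fst (run E n ?c (upd 16 i s')) 18 = (if b i = 3 then Suc (fst s' 18) else fst s' 18) \<and>
      fst (run E n ?c (upd 16 i s')) 19 = (if b i = 4 then Suc (fst s' 19) else fst s' 19) \<and>
      fst (run E n ?c (upd 16 i s')) 20 = (if b i = 3 \<and> fc i then 1 else fst s' 20) \<and>
      fst (run E n ?c (upd 16 i s')) 21 = (if b i = 4 \<and> fc i then 1 else fst s' 21)"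
    if i: "i < 1 * n" and ag: "agree_For 16 ?c s s'" for i s'
  proof -
    have ag': "agree {16, 18, 19, 20, 21} {} s s'" using ag by (rule agree_mono) auto
    have b: "snd s' 1 = b" using ag' by (simp add: agree_def b_def)
    have ft': "test_val E n forced_test (upd 18 j (upd 16 i s')) \<longleftrightarrow> fc i"
      "test_val E n forced_test (upd 19 j (upd 16 i s')) \<longleftrightarrow> fc i" for j
      using i by (subst ft; (intro agree_upd ag')?; simp)+
    show ?thesis by (simp add: b ft')
  qed
  have "fst (run E n (LFor 16 1 ?c) s) 18 = fst s 18 + card {v. v < 1 * n \<and> b v = 3}"
    by (rule run_For_count) (use step in simp_all)
  then show "fst (run E n tally s) 18 = card {v. v < n \<and> b v = 3}"
    unfolding tally_def mult_1 assms(1) add_0 .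
  have "fst (run E n (LFor 16 1 ?c) s) 19 = fst s 19 + card {v. v < 1 * n \<and> b v = 4}"
    by (rule run_For_count) (use step in simp_all)
  then show "fst (run E n tally s) 19 = card {v. v < n \<and> b v = 4}"
    unfolding tally_def mult_1 assms(2) add_0 .
  have "fst (run E n (LFor 16 1 ?c) s) 20 = (if \<exists>v<1 * n. b v = 3 \<and> fc v then 1 else fst s 20)"
    by (rule run_For_flag) (use step in simp_all)
  then show "fst (run E n tally s) 20 = (if \<exists>v<n. b v = 3 \<and> fc v then 1 else 0)"
    unfolding tally_def mult_1 assms(3) .
  have "fst (run E n (LFor 16 1 ?c) s) 21 = (if \<exists>v<1 * n. b v = 4 \<and> fc v then 1 else fst s 21)"
    by (rule run_For_flag) (use step in simp_all)
  then show "fst (run E n tally s) 21 = (if \<exists>v<n. b v = 4 \<and> fc v then 1 else 0)"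
    unfolding tally_def mult_1 assms(4) .
qed

lemma run_explore:
  fixes s :: lstate
  defines "A \<equiv> guess_A n (fst s)" and "Z \<equiv> guess_Z n (fst s)"
  obtains b where "(flood_step n (xor_edge E A Z) 3 4)\<^sup>*\<^sup>* ((snd s 1)(fst s 14 := 3)) b"
    "flood_closed n (xor_edge E A Z) 3 4 b"
    "snd (run E n explore s) 1 = (if first_chosen n (forced E A Z) b
      then relabelled n 1 2 b else relabelled n 2 1 b)"
proof -
  define s1 where "s1 = (fst s, (snd s)(1 := (snd s 1)(fst s 14 := 3)))"
  define s2 where "s2 = run E n (flood 1 xor_test (Cst 3) (Cst 4)) s1"
  define s3 where "s3 = upd 21 0 (upd 20 0 (upd 19 0 (upd 18 0 s2)))"
  define s4 where "s4 = run E n tally s3"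
  define b where "b = snd s2 1"
  have run: "run E n explore s = run E n choose_class s4"
    by (simp add: explore_def s1_def s2_def s3_def s4_def)
  have AZ1: "guess_A n (fst s1) = A" "guess_Z n (fst s1) = Z" by (simp_all add: s1_def A_def Z_def)
  have fl: "(flood_step n (xor_edge E A Z) 3 4)\<^sup>*\<^sup>* (snd s1 1) b \<and> flood_closed n (xor_edge E A Z) 3 4 b"
    unfolding b_def s2_def
  proof (rule run_flood)
    fix s' assume "agree {15, 16, 17} {1} s1 s'"
    then have "guess_A n (fst s') = A" "guess_Z n (fst s') = Z"
      using guess_agree[of "{15, 16, 17}" "{1}" s1 s' n] AZ1 by auto
    then show "test_val E n xor_test s' \<longleftrightarrow> xor_edge E A Z (fst s' 16) (fst s' 17)" by (simp add: test_xor)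
  qed auto
  have "agree {15, 16, 17} {1} s1 s2" unfolding s2_def using agree_run[of "flood 1 xor_test (Cst 3) (Cst 4)"] by simp
  then have "agree {15, 16, 17, 18, 19, 20, 21} {1} s1 s3"
    unfolding s3_def by (intro agree_upd) (auto elim: agree_mono)
  then have AZ3: "guess_A n (fst s3) = A" "guess_Z n (fst s3) = Z"
    using guess_agree[of "{15, 16, 17, 18, 19, 20, 21}" "{1}" s1 s3 n] AZ1 by auto
  have b3: "snd s3 1 = b" by (simp add: s3_def b_def)
  have z: "fst s3 18 = 0" "fst s3 19 = 0" "fst s3 20 = 0" "fst s3 21 = 0" by (simp_all add: s3_def)
  note t = run_tally[OF z, folded s4_def, unfolded b3 AZ3]
  have flag01: "(if P then 1 else 0) = (0::nat) \<longleftrightarrow> \<not> P" "(if P then 1 else 0) = (1::nat) \<longleftrightarrow> P" for P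
    by auto
  have b4: "snd s4 1 = b" unfolding s4_def using run_array_frame[of 1 tally] b3 by simp
  have "test_val E n (TAnd (TEq (Rg 21) (Cst 0)) (TOr (TEq (Rg 20) (Cst 1)) (TNot (TLess (Rg 19) (Rg 18))))) s4
      \<longleftrightarrow> first_chosen n (forced E A Z) b"
    by (simp only: test_val.simps test_val_TEq test_val_TOr atom_val.simps t flag01 not_less first_chosen_def)
  then have "snd (run E n explore s) 1 = (if first_chosen n (forced E A Z) b
      then relabelled n 1 2 b else relabelled n 2 1 b)"
    unfolding run choose_class_def by (simp add: run_relabel b4)
  then show ?thesis using that[of b] fl by (simp add: s1_def)
qed

end

text \<open>Cells with an index of at least \<open>n\<close> are never read, but need not be 0.\<close>

definition trunc :: "nat \<Rightarrow> (nat \<Rightarrow> nat) \<Rightarrow> nat \<Rightarrow> nat" where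
  "trunc n a = (\<lambda>v. if v < n then a v else 0)"

lemma trunc_upd: "y < n \<Longrightarrow> trunc n (a(y := v)) = (trunc n a)(y := v)"
  by (auto simp: trunc_def)

lemma flood_step_trunc: "flood_step n R p q a b \<Longrightarrow> flood_step n R p q (trunc n a) (trunc n b)"
proof -
  assume "flood_step n R p q a b"
  then obtain x y where xy: "x < n" "y < n" "R x y" "a y = 0"
    and b: "a x = p \<and> b = a(y := q) \<or> a x = q \<and> b = a(y := p)"
    unfolding flood_step_def by blast
  have "trunc n a x = a x" "trunc n a y = a y" using xy by (simp_all add: trunc_def)
  then show ?thesis unfolding flood_step_def using xy b trunc_upd[OF xy(2)] by metis
qed

lemma flood_steps_trunc:
  "(flood_step n R p q)\<^sup>*\<^sup>* a b \<Longrightarrow> (flood_step n R p q)\<^sup>*\<^sup>* (trunc n a) (trunc n b)"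
  by (induction rule: rtranclp_induct) (auto intro: flood_step_trunc rtranclp.rtrancl_into_rtrancl)

lemma flood_closed_trunc: "flood_closed n R p q a \<Longrightarrow> flood_closed n R p q (trunc n a)"
  by (auto simp: flood_closed_def trunc_def)

lemma first_chosen_trunc: "first_chosen n fc (trunc n b) = first_chosen n fc b"
proof -
  have "{v. v < n \<and> trunc n b v = j} = {v. v < n \<and> b v = j}" for j by (auto simp: trunc_def)
  moreover have "(\<exists>v<n. trunc n b v = j \<and> fc v) \<longleftrightarrow> (\<exists>v<n. b v = j \<and> fc v)" for j by (auto simp: trunc_def)
  ultimately show ?thesis unfolding first_chosen_def by simp
qed

lemma relabelled_trunc: "trunc n (relabelled n p q b) = relabelled n p q (trunc n b)"
  by (auto simp: relabelled_def trunc_def fun_eq_iff)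

definition good_guess :: "(nat \<Rightarrow> nat \<Rightarrow> bool) \<Rightarrow> nat set \<Rightarrow> nat set \<Rightarrow> nat set \<Rightarrow> nat set \<Rightarrow> bool" where
  "good_guess E C A Z S \<longleftrightarrow> ifvs E C S \<and> A \<subseteq> C - S \<and> Z \<subseteq> S \<and> covered E C A Z \<and> admissible E C A Z S"

definition tagged :: "nat \<Rightarrow> lstate \<Rightarrow> nat set" where
  "tagged n s = {v. v < n \<and> snd s 0 v = fst s 24}"

lemma colour_inv_Suc:
  assumes inv: "colour_inv n E C A Z S i a" and i: "i \<in> C - A \<longrightarrow> a i \<noteq> 0"
  shows "colour_inv n E C A Z S (Suc i) a"
proof -
  have "\<forall>v<i. v \<in> C - A \<longrightarrow> a v \<noteq> 0" using inv unfolding colour_inv_def by (elim conjE)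
  then have "\<forall>v<Suc i. v \<in> C - A \<longrightarrow> a v \<noteq> 0" using i by (metis less_SucE)
  with inv show ?thesis unfolding colour_inv_def by (elim conjE, intro conjI)
qed

context
  fixes E :: "nat \<Rightarrow> nat \<Rightarrow> bool" and n :: nat
  assumes E_less: "\<forall>x y. E x y \<longrightarrow> x < n \<and> y < n" and p5: "p5_free E"
begin

text \<open>\<open>S\<close> occurs in the invariant but not in the program: it is the unknown
  solution against which the number of vertices of colour 1 is compared.\<close>

lemma run_colour:
  fixes s :: lstate
  defines "C \<equiv> tagged n s" and "A \<equiv> guess_A n (fst s)" and "Z \<equiv> guess_Z n (fst s)"
  assumes closed: "\<And>x y. x \<in> C \<Longrightarrow> E x y \<Longrightarrow> y \<in> C" and adm: "admissible E C A Z S"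
  shows "colour_inv n E C A Z S n (trunc n (snd (run E n colour s) 1))"
proof -
  define s1 where "s1 = run E n (LFor 16 1 (LStore 1 16 (Cst 0))) s"
  let ?t = "TAnd (TEq (Cell 0 14) (Rg 24)) (TAnd (TNot (in_A 14)) (TEq (Cell 1 14) (Cst 0)))"
  let ?c = "LIf ?t explore LSkip"
  have ag1: "agree {16} {1} s s1"
    unfolding s1_def using agree_run[of "LFor 16 1 (LStore 1 16 (Cst 0))" s E n] by simp
  have "snd s1 1 = (\<lambda>v. if v < 1 * n then 0 else snd s 1 v)"
    unfolding s1_def by (rule run_For_map[where g = "\<lambda>_ _. 0"]) simp
  then have z: "trunc n (snd s1 1) = (\<lambda>_. 0)" by (auto simp: trunc_def)
  let ?I = "\<lambda>i s'. colour_inv n E C A Z S i (trunc n (snd s' 1))"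
  obtain s' where s': "run E n (LFor 14 1 ?c) s1 = upd 14 (1 * n) s'" "?I (1 * n) s'"
  proof (rule run_For_rule[of ?I s1 1 n 14 ?c E])
    show "?I 0 s1" unfolding z by (simp add: colour_inv_def)
    fix i s' assume i: "i < 1 * n" and ag: "agree_For 14 ?c s1 s'" and I: "?I i s'"
    define s0 where "s0 = upd 14 i s'"
    have "agree {14, 15, 16, 17, 18, 19, 20, 21} {1} s1 s'" using ag by (rule agree_mono) auto
    then have b: "agree {14, 15, 16, 17, 18, 19, 20, 21} {1} s1 s0" unfolding s0_def by (intro agree_upd) auto
    have a: "agree {14, 15, 16, 17, 18, 19, 20, 21} {1} s s1" using ag1 by (rule agree_mono) auto
    have ag0: "agree {14, 15, 16, 17, 18, 19, 20, 21} {1} s s0" using a b by (rule agree_trans)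
    have AZ: "guess_A n (fst s0) = A" "guess_Z n (fst s0) = Z"
      using guess_agree[OF ag0, of n] by (simp_all add: A_def Z_def)
    have iC: "snd s0 0 i = fst s0 24 \<longleftrightarrow> i \<in> C"
      using ag0 i by (simp add: agree_def C_def tagged_def)
    have s0: "fst s0 14 = i" "snd s0 1 = snd s' 1" by (simp_all add: s0_def)
    have test: "test_val E n ?t s0 \<longleftrightarrow> i \<in> C - A \<and> trunc n (snd s' 1) i = 0"
      using iC test_in_A[OF E_less, where s = s0 and x = 14] i by (auto simp: s0 AZ trunc_def)
    show "?I (Suc i) (run E n ?c (upd 14 i s'))"
    proof (cases "i \<in> C - A \<and> trunc n (snd s' 1) i = 0")
      case True
      then have run: "run E n ?c (upd 14 i s') = run E n explore s0"
        using test unfolding s0_def[symmetric] by simp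
      obtain b where b: "(flood_step n (xor_edge E A Z) 3 4)\<^sup>*\<^sup>* ((snd s' 1)(i := 3)) b"
        "flood_closed n (xor_edge E A Z) 3 4 b"
        "snd (run E n explore s0) 1 = (if first_chosen n (forced E A Z) b
          then relabelled n 1 2 b else relabelled n 2 1 b)"
        using run_explore[OF E_less, where s = s0] unfolding AZ s0 by metis
      show ?thesis unfolding run
      proof (rule colour_inv_step[OF I p5_free.sym[OF p5]])
        show "C \<subseteq> {..<n}" by (auto simp: C_def tagged_def)
        show "i \<in> C - A" "trunc n (snd s' 1) i = 0" using True by auto
        show "(flood_step n (xor_edge E A Z) 3 4)\<^sup>*\<^sup>* ((trunc n (snd s' 1))(i := 3)) (trunc n b)"
          using flood_steps_trunc[OF b(1)] trunc_upd[of i n] i by simp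
        show "flood_closed n (xor_edge E A Z) 3 4 (trunc n b)" using b(2) by (rule flood_closed_trunc)
        show "trunc n (snd (run E n explore s0) 1) = (if first_chosen n (forced E A Z) (trunc n b)
            then relabelled n 1 2 (trunc n b) else relabelled n 2 1 (trunc n b))"
          unfolding b(3) first_chosen_trunc by (simp add: relabelled_trunc)
      qed (use closed adm in blast)+
    next
      case False
      then have "\<not> test_val E n ?t s0" using test by blast
      then have run: "run E n ?c (upd 14 i s') = s0" by (simp only: s0_def[symmetric] run.simps if_False)
      have "i \<in> C - A \<longrightarrow> trunc n (snd s' 1) i \<noteq> 0" using False by auto
      then show ?thesis using colour_inv_Suc[OF I] unfolding run s0 by blast
    qed
  qed
  have "run E n colour s = upd 14 (1 * n) s'" using s'(1) by (simp add: colour_def s1_def)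
  then show ?thesis using s'(2) by simp
qed

lemma run_normalise:
  "snd (run E n normalise s) 1 = (\<lambda>v. if v < n then
    (if v \<in> tagged n s then (if v \<notin> guess_A n (fst s) \<and> snd s 1 v = 1 then 1 else 2) else 0) else snd s 1 v)"
proof -
  let ?g = "\<lambda>v w. if v \<in> tagged n s then (if v \<notin> guess_A n (fst s) \<and> w = 1 then 1 else 2) else (0::nat)"
  let ?c = "LIf (TEq (Cell 0 16) (Rg 24))
     (LIf (TAnd (TNot (in_A 16)) (TEq (Cell 1 16) (Cst 1))) LSkip (LStore 1 16 (Cst 2)))
     (LStore 1 16 (Cst 0))"
  have "snd (run E n (LFor 16 1 ?c) s) 1 = (\<lambda>v. if v < 1 * n then ?g v (snd s 1 v) else snd s 1 v)"
  proof (rule run_For_map[where g = ?g])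
    fix i s' assume i: "i < 1 * n" and ag: "agree_For 16 ?c s s'"
    have ag': "agree {16} {1} s (upd 16 i s')" using ag by (intro agree_upd) (auto elim: agree_mono)
    have A: "test_val E n (in_A 16) (upd 16 i s') \<longleftrightarrow> i \<in> guess_A n (fst s)"
      using test_in_A[OF E_less, where s = "upd 16 i s'" and x = 16] guess_agree[OF ag', of n] i by simp
    have C: "i \<in> tagged n s \<longleftrightarrow> snd s' 0 i = fst s' 24" using ag' i by (auto simp: agree_def tagged_def)
    have same: "snd s' 1 i = 1 \<Longrightarrow> snd s' 1 = (snd s' 1)(i := 1)" by (metis fun_upd_triv)
    show "snd (run E n ?c (upd 16 i s')) 1 = (snd s' 1)(i := ?g i (snd s' 1 i))"
      using same by (simp add: A C)
  qed
  then show ?thesis by (simp add: normalise_def)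
qed

lemma run_check:
  fixes s :: lstate
  defines "a \<equiv> snd s 1"
  shows "fst (run E n check s) 23 = card {v. v < n \<and> a v = 1}"
    "fst (run E n check s) 22 = 1 \<longleftrightarrow>
      (\<forall>x\<in>{v. v < n \<and> a v = 1}. \<forall>y\<in>{v. v < n \<and> a v = 1}. \<not> E x y) \<and> acyclic_on E {v. v < n \<and> a v = 2}"
proof -
  let ?S = "\<lambda>j. {v. v < n \<and> a v = j}"
  define s1 where "s1 = upd 23 0 (upd 22 1 s)"
  let ?c2 = "LIf (TEq (Cell 1 16) (Cst 1)) (LInc 23) LSkip"
  define s2 where "s2 = run E n (LFor 16 1 ?c2) s1"
  let ?c3 = "LIf (TAnd (TAdj 16 17) (TAnd (TEq (Cell 1 16) (Cst 1)) (TEq (Cell 1 17) (Cst 1)))) (LAssign 22 (Cst 0)) LSkip"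
  define s3 where "s3 = run E n (LFor 16 1 (LFor 17 1 ?c3)) s2"
  define s4 where "s4 = run E n strip s3"
  let ?c5 = "LIf (TEq (Cell 1 16) (Cst 2)) (LAssign 22 (Cst 0)) LSkip"
  define s5 where "s5 = run E n (LFor 16 1 ?c5) s4"
  have run: "run E n check s = s5" by (simp add: check_def s1_def s2_def s3_def s4_def s5_def)
  have a1: "snd s1 1 = a" by (simp add: s1_def a_def)
  have "fst s2 23 = fst s1 23 + card {v. v < 1 * n \<and> a v = 1}"
    unfolding s2_def by (rule run_For_count) (simp_all add: agree_def a1)
  then have c2: "fst s2 23 = card (?S 1)" by (simp add: s1_def)
  have f2: "fst s2 22 = 1" "snd s2 1 = a"
    unfolding s2_def using run_frame[of 22 "LFor 16 1 ?c2"] run_array_frame[of 1 "LFor 16 1 ?c2"] a1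
    by (simp_all add: s1_def)
  have inner: "fst (run E n (LFor 17 1 ?c3) (upd 16 i s')) 22 =
      (if \<exists>j<n. E i j \<and> a i = 1 \<and> a j = 1 then 0 else fst s' 22)" if "snd s' 1 = a" for i s'
  proof -
    have "fst (run E n (LFor 17 1 ?c3) (upd 16 i s')) 22 =
      (if \<exists>j<1 * n. E i j \<and> a i = 1 \<and> a j = 1 then 0 else fst (upd 16 i s') 22)"
      by (rule run_For_flag) (simp_all add: agree_def that)
    moreover have "fst (upd 16 i s') 22 = fst s' 22" by simp
    ultimately show ?thesis unfolding mult_1 by (simp only:)
  qed
  have "fst s3 22 = (if \<exists>i<1 * n. \<exists>j<n. E i j \<and> a i = 1 \<and> a j = 1 then 0 else fst s2 22)"
    unfolding s3_def
  proof (rule run_For_flag)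
    fix i s' assume "agree_For 16 (LFor 17 1 ?c3) s2 s'"
    then have "snd s' 1 = a" using f2(2) by (simp add: agree_def)
    then show "fst (run E n (LFor 17 1 ?c3) (upd 16 i s')) 22 =
      (if \<exists>j<n. E i j \<and> a i = 1 \<and> a j = 1 then 0 else fst s' 22)" by (rule inner)
  qed simp
  then have c3: "fst s3 22 = (if \<exists>i<n. \<exists>j<n. E i j \<and> a i = 1 \<and> a j = 1 then 0 else 1)"
    unfolding f2(1) mult_1 .
  have f3: "fst s3 23 = card (?S 1)" "snd s3 1 = a"
    unfolding s3_def using run_frame[of 23 "LFor 16 1 (LFor 17 1 ?c3)"]
      run_array_frame[of 1 "LFor 16 1 (LFor 17 1 ?c3)"] c2 f2(2)
    by simp_all
  have f4: "fst s4 22 = fst s3 22" "fst s4 23 = fst s3 23"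
    unfolding s4_def by (simp_all add: run_frame)
  have ac: "(\<forall>x<n. snd s4 1 x \<noteq> 2) \<longleftrightarrow> acyclic_on E (?S 2)"
    unfolding s4_def using acyclic_on_iff_stripped run_strip[of n E s3] unfolding f3(2) by blast
  have "fst s5 22 = (if \<exists>i<1 * n. snd s4 1 i = 2 then 0 else fst s4 22)"
    unfolding s5_def by (rule run_For_flag) (simp_all add: agree_def)
  then have c5: "fst s5 22 = (if acyclic_on E (?S 2) then fst s3 22 else 0)"
    unfolding f4(1) mult_1 ac[symmetric] by auto
  have "fst s5 23 = fst s4 23" unfolding s5_def by (simp add: run_frame)
  then show "fst (run E n check s) 23 = card (?S 1)" unfolding run f4 f3 .
  show "fst (run E n check s) 22 = 1 \<longleftrightarrow>
      (\<forall>x\<in>?S 1. \<forall>y\<in>?S 1. \<not> E x y) \<and> acyclic_on E (?S 2)"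
    unfolding run c5 c3 by auto
qed

text \<open>Soundness holds for every guess, since a size is recorded only after the check. Only the
  comparison with \<open>S\<close> needs a good guess.\<close>

lemma run_try_guess:
  fixes s :: lstate
  defines "C \<equiv> tagged n s" and "A \<equiv> guess_A n (fst s)" and "Z \<equiv> guess_Z n (fst s)"
    and "s' \<equiv> run E n try_guess s"
  assumes closed: "\<And>x y. x \<in> C \<Longrightarrow> E x y \<Longrightarrow> y \<in> C"
  obtains T where
    "fst s' 13 = (if ifvs E C T \<and> (fst s 25 = 0 \<or> card T < fst s 13) then card T else fst s 13)"
    "fst s' 25 = (if ifvs E C T \<and> (fst s 25 = 0 \<or> card T < fst s 13) then 1 else fst s 25)"
    "\<And>S. good_guess E C A Z S \<Longrightarrow> ifvs E C T \<and> card T \<le> card S"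
proof -
  define s1 where "s1 = run E n colour s"
  define s2 where "s2 = run E n normalise s1"
  define s3 where "s3 = run E n check s2"
  define T where "T = {v \<in> C - A. snd s1 1 v = 1}"
  have ag1: "agree {14, 15, 16, 17, 18, 19, 20, 21} {1} s s1"
    unfolding s1_def using agree_run[of colour s E n] by simp
  have A1: "guess_A n (fst s1) = A" using guess_agree[OF ag1, of n] by (simp add: A_def)
  have C1: "tagged n s1 = C" using ag1 by (simp add: tagged_def C_def agree_def)
  have Cn: "C \<subseteq> {..<n}" by (auto simp: C_def tagged_def)
  have a2: "snd s2 1 v = (if v \<in> C then (if v \<in> T then 1 else 2) else 0)" if "v < n" for v
    using that unfolding s2_def run_normalise A1 C1 T_def by auto
  have sets: "{v. v < n \<and> snd s2 1 v = 1} = T" "{v. v < n \<and> snd s2 1 v = 2} = C - T"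
    using a2 Cn by (auto simp: T_def split: if_splits)
  have ok: "fst s3 22 = 1 \<longleftrightarrow> ifvs E C T"
    unfolding s3_def run_check(2) sets ifvs_def by (auto simp: T_def)
  have cnt: "fst s3 23 = card T" unfolding s3_def run_check(1) sets ..
  have fr: "fst s3 13 = fst s 13" "fst s3 25 = fst s 25"
    unfolding s3_def s2_def s1_def by (simp_all add: run_frame)
  have run: "s' = run E n (LIf (TAnd (TEq (Rg 22) (Cst 1)) (TOr (TEq (Rg 25) (Cst 0)) (TLess (Rg 23) (Rg 13))))
       (LSeq (LAssign 13 (Rg 23)) (LAssign 25 (Cst 1))) LSkip) s3"
    by (simp add: s'_def try_guess_def s1_def s2_def s3_def)
  show ?thesis
  proof (rule that[of T])
    show "fst s' 13 = (if ifvs E C T \<and> (fst s 25 = 0 \<or> card T < fst s 13) then card T else fst s 13)"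
      "fst s' 25 = (if ifvs E C T \<and> (fst s 25 = 0 \<or> card T < fst s 13) then 1 else fst s 25)"
      unfolding run by (auto simp: ok cnt fr)
    fix S assume g: "good_guess E C A Z S"
    then have "colour_inv n E C A Z S n (trunc n (snd s1 1))"
      unfolding s1_def C_def A_def Z_def good_guess_def
      by (intro run_colour) (use closed[unfolded C_def] in blast)+
    then have "ifvs E C {v \<in> C - A. trunc n (snd s1 1) v = 1} \<and>
        card {v \<in> C - A. trunc n (snd s1 1) v = 1} \<le> card S"
      using g Cn unfolding good_guess_def by (intro ifvs_if_colour_inv[OF p5]) auto
    moreover have "{v \<in> C - A. trunc n (snd s1 1) v = 1} = T"
      using Cn by (auto simp: T_def trunc_def)
    ultimately show "ifvs E C T \<and> card T \<le> card S" by simp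
  qed
qed

end

section \<open>Enumeration of all guesses\<close>

lemma run_guesses_inv:
  assumes "\<And>s. I s \<Longrightarrow> I (run E n c s)" "\<And>s g v. g \<in> set gs \<Longrightarrow> I s \<Longrightarrow> I (upd g v s)" "I s"
  shows "I (run E n (guesses gs c) s)"
  using assms(2,3)
proof (induction gs arbitrary: s)
  case Nil
  then show ?case using assms(1) by simp
next
  case (Cons g gs)
  obtain s' where "run E n (LFor g 2 (guesses gs c)) s = upd g (2 * n) s'" "I s'"
    by (rule run_For_rule[of "\<lambda>_. I" s 2 n g "guesses gs c" E]) (use Cons in auto)
  then show ?case using Cons.prems(1)[of g s'] by simp
qed

text \<open>The nested loops meet the assignment \<open>\<gamma>\<close> at some time. What the body
  achieves there, and neither later runs nor counter updates destroy, holds in the end.\<close>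

lemma run_guesses_hit:
  assumes I: "\<And>s. I s \<Longrightarrow> I (run E n c s)" "\<And>s g v. g \<in> G \<Longrightarrow> I s \<Longrightarrow> I (upd g v s)"
    and Q: "\<And>s. I s \<Longrightarrow> Q s \<Longrightarrow> Q (run E n c s)" "\<And>s g v. g \<in> G \<Longrightarrow> Q s \<Longrightarrow> Q (upd g v s)"
    and hit: "\<And>s. I s \<Longrightarrow> (\<forall>g\<in>G. fst s g = \<gamma> g) \<Longrightarrow> Q (run E n c s)"
    and G: "G \<inter> writes c = {}" "\<forall>g\<in>G. \<gamma> g < 2 * n"
    and gs: "distinct gs" "set gs \<subseteq> G" and s: "I s" "\<forall>g\<in>G - set gs. fst s g = \<gamma> g"
  shows "Q (run E n (guesses gs c) s)"
  using gs s
proof (induction gs arbitrary: s)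
  case Nil
  then show ?case using hit by simp
next
  case (Cons g gs)
  let ?c = "guesses gs c"
  \<comment> \<open>The registers of the outer loops already have their target values;
    \<open>Q\<close> holds as soon as the round with value \<open>\<gamma> g\<close> is
    over.\<close>
  let ?I = "\<lambda>i s'. I s' \<and> (\<forall>h\<in>G - set (g # gs). fst s' h = \<gamma> h) \<and> (\<gamma> g < i \<longrightarrow> Q s')"
  have gG: "g \<in> G" using Cons.prems(2) by simp
  obtain s' where s': "run E n (LFor g 2 ?c) s = upd g (2 * n) s'" "?I (2 * n) s'"
  proof (rule run_For_rule[of ?I s 2 n g ?c E])
    show "?I 0 s" using Cons.prems by simp
    fix i s' assume I': "?I i s'"
    let ?s = "upd g i s'"
    have Is: "I ?s" using I' I(2)[OF gG] by blast
    have "I (run E n ?c ?s)"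
      by (rule run_guesses_inv) (use I Is Cons.prems(2) in auto)
    moreover have "\<forall>h\<in>G - set (g # gs). fst (run E n ?c ?s) h = \<gamma> h"
    proof
      fix h assume h: "h \<in> G - set (g # gs)"
      then have "h \<notin> writes ?c" using G(1) by auto
      then show "fst (run E n ?c ?s) h = \<gamma> h" using run_frame[of h ?c] I' h by simp
    qed
    moreover have "Q (run E n ?c ?s)" if "\<gamma> g < Suc i"
    proof (cases "\<gamma> g = i")
      case True
      then have "\<forall>h\<in>G - set gs. fst ?s h = \<gamma> h" using I' by simp
      then show ?thesis using Cons.IH[of ?s] Cons.prems Is by simp
    next
      case False
      then have "Q s'" using I' that by simp
      then have "I ?s \<and> Q ?s" using Is Q(2)[OF gG] by blast
      then have "I (run E n ?c ?s) \<and> Q (run E n ?c ?s)"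
        by (intro run_guesses_inv[of "\<lambda>s. I s \<and> Q s"]) (use I Q Cons.prems(2) in auto)
      then show ?thesis by blast
    qed
    ultimately show "?I (Suc i) (run E n ?c ?s)" by blast
  qed
  have "\<gamma> g < 2 * n" using G(2) gG by simp
  then have "Q s'" using s'(2) by blast
  then show ?case using s'(1) Q(2)[OF gG] by simp
qed

section \<open>Additivity of the optimum over components\<close>

definition min_ifvs :: "(nat \<Rightarrow> nat \<Rightarrow> bool) \<Rightarrow> nat set \<Rightarrow> nat set \<Rightarrow> bool" where
  "min_ifvs E C T \<longleftrightarrow> ifvs E C T \<and> (\<forall>S. ifvs E C S \<longrightarrow> card T \<le> card S)"

text \<open>A solution of the union restricts to a solution of either part, whence the lower bound;
  without edges in between, solutions of the parts unite to one of the union.\<close>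

lemma min_ifvs_Un:
  assumes T: "min_ifvs E C T" "min_ifvs E D U" and fin: "finite C" "finite D" and disj: "C \<inter> D = {}"
    and sep: "\<And>x y. x \<in> C \<Longrightarrow> y \<in> D \<Longrightarrow> \<not> E x y" "\<And>x y. x \<in> D \<Longrightarrow> y \<in> C \<Longrightarrow> \<not> E x y"
  shows "min_ifvs E (C \<union> D) (T \<union> U)" "card (T \<union> U) = card T + card U"
proof -
  have sub: "T \<subseteq> C" "U \<subseteq> D" using T unfolding min_ifvs_def ifvs_def by blast+
  show card: "card (T \<union> U) = card T + card U"
    using sub disj fin by (intro card_Un_disjoint) (auto intro: finite_subset)
  have "card (T \<union> U) \<le> card S" if S: "ifvs E (C \<union> D) S" for S
  proof -
    have SCD: "S \<subseteq> C \<union> D" using S unfolding ifvs_def by blast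
    have "card T \<le> card (S \<inter> C)" "card U \<le> card (S \<inter> D)"
      using T ifvs_restrict[OF S, of C] ifvs_restrict[OF S, of D] unfolding min_ifvs_def by auto
    then have "card (T \<union> U) \<le> card (S \<inter> C) + card (S \<inter> D)" unfolding card by (rule add_le_mono)
    also have "\<dots> = card ((S \<inter> C) \<union> (S \<inter> D))"
      using disj fin by (intro card_Un_disjoint[symmetric]) auto
    also have "(S \<inter> C) \<union> (S \<inter> D) = S" using SCD by blast
    finally show ?thesis .
  qed
  moreover have "ifvs E (C \<union> D) (T \<union> U)"
    using T disj sep unfolding min_ifvs_def by (intro ifvs_Un) auto
  ultimately show "min_ifvs E (C \<union> D) (T \<union> U)" unfolding min_ifvs_def by blast
qed

text \<open>Entry \<open>g - 4\<close> of the list is held in register \<open>g\<close>. Its vertex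
  is below \<open>n\<close>, so adding \<open>n\<close> for the sign \<open>False\<close> is
  unambiguous.\<close>

lemma guess_of_list:
  assumes L: "length L = 9" "set L \<subseteq> UNIV \<times> {..<n}"
    and \<rho>: "\<forall>g\<in>set guess_regs. \<rho> g = (if fst (L ! (g - 4)) then snd (L ! (g - 4)) else snd (L ! (g - 4)) + n)"
  shows "guess_A n \<rho> = {v. (True, v) \<in> set L}" "guess_Z n \<rho> = {v. (False, v) \<in> set L}"
proof -
  have in_L: "(b, v) \<in> set L \<longleftrightarrow> (\<exists>g\<in>set guess_regs. L ! (g - 4) = (b, v))" for b v
  proof
    assume "(b, v) \<in> set L"
    then obtain i where "i < 9" "L ! i = (b, v)" using L(1) by (metis in_set_conv_nth)
    then have "i + 4 \<in> set guess_regs" "L ! (i + 4 - 4) = (b, v)" by (simp_all add: set_guess_regs)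
    then show "\<exists>g\<in>set guess_regs. L ! (g - 4) = (b, v)" by blast
  next
    assume "\<exists>g\<in>set guess_regs. L ! (g - 4) = (b, v)"
    then obtain g where g: "g \<in> set guess_regs" and "L ! (g - 4) = (b, v)" by (elim bexE)
    moreover have "4 \<le> g" "g < 13" using g by (simp_all add: set_guess_regs)
    ultimately show "(b, v) \<in> set L" using L(1) nth_mem[of "g - 4" L] by simp
  qed
  have less: "snd (L ! (g - 4)) < n" if "g \<in> set guess_regs" for g
  proof -
    have "L ! (g - 4) \<in> set L" using that L(1) unfolding set_guess_regs by (intro nth_mem) linarith
    then show ?thesis using L(2) by auto
  qed
  have A: "v < n \<and> \<rho> g = v \<longleftrightarrow> L ! (g - 4) = (True, v)" if "g \<in> set guess_regs" for g v
    using less[OF that] \<rho> that by (cases "L ! (g - 4)") auto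
  have Z: "v < n \<and> \<rho> g = v + n \<longleftrightarrow> L ! (g - 4) = (False, v)" if "g \<in> set guess_regs" for g v
    using less[OF that] \<rho> that by (cases "L ! (g - 4)") auto
  have "v \<in> guess_A n \<rho> \<longleftrightarrow> (\<exists>g\<in>set guess_regs. v < n \<and> \<rho> g = v)" for v
    by (simp add: guess_A_def)
  then show "guess_A n \<rho> = {v. (True, v) \<in> set L}"
    by (simp add: set_eq_iff in_L A cong: bex_cong)
  have "v \<in> guess_Z n \<rho> \<longleftrightarrow> (\<exists>g\<in>set guess_regs. v < n \<and> \<rho> g = v + n)" for v
    by (simp add: guess_Z_def)
  then show "guess_Z n \<rho> = {v. (False, v) \<in> set L}"
    by (simp add: set_eq_iff in_L Z cong: bex_cong)
qed

section \<open>Search within a component and summation over the components\<close>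

context
  fixes E :: "nat \<Rightarrow> nat \<Rightarrow> bool" and n :: nat
  assumes E_less: "\<forall>x y. E x y \<longrightarrow> x < n \<and> y < n" and p5: "p5_free E"
begin

text \<open>Recorded sizes always belong to actual solutions. Conversely, for each solution
  \<open>S\<close> the enumeration passes a good guess, after which the recorded size is at most
  \<open>card S\<close>; this holds for all \<open>S\<close> at once.\<close>

lemma run_search:
  fixes s :: lstate
  defines "C \<equiv> tagged n s" and "s' \<equiv> run E n (guesses guess_regs try_guess) s"
  assumes closed: "\<And>x y. x \<in> C \<Longrightarrow> E x y \<Longrightarrow> y \<in> C" and grown: "grown E r C"
    and start: "fst s 25 = 0" "fst s 13 = 0"
  shows "fst s' 25 = 0 \<Longrightarrow> fst s' 13 = 0 \<and> \<not> (\<exists>S. ifvs E C S)"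
    "fst s' 25 \<noteq> 0 \<Longrightarrow> \<exists>T. min_ifvs E C T \<and> fst s' 13 = card T"
proof -
  let ?better = "\<lambda>t T. ifvs E C T \<and> (fst t 25 = 0 \<or> card T < fst t 13)" and ?run = "run E n try_guess"
  let ?X = "set guess_regs \<union> writes try_guess"
  define I where "I = (\<lambda>t. agree ?X {1} s t \<and> (fst t 25 = 0 \<longrightarrow> fst t 13 = 0) \<and>
     (fst t 25 \<noteq> 0 \<longrightarrow> (\<exists>T. ifvs E C T \<and> fst t 13 = card T)))"
  have Is: "I s" using start by (simp add: I_def agree_refl)
  have tag: "tagged n t = C" if "I t" for t
    using that by (simp add: I_def agree_def tagged_def C_def set_guess_regs)
  have try_ex: "\<exists>T. fst (?run t) 13 = (if ?better t T then card T else fst t 13) \<and>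
      fst (?run t) 25 = (if ?better t T then 1 else fst t 25) \<and>
      (\<forall>S. good_guess E C (guess_A n (fst t)) (guess_Z n (fst t)) S \<longrightarrow> ifvs E C T \<and> card T \<le> card S)"
    if "I t" for t
  proof -
    note rt = run_try_guess[OF E_less p5, where s = t, unfolded tag[OF that]]
    obtain T where T: "fst (?run t) 13 = (if ?better t T then card T else fst t 13)"
      "fst (?run t) 25 = (if ?better t T then 1 else fst t 25)"
      "\<And>S. good_guess E C (guess_A n (fst t)) (guess_Z n (fst t)) S \<Longrightarrow> ifvs E C T \<and> card T \<le> card S"
      by (rule rt) (auto intro: closed)
    show ?thesis by (rule exI[of _ T]) (use T in simp)
  qed
  have Irun: "I (?run t)" if It: "I t" for t
  proof -
    obtain T where T: "fst (?run t) 13 = (if ?better t T then card T else fst t 13)"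
      "fst (?run t) 25 = (if ?better t T then 1 else fst t 25)"
      using try_ex[OF It] by blast
    have a: "agree ?X {1} t (?run t)" by (rule agree_mono[OF agree_run]) auto
    have "agree ?X {1} s t" using It by (simp add: I_def)
    then have "agree ?X {1} s (?run t)" using a by (rule agree_trans)
    then show ?thesis using It T unfolding I_def by (auto split: if_splits)
  qed
  have Iupd: "I (upd g v t)" if "g \<in> set guess_regs" "I t" for g v t
  proof -
    have "g \<noteq> 25" "g \<noteq> 13" using that(1) by (auto simp: set_guess_regs)
    moreover have "agree ?X {1} s (upd g v t)" using that by (intro agree_upd) (auto simp: I_def)
    ultimately show ?thesis using that(2) unfolding I_def by simp
  qed
  have Is': "I s'" unfolding s'_def by (rule run_guesses_inv) (use Irun Iupd Is in auto)
  have opt: "fst s' 25 \<noteq> 0 \<and> fst s' 13 \<le> card S" if S: "ifvs E C S" for S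
  proof -
    have Cn: "C \<subseteq> {..<n}" by (auto simp: C_def tagged_def)
    obtain L where L: "length L = 9" "set L \<subseteq> UNIV \<times> C"
      and good: "good_guess E C {v. (True, v) \<in> set L} {v. (False, v) \<in> set L} S"
    proof (rule p5_free.good_guess_exists[OF p5 S p5_free.triple_dominated_if_grown[OF p5 grown S]])
      fix x y assume "x \<in> C" "E x y"
      then show "y \<in> C" by (rule closed)
    qed (use S in \<open>simp add: good_guess_def\<close>)
    have Ln: "set L \<subseteq> UNIV \<times> {..<n}" using L(2) Cn by auto
    define \<gamma> where "\<gamma> g = (if fst (L ! (g - 4)) then snd (L ! (g - 4)) else snd (L ! (g - 4)) + n)" for g
    show ?thesis
      unfolding s'_def
    proof (rule run_guesses_hit[where I = I and Q = "\<lambda>t. fst t 25 \<noteq> 0 \<and> fst t 13 \<le> card S"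
          and G = "set guess_regs" and \<gamma> = \<gamma>])
      show "I (?run t)" if "I t" for t using Irun[OF that] .
      show "I (upd g v t)" if "g \<in> set guess_regs" "I t" for g v t using Iupd[OF that] .
      show "fst (?run t) 25 \<noteq> 0 \<and> fst (?run t) 13 \<le> card S"
        if t: "I t" "fst t 25 \<noteq> 0 \<and> fst t 13 \<le> card S" for t
      proof -
        obtain T where "fst (?run t) 13 = (if ?better t T then card T else fst t 13)"
          "fst (?run t) 25 = (if ?better t T then 1 else fst t 25)"
          using try_ex[OF t(1)] by blast
        then show ?thesis using t(2) by auto
      qed
      show "fst (upd g v t) 25 \<noteq> 0 \<and> fst (upd g v t) 13 \<le> card S"
        if "g \<in> set guess_regs" "fst t 25 \<noteq> 0 \<and> fst t 13 \<le> card S" for g v t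
        using that by (auto simp: set_guess_regs)
      show "fst (?run t) 25 \<noteq> 0 \<and> fst (?run t) 13 \<le> card S"
        if t: "I t" "\<forall>g\<in>set guess_regs. fst t g = \<gamma> g" for t
      proof -
        have "good_guess E C (guess_A n (fst t)) (guess_Z n (fst t)) S"
          using good guess_of_list[OF L(1) Ln t(2)[unfolded \<gamma>_def]] by simp
        then obtain T where "fst (?run t) 13 = (if ?better t T then card T else fst t 13)"
          "fst (?run t) 25 = (if ?better t T then 1 else fst t 25)"
          "ifvs E C T" "card T \<le> card S"
          using try_ex[OF t(1)] by blast
        then show ?thesis by auto
      qed
      show "set guess_regs \<inter> writes try_guess = {}" by (auto simp: set_guess_regs)
      show "\<forall>g\<in>set guess_regs. \<gamma> g < 2 * n"
      proof
        fix g assume "g \<in> set guess_regs"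
        then have "L ! (g - 4) \<in> set L" using L(1) unfolding set_guess_regs by (intro nth_mem) linarith
        then have "snd (L ! (g - 4)) < n" using Ln by auto
        then show "\<gamma> g < 2 * n" by (simp add: \<gamma>_def)
      qed
      show "distinct guess_regs" by (simp add: guess_regs_def)
    qed (use Is in auto)
  qed
  show "fst s' 13 = 0 \<and> \<not> (\<exists>S. ifvs E C S)" if "fst s' 25 = 0"
    using Is' opt that unfolding I_def by blast
  show "\<exists>T. min_ifvs E C T \<and> fst s' 13 = card T" if nz: "fst s' 25 \<noteq> 0"
  proof -
    obtain T where "ifvs E C T" "fst s' 13 = card T" using Is' nz unfolding I_def by blast
    then show ?thesis using opt unfolding min_ifvs_def by auto
  qed
qed

text \<open>The vertices tagged before are closed under adjacency and do not contain
  \<open>r\<close>, so flooding with a fresh tag never runs into them and marks a closed set grown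
  from \<open>r\<close>.\<close>

lemma flood_component:
  assumes fl: "(flood_step n E t t)\<^sup>*\<^sup>* (a(r := t)) b" "flood_closed n E t t b"
    and r: "r < n" "a r = 0" and t: "t \<noteq> 0" "\<And>v. v < n \<Longrightarrow> a v \<noteq> t"
    and closed: "\<And>x y. x < n \<Longrightarrow> a x \<noteq> 0 \<Longrightarrow> E x y \<Longrightarrow> a y \<noteq> 0"
  shows "grown E r {v. v < n \<and> b v = t}" "\<And>v. v < n \<Longrightarrow> b v = t \<and> a v = 0 \<or> b v = a v"
    "\<And>x y. x < n \<Longrightarrow> b x = t \<Longrightarrow> E x y \<Longrightarrow> b y = t" "b r = t"
proof -
  have inv: "grown E r {v. v < n \<and> b v = t} \<and> (\<forall>v<n. b v = t \<and> a v = 0 \<or> b v = a v) \<and> b r = t"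
    using fl(1)
  proof (induction rule: rtranclp_induct)
    case base
    have "{v. v < n \<and> (a(r := t)) v = t} = {r}" using r t(2) by auto
    then show ?case using grown.single[of E r] r by simp
  next
    case (step b c)
    obtain x y where xy: "x < n" "y < n" "E x y" "b y = 0" "b x = t" "c = b(y := t)"
      using step.hyps(2) unfolding flood_step_def by blast
    have "{v. v < n \<and> c v = t} = insert y {v. v < n \<and> b v = t}" using xy by auto
    moreover have "grown E r (insert y {v. v < n \<and> b v = t})"
      by (rule grown.extend[of _ _ _ x]) (use step.IH xy in auto)
    moreover have "a y = 0" using step.IH xy(2,4) t(1) by metis
    moreover have "y \<noteq> r" using step.IH xy(4) t(1) by metis
    ultimately show ?case using step.IH xy(6) by simp
  qed
  then show "grown E r {v. v < n \<and> b v = t}" "b r = t" by blast+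
  show ab: "b v = t \<and> a v = 0 \<or> b v = a v" if "v < n" for v using inv that by blast
  show "b y = t" if x: "x < n" "b x = t" and e: "E x y" for x y
  proof -
    have y: "y < n" using E_less[rule_format, OF e] by simp
    then have "b y \<noteq> 0" using flood_closedD[OF fl(2) x(1) y] e x(2) by metis
    \<comment> \<open>A neighbour tagged before would have had \<open>x\<close> tagged before, by
      closure and symmetry.\<close>
    moreover have "a y = 0"
    proof (rule ccontr)
      assume "a y \<noteq> 0"
      then have "a x \<noteq> 0" using closed[OF y _ p5_free.sym[OF p5 e]] by blast
      then show False using ab[OF x(1)] t(2)[OF x(1)] x(2) by metis
    qed
    ultimately show ?thesis using ab[OF y] by metis
  qed
qed

lemma run_component:
  fixes s :: lstate
  defines "s' \<equiv> run E n component s" and "R \<equiv> {v. v < n \<and> snd s 0 v \<noteq> 0}"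
  assumes r: "r < n" "fst s 3 = r" "snd s 0 r = 0" and all_tags: "\<forall>v<n. snd s 0 v \<le> r"
    and all_closed: "\<forall>x y. x \<in> R \<longrightarrow> E x y \<longrightarrow> y \<in> R"
  obtains C where "{v. v < n \<and> snd s' 0 v \<noteq> 0} = R \<union> C" "R \<inter> C = {}" "r \<in> C"
    "\<forall>x y. x \<in> C \<longrightarrow> E x y \<longrightarrow> y \<in> C" "\<forall>v<n. snd s' 0 v \<le> Suc r"
    "\<forall>S. ifvs E C S \<longrightarrow> (\<exists>T. min_ifvs E C T \<and> fst s' 1 = fst s 1 + card T \<and> fst s' 2 = fst s 2)"
    "\<not> (\<exists>S. ifvs E C S) \<longrightarrow> fst s' 2 = 1"
proof -
  note tags = all_tags[rule_format] and closed = all_closed[rule_format]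
  define s1 where "s1 = upd 24 (Suc r) s"
  define s2 where "s2 = (fst s1, (snd s1)(0 := (snd s1 0)(r := Suc r)))"
  define s3 where "s3 = run E n (flood 0 (TAdj 16 17) (Rg 24) (Rg 24)) s2"
  define s4 where "s4 = upd 13 0 (upd 25 0 s3)"
  define s5 where "s5 = run E n (guesses guess_regs try_guess) s4"
  define s6 where "s6 = run E n (LIf (TEq (Rg 25) (Cst 0)) (LAssign 2 (Cst 1)) LSkip) s5"
  let ?c = "LIf (TLess (Rg 16) (Rg 13)) (LInc 1) LSkip"
  have "upd 24 (Suc r) (upd 24 r s) = s1" by (simp add: s1_def upd_def)
  then have run: "s' = run E n (LFor 16 1 ?c) s6"
    by (simp add: s'_def component_def s6_def s5_def s4_def s3_def s2_def r(2)) (simp add: s1_def r(2))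
  define b where "b = snd s3 0"
  define C where "C = {v. v < n \<and> b v = Suc r}"
  have s2: "fst s2 24 = Suc r" "snd s2 0 = (snd s 0)(r := Suc r)" by (simp_all add: s2_def s1_def)
  have fl: "(flood_step n E (Suc r) (Suc r))\<^sup>*\<^sup>* (snd s2 0) b \<and> flood_closed n E (Suc r) (Suc r) b"
    unfolding b_def s3_def by (rule run_flood) (use s2(1) in \<open>simp_all add: agree_def\<close>)
  have comp: "grown E r C" "\<And>v. v < n \<Longrightarrow> b v = Suc r \<and> snd s 0 v = 0 \<or> b v = snd s 0 v"
    "\<And>x y. x < n \<Longrightarrow> b x = Suc r \<Longrightarrow> E x y \<Longrightarrow> b y = Suc r" "b r = Suc r"
  proof -
    have cl: "snd s 0 y \<noteq> 0" if "x < n" "snd s 0 x \<noteq> 0" "E x y" for x y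
      using closed[of x y] that by (simp add: R_def)
    have ne: "snd s 0 v \<noteq> Suc r" if "v < n" for v using tags[OF that] by simp
    note fc = flood_component[OF fl[THEN conjunct1, unfolded s2(2)] fl[THEN conjunct2] r(1,3) _ ne cl]
    show "grown E r C" "\<And>v. v < n \<Longrightarrow> b v = Suc r \<and> snd s 0 v = 0 \<or> b v = snd s 0 v"
      "\<And>x y. x < n \<Longrightarrow> b x = Suc r \<Longrightarrow> E x y \<Longrightarrow> b y = Suc r" "b r = Suc r"
      using fc unfolding C_def by simp_all
  qed
  have Cclosed: "y \<in> C" if "x \<in> C" "E x y" for x y
    using comp(3)[of x y] that E_less[rule_format, OF that(2)] by (simp add: C_def)
  have s4: "fst s4 25 = 0" "fst s4 13 = 0" "tagged n s4 = C"
    using s2(1) by (simp_all add: s4_def tagged_def C_def b_def s3_def run_frame)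
  note rs = run_search[where s = s4 and r = r, folded s5_def, unfolded s4, OF _ comp(1) refl refl]
  have search1: "\<not> (\<exists>S. ifvs E C S)" if "fst s5 25 = 0"
    using rs(1)[rotated, OF that] Cclosed by blast
  have search2: "\<exists>T. min_ifvs E C T \<and> fst s5 13 = card T" if "fst s5 25 \<noteq> 0"
    by (rule rs(2)[rotated, OF that]) (rule Cclosed)
  have arr: "snd s' 0 = b"
    unfolding run s6_def s5_def using run_array_frame[of 0 "LFor 16 1 ?c"]
    by (simp add: run_array_frame s4_def b_def)
  have fr: "fst s5 1 = fst s 1" "fst s5 2 = fst s 2"
    by (simp_all add: s5_def run_frame set_guess_regs s4_def s3_def s2_def s1_def)
  have fr6: "fst s6 1 = fst s 1" "fst s6 13 = fst s5 13" "fst s6 2 = (if fst s5 25 = 0 then 1 else fst s 2)"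
    by (simp_all add: s6_def fr)
  have "fst s' 1 = fst s6 1 + card {i. i < 1 * n \<and> i < fst s5 13}"
    unfolding run by (rule run_For_count) (auto simp: agree_def fr6)
  then have r1: "fst s' 1 = fst s 1 + card {i. i < n \<and> i < fst s5 13}" by (simp add: fr6)
  have r2: "fst s' 2 = (if fst s5 25 = 0 then 1 else fst s 2)"
    unfolding run using run_frame[of 2 "LFor 16 1 ?c"] fr6 by simp
  show ?thesis
  proof (rule that[of C])
    have "b v \<noteq> 0 \<longleftrightarrow> v \<in> R \<or> v \<in> C" if "v < n" for v
      using comp(2)[OF that] that by (auto simp: R_def C_def)
    then show "{v. v < n \<and> snd s' 0 v \<noteq> 0} = R \<union> C" unfolding arr by (auto simp: R_def C_def)
    have "v \<notin> C" if "v \<in> R" for v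
    proof -
      have v: "v < n" "snd s 0 v \<noteq> 0" using that by (auto simp: R_def)
      then have "b v = snd s 0 v" using comp(2)[OF v(1)] by metis
      then have "b v \<noteq> Suc r" using tags[OF v(1)] by simp
      then show ?thesis by (simp add: C_def)
    qed
    then show "R \<inter> C = {}" by blast
    show "r \<in> C" using comp(4) r(1) by (simp add: C_def)
    show "\<forall>x y. x \<in> C \<longrightarrow> E x y \<longrightarrow> y \<in> C" using Cclosed by blast
    show "\<forall>v<n. snd s' 0 v \<le> Suc r"
    proof (intro allI impI)
      fix v assume v: "v < n"
      show "snd s' 0 v \<le> Suc r" unfolding arr using comp(2)[OF v] tags[OF v] by auto
    qed
    show "\<forall>S. ifvs E C S \<longrightarrow> (\<exists>T. min_ifvs E C T \<and> fst s' 1 = fst s 1 + card T \<and> fst s' 2 = fst s 2)"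
    proof (intro allI impI)
      fix S assume S: "ifvs E C S"
      have nz: "fst s5 25 \<noteq> 0" using search1 S by blast
      then obtain T where T: "min_ifvs E C T" "fst s5 13 = card T" using search2 by blast
      \<comment> \<open>The optimum is at most \<open>n\<close>, so the \<open>n\<close> rounds of
        the last loop suffice to add all of it.\<close>
      have "T \<subseteq> {..<n}" using T(1) unfolding min_ifvs_def ifvs_def by (auto simp: C_def)
      then have "card T \<le> n" using card_mono[of "{..<n}" T] by simp
      then have "{i. i < n \<and> i < fst s5 13} = {..<card T}" using T(2) by auto
      then show "\<exists>T. min_ifvs E C T \<and> fst s' 1 = fst s 1 + card T \<and> fst s' 2 = fst s 2"
        using T(1) r1 r2 nz by auto
    qed
    show "\<not> (\<exists>S. ifvs E C S) \<longrightarrow> fst s' 2 = 1"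
    proof (rule impI, rule ccontr)
      assume no: "\<not> (\<exists>S. ifvs E C S)" and "fst s' 2 \<noteq> 1"
      then have "fst s5 25 \<noteq> 0" using r2 by (cases "fst s5 25 = 0") simp_all
      then show False using search2 no unfolding min_ifvs_def by blast
    qed
  qed
qed

text \<open>Before round \<open>r\<close> the tagged vertices are closed under adjacency, contain
  every vertex below \<open>r\<close>, and have tags of at most \<open>r\<close>, which keeps the
  next tag fresh. Register 1 is meaningful only while register 2 is 0.\<close>

lemma run_main:
  fixes s :: lstate
  defines "s' \<equiv> run E n main s"
  assumes s: "fst s 1 = 0" "fst s 2 = 0" "\<And>v. snd s 0 v = 0"
  shows "fst s' 2 = 0 \<Longrightarrow> \<exists>T. min_ifvs E {..<n} T \<and> fst s' 1 = card T"
    "fst s' 2 \<noteq> 0 \<Longrightarrow> \<not> (\<exists>S. ifvs E {..<n} S)"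
proof -
  let ?c = "LIf (TEq (Cell 0 3) (Cst 0)) component LSkip"
  let ?R = "\<lambda>t. {v. v < n \<and> snd t 0 v \<noteq> 0}"
  define I :: "nat \<Rightarrow> lstate \<Rightarrow> bool" where "I r t \<longleftrightarrow> (\<forall>v<n. snd t 0 v \<le> r) \<and> (\<forall>v<r. v < n \<longrightarrow> snd t 0 v \<noteq> 0) \<and>
    (\<forall>x y. x \<in> ?R t \<longrightarrow> E x y \<longrightarrow> y \<in> ?R t) \<and>
    (fst t 2 = 0 \<longrightarrow> (\<exists>T. min_ifvs E (?R t) T \<and> fst t 1 = card T)) \<and>
    (fst t 2 \<noteq> 0 \<longrightarrow> \<not> (\<exists>S. ifvs E (?R t) S))" for r t
  obtain t where t: "run E n (LFor 3 1 ?c) s = upd 3 (1 * n) t" "I (1 * n) t"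
  proof (rule run_For_rule[of I s 1 n 3 ?c E])
    have "min_ifvs E {} {}" by (simp add: min_ifvs_def ifvs_def acyclic_on_def)
    then show "I 0 s" using s by (auto simp: I_def)
    fix r t assume "r < 1 * n" and It: "I r t"
    then have rn: "r < n" by simp
    let ?t = "upd 3 r t"
    note conj = It[unfolded I_def]
    note i1 = conj[THEN conjunct1] and conj2 = conj[THEN conjunct2]
    note i2 = conj2[THEN conjunct1] and conj3 = conj2[THEN conjunct2]
    note i3 = conj3[THEN conjunct1] and conj4 = conj3[THEN conjunct2]
    note i4 = conj4[THEN conjunct1] and i5 = conj4[THEN conjunct2]
    have tags: "snd ?t 0 v \<le> r" if "v < n" for v using i1 that by simp
    have closed: "y \<in> ?R ?t" if "x \<in> ?R ?t" "E x y" for x y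
      using i3 that unfolding snd_upd by blast
    show "I (Suc r) (run E n ?c ?t)"
    proof (cases "snd t 0 r = 0")
      case False
      then have run: "run E n ?c ?t = ?t" by simp
      have a2: "\<forall>v<Suc r. v < n \<longrightarrow> snd t 0 v \<noteq> 0" using i2 False by (metis less_SucE)
      have a1: "\<forall>v<n. snd t 0 v \<le> Suc r" using tags by (simp add: le_SucI)
      have f: "fst ?t 1 = fst t 1" "fst ?t 2 = fst t 2" by simp_all
      show ?thesis unfolding run I_def f snd_upd by (intro conjI a1 a2 i3 i4 i5)
    next
      case True
      define u where "u = run E n component ?t"
      have run: "run E n ?c ?t = u" using True by (simp add: u_def)
      have fst_t: "fst ?t 3 = r" and True': "snd ?t 0 r = 0" using True by simp_all
      have t_tags: "\<forall>v<n. snd ?t 0 v \<le> r" and t_closed: "\<forall>x y. x \<in> ?R ?t \<longrightarrow> E x y \<longrightarrow> y \<in> ?R ?t"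
        unfolding snd_upd by (fact i1, fact i3)
      obtain C where C: "?R u = ?R ?t \<union> C" "?R ?t \<inter> C = {}" "r \<in> C"
        "\<forall>x y. x \<in> C \<longrightarrow> E x y \<longrightarrow> y \<in> C" "\<forall>v<n. snd u 0 v \<le> Suc r"
        "\<forall>S. ifvs E C S \<longrightarrow> (\<exists>T. min_ifvs E C T \<and> fst u 1 = fst ?t 1 + card T \<and> fst u 2 = fst ?t 2)"
        "\<not> (\<exists>S. ifvs E C S) \<longrightarrow> fst u 2 = 1"
        by (rule run_component[where s = ?t, folded u_def, OF rn fst_t True' t_tags t_closed])
          (rule that)
      let ?Rt = "{v. v < n \<and> snd t 0 v \<noteq> 0}"
      have Ru: "?R u = ?Rt \<union> C" using C(1) by simp
      have sep: "\<not> E x y" if "x \<in> ?Rt" "y \<in> C" for x y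
        using closed[of x y] that C(2) by auto
      have sep': "\<not> E x y" if "x \<in> C" "y \<in> ?Rt" for x y
        using sep[OF that(2,1)] p5_free.sym[OF p5] by blast
      have Cn: "C \<subseteq> {..<n}" using C(1) by auto
      have 1: "\<forall>v<Suc r. v < n \<longrightarrow> snd u 0 v \<noteq> 0"
      proof (intro allI impI)
        fix v assume v: "v < Suc r" "v < n"
        have "v \<in> ?Rt \<union> C"
        proof (cases "v = r")
          case False
          then show ?thesis using i2 v by simp
        qed (use C(3) in simp)
        then show "snd u 0 v \<noteq> 0" using Ru by blast
      qed
      have 2: "y \<in> ?R u" if "x \<in> ?R u" "E x y" for x y
        using that closed[of x y] C(4) unfolding Ru snd_upd by blast
      have 3: "\<exists>T. min_ifvs E (?R u) T \<and> fst u 1 = card T" if z: "fst u 2 = 0"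
      proof -
        have "fst u 2 \<noteq> 1" using z by simp
        then obtain S where "ifvs E C S" using C(7) by blast
        then obtain T where T: "min_ifvs E C T" "fst u 1 = fst ?t 1 + card T" "fst u 2 = fst ?t 2"
          using C(6) by blast
        have t12: "fst t 2 = 0" "fst u 1 = fst t 1 + card T" using T(2,3) z by simp_all
        obtain U where U: "min_ifvs E ?Rt U" "fst t 1 = card U" using i4 t12(1) by blast
        have "finite C" "finite ?Rt" using Cn finite_subset by auto
        then have "min_ifvs E (?Rt \<union> C) (U \<union> T)" "card (U \<union> T) = card U + card T"
          using min_ifvs_Un[OF U(1) T(1)] C(2) sep sep' by auto
        then show ?thesis unfolding Ru using t12(2) U(2) by (intro exI[of _ "U \<union> T"]) simp
      qed
      \<comment> \<open>If the union had a solution, then so would the new component, and the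
        register would have been nonzero before; but the earlier vertices have a solution
        too.\<close>
      have 4: "\<not> (\<exists>S. ifvs E (?R u) S)" if nz: "fst u 2 \<noteq> 0"
      proof
        assume "\<exists>S. ifvs E (?R u) S"
        then obtain S where S: "ifvs E (?Rt \<union> C) S" unfolding Ru by blast
        have "ifvs E C (S \<inter> C)" and RS: "ifvs E ?Rt (S \<inter> ?Rt)" using ifvs_restrict[OF S] by auto
        then have "fst u 2 = fst ?t 2" using C(6) by blast
        then have "fst t 2 \<noteq> 0" using nz by simp
        with i5 have "\<not> (\<exists>S. ifvs E ?Rt S)" by (rule mp)
        then show False using RS by (rule notE[OF _ exI])
      qed
      show ?thesis
        unfolding run I_def
      proof (intro conjI)
        show "\<forall>v<n. snd u 0 v \<le> Suc r" using C(5) by blast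
        show "\<forall>x y. x \<in> ?R u \<longrightarrow> E x y \<longrightarrow> y \<in> ?R u" using 2 by blast
        show "fst u 2 = 0 \<longrightarrow> (\<exists>T. min_ifvs E (?R u) T \<and> fst u 1 = card T)" using 3 by blast
        show "fst u 2 \<noteq> 0 \<longrightarrow> \<not> (\<exists>S. ifvs E (?R u) S)" using 4 by blast
      qed (rule 1)
    qed
  qed
  have "s' = upd 3 (1 * n) t" using t(1) by (simp add: s'_def main_def)
  then have st: "fst s' 1 = fst t 1" "fst s' 2 = fst t 2" by simp_all
  note conj = t(2)[unfolded I_def]
  note processed = conj[THEN conjunct2, THEN conjunct1]
  note result = conj[THEN conjunct2, THEN conjunct2, THEN conjunct2]
  have "v \<in> ?R t \<longleftrightarrow> v \<in> {..<n}" for v using processed by auto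
  then have "?R t = {..<n}" by (rule set_eqI)
  then show "fst s' 2 = 0 \<Longrightarrow> \<exists>T. min_ifvs E {..<n} T \<and> fst s' 1 = card T"
    "fst s' 2 \<noteq> 0 \<Longrightarrow> \<not> (\<exists>S. ifvs E {..<n} S)"
    using result unfolding st by simp_all
qed

end

section \<open>The running time\<close>

lemma cok_guesses [simp]:
  "cok B (guesses gs c) \<longleftrightarrow> 0 \<notin> set gs \<and> distinct gs \<and> set gs \<inter> writes c = {} \<and> cok B c"
  by (induction gs) auto

lemma depth_guesses [simp]: "depth (guesses gs c) = length gs + depth c"
  by (induction gs) auto

lemma tok_tests [simp]: "tok (in_A x)" "tok xor_test" "tok forced_test"
  by (auto simp: in_A_def in_Z_def nbr_A_def xor_test_def forced_test_def)

text \<open>5 is the largest constant of the program, the colour of stripped vertices.\<close>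

lemma cok_try_guess: "cok 5 try_guess"
  by (simp add: try_guess_def colour_def explore_def tally_def choose_class_def relabel_def flood_def
      normalise_def check_def strip_def)

lemma cok_main: "cok 5 main"
proof -
  have "set guess_regs \<inter> writes try_guess = {}" "0 \<notin> set guess_regs" by (auto simp: set_guess_regs)
  moreover have "distinct guess_regs" by (simp add: guess_regs_def)
  ultimately show ?thesis
    by (simp add: main_def component_def cok_try_guess set_guess_regs) (simp add: flood_def)
qed

text \<open>14 = 1 + 9 + 1 + 3: the root of the component, the nine guess registers, the start of an
  exploration, and the rounds and two vertex loops of flooding.\<close>

lemma depth_main: "depth main = 14"
  by (simp add: main_def component_def try_guess_def colour_def explore_def tally_def choose_class_def
      relabel_def flood_def normalise_def check_def strip_def guess_regs_def)

text \<open>Register 0 has to keep the number of vertices until the addresses are no longer needed,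
  so the verdict of register 2 is moved there last. The size is already in register 1.\<close>

definition algorithm :: com where
  "algorithm = Seq (compile main) (IfElse (Less (Const 0) (Reg 2)) (Assign 0 (Const 0)) (Assign 0 (Const 1)))"

lemma min_independent_fvs_size_eq:
  assumes "pair_graph G" and V: "pverts G = {..<n}"
  shows "min_ifvs (\<lambda>u v. (u, v) \<in> parcs G) {..<n} T \<Longrightarrow> min_independent_fvs_size (with_proj G) = Some (card T)"
    "\<not> (\<exists>S. ifvs (\<lambda>u v. (u, v) \<in> parcs G) {..<n} S) \<Longrightarrow> min_independent_fvs_size (with_proj G) = None"
proof -
  note iff = independent_fvs_iff_ifvs[OF assms(1), unfolded V]
  show "min_independent_fvs_size (with_proj G) = Some (card T)"
    if T: "min_ifvs (\<lambda>u v. (u, v) \<in> parcs G) {..<n} T"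
  proof -
    have "(LEAST k. \<exists>S. independent_fvs (with_proj G) S \<and> card S = k) = card T"
      using T unfolding iff min_ifvs_def by (intro Least_equality) auto
    moreover have "near_bipartite (with_proj G)" using T unfolding near_bipartite_def iff min_ifvs_def by auto
    ultimately show ?thesis by (simp add: min_independent_fvs_size_def)
  qed
  show "min_independent_fvs_size (with_proj G) = None"
    if "\<not> (\<exists>S. ifvs (\<lambda>u v. (u, v) \<in> parcs G) {..<n} S)"
    using that by (simp add: min_independent_fvs_size_def near_bipartite_def iff)
qed

lemma algorithm_correct:
  assumes G: "pair_graph G" and V: "pverts G = {..<n}"
    and P5: "induced_free (with_proj G) (with_proj (path_graph 5))"
    and W: "n * n + 2 * (n + 5 + steps n main) + 2 \<le> W"
  shows "\<exists>t s. exec W algorithm (graph_input n G) t s \<and> t \<le> steps n main + 2 \<and>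
    outputs s (min_independent_fvs_size (with_proj G))"
proof -
  define E where "E = (\<lambda>u v. (u, v) \<in> parcs G)"
  have wf: "pair_wf_digraph G"
    using G by (simp add: pair_graph_def pair_pseudo_graph_def pair_sym_digraph_def)
  have E_less: "\<forall>x y. E x y \<longrightarrow> x < n \<and> y < n"
    using pair_wf_digraph.in_arcsD1[OF wf] pair_wf_digraph.in_arcsD2[OF wf] V unfolding E_def by auto
  have p5: "p5_free E" unfolding E_def using G P5 by (rule p5_free_if_induced_free)
  define s :: lstate where "s = (\<lambda>x. if x = 0 then n else 0, \<lambda>_ _. 0)"
  have input: "graph_input n G = conc E n s"
    by (auto simp: graph_input_def conc_def s_def E_def fun_eq_iff)
  \<comment> \<open>The input contains no number above \<open>n\<close> apart from the matrix
    entries, which \<open>conc\<close> accounts for separately; 5 makes room for the constants of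
    the program.\<close>
  have "bounded_by (n + 5) s" by (simp add: bounded_by_def s_def)
  moreover have "cok (n + 5) main" using cok_main by (rule cok_mono) simp
  moreover have "fst s 0 = n" by (simp add: s_def)
  ultimately obtain t where t: "t \<le> steps n main" "exec W (compile main) (conc E n s) t (conc E n (run E n main s))"
    using exec_compile[of E n "n + 5" main s W] E_less W by blast
  let ?s = "conc E n (run E n main s)"
  have s0: "fst s 1 = 0" "fst s 2 = 0" "\<And>v. snd s 0 v = 0" by (simp_all add: s_def)
  note correct = run_main[OF E_less p5 s0]
  have "1 \<le> W" using W by simp
  show ?thesis
  proof (cases "fst ?s 2 = 0")
    case True
    then obtain T where T: "min_ifvs E {..<n} T" "fst ?s 1 = card T" using correct(1) by auto
    have "exec W (IfElse (Less (Const 0) (Reg 2)) (Assign 0 (Const 0)) (Assign 0 (Const 1))) ?s (1 + 1)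
        ((fst ?s)(0 := aval (Const 1) ?s), snd ?s)"
      by (intro exec.IfFalse exec.Assign) (use True \<open>1 \<le> W\<close> in simp_all)
    then have "exec W algorithm (graph_input n G) (t + (1 + 1)) ((fst ?s)(0 := aval (Const 1) ?s), snd ?s)"
      unfolding algorithm_def input using t(2) by (intro exec.Seq)
    moreover have "outputs ((fst ?s)(0 := aval (Const 1) ?s), snd ?s) (min_independent_fvs_size (with_proj G))"
      using min_independent_fvs_size_eq(1)[OF G V T(1)[unfolded E_def]] T(2) by (simp add: outputs_def)
    ultimately show ?thesis using t(1) by (intro exI conjI) (assumption | simp)+
  next
    case False
    then have no: "\<not> (\<exists>S. ifvs E {..<n} S)" using correct(2) by auto
    have "exec W (IfElse (Less (Const 0) (Reg 2)) (Assign 0 (Const 0)) (Assign 0 (Const 1))) ?s (1 + 1)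
        ((fst ?s)(0 := aval (Const 0) ?s), snd ?s)"
      by (intro exec.IfTrue exec.Assign) (use False in simp_all)
    then have "exec W algorithm (graph_input n G) (t + (1 + 1)) ((fst ?s)(0 := aval (Const 0) ?s), snd ?s)"
      unfolding algorithm_def input using t(2) by (intro exec.Seq)
    moreover have "outputs ((fst ?s)(0 := aval (Const 0) ?s), snd ?s) (min_independent_fvs_size (with_proj G))"
      using min_independent_fvs_size_eq(2)[OF G V no[unfolded E_def]] by (simp add: outputs_def)
    ultimately show ?thesis using t(1) by (intro exI conjI) (assumption | simp)+
  qed
qed

theorem theorem4:
  shows "\<exists>(c :: com) (T :: nat \<Rightarrow> nat).
    (\<lambda>n. real (T n)) \<in> O(\<lambda>n. real n ^ 16) \<and>
    computes_in_time c
      (\<lambda>G. induced_free (with_proj G) (with_proj (path_graph 5)))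
      (\<lambda>G. min_independent_fvs_size (with_proj G)) T"
proof -
  obtain K where K: "\<And>n. steps n main \<le> K * Suc n ^ 14"
    using steps_polynomial[of main] unfolding depth_main by blast
  define T where "T n = steps n main + 2" for n
  have "(\<lambda>n. real (T n)) \<in> O(\<lambda>n. real n ^ 16)"
  proof (rule bigoI[where c = "real ((K + 2) * 2 ^ 14)"])
    show "\<forall>\<^sub>F n in at_top. norm (real (T n)) \<le> real ((K + 2) * 2 ^ 14) * norm (real n ^ 16)"
    proof (rule eventually_at_top_linorderI[of 1])
      fix n :: nat assume n: "1 \<le> n"
      \<comment> \<open>For \<open>n \<ge> 1\<close>, doubling \<open>n\<close> reaches
        \<open>Suc n\<close>. The depth 14 leaves slack below the exponent 16.\<close>
      have "Suc n ^ 14 \<le> (2 * n) ^ 14" using n by (intro power_mono) simp_all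
      also have "\<dots> = 2 ^ 14 * n ^ 14" by (rule power_mult_distrib)
      also have "\<dots> \<le> 2 ^ 14 * n ^ 16" using n by (intro mult_left_mono power_increasing) simp_all
      finally have S: "Suc n ^ 14 \<le> 2 ^ 14 * n ^ 16" .
      have "1 \<le> Suc n ^ 14" by (rule one_le_power) simp
      then have "T n \<le> (K + 2) * Suc n ^ 14" using K[of n] unfolding T_def add_mult_distrib by linarith
      also have "\<dots> \<le> (K + 2) * (2 ^ 14 * n ^ 16)" using S by (rule mult_left_mono) simp
      finally have "T n \<le> (K + 2) * 2 ^ 14 * n ^ 16" by (simp only: mult.assoc)
      then have "real (T n) \<le> real ((K + 2) * 2 ^ 14 * n ^ 16)" by (rule of_nat_mono)
      then show "norm (real (T n)) \<le> real ((K + 2) * 2 ^ 14) * norm (real n ^ 16)" by simp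
    qed
  qed
  moreover have "computes_in_time algorithm
      (\<lambda>G. induced_free (with_proj G) (with_proj (path_graph 5)))
      (\<lambda>G. min_independent_fvs_size (with_proj G)) T"
    unfolding computes_in_time_def
  \<comment> \<open>As the base is at least 2, the constant factor \<open>2 * K + 11\<close> is
    absorbed by the power with exponent \<open>2 * K + 20\<close>; the other 14 is the degree of the
    running time.\<close>
  proof (rule exI[of _ "2 * K + 20 + 14"], intro allI impI)
    fix n :: nat and G :: "nat pair_pre_digraph"
    assume G: "pair_graph G \<and> pverts G = {..<n} \<and> induced_free (with_proj G) (with_proj (path_graph 5))"
    let ?N = "n + 2"
    have "n * n \<le> ?N ^ 2" unfolding power2_eq_square by (intro mult_le_mono) simp_all
    also have "\<dots> \<le> ?N ^ 14" by (intro power_increasing) simp_all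
    finally have 1: "n * n \<le> ?N ^ 14" .
    have "?N ^ 1 \<le> ?N ^ 14" by (intro power_increasing) simp_all
    then have 2: "n + 2 \<le> ?N ^ 14" by simp
    have "K * Suc n ^ 14 \<le> K * ?N ^ 14" by (intro mult_left_mono power_mono) simp_all
    then have 3: "steps n main \<le> K * ?N ^ 14" using K[of n] by linarith
    have "n * n + 2 * (n + 5 + steps n main) + 2 \<le> n * n + 10 * (n + 2) + 2 * steps n main" by simp
    also have "\<dots> \<le> ?N ^ 14 + 10 * ?N ^ 14 + 2 * (K * ?N ^ 14)"
      using 1 2 3 by (intro add_le_mono mult_le_mono le_refl)
    also have "\<dots> = (2 * K + 11) * ?N ^ 14" by (simp add: algebra_simps)
    also have "\<dots> \<le> 2 ^ (2 * K + 11) * ?N ^ 14"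
      using less_exp[of "2 * K + 11"] by (intro mult_right_mono) simp_all
    also have "\<dots> \<le> ?N ^ (2 * K + 20) * ?N ^ 14"
    proof (rule mult_right_mono)
      have "(2::nat) ^ (2 * K + 11) \<le> 2 ^ (2 * K + 20)" by (rule power_increasing) simp_all
      also have "\<dots> \<le> ?N ^ (2 * K + 20)" by (rule power_mono) simp_all
      finally show "(2::nat) ^ (2 * K + 11) \<le> ?N ^ (2 * K + 20)" .
    qed simp
    also have "\<dots> = ?N ^ (2 * K + 20 + 14)" by (rule power_add[symmetric])
    finally show "\<exists>t s. exec (?N ^ (2 * K + 20 + 14)) algorithm (graph_input n G) t s \<and> t \<le> T n \<and>
        outputs s (min_independent_fvs_size (with_proj G))"
      unfolding T_def using algorithm_correct[of G n "?N ^ (2 * K + 20 + 14)"] G by blast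
  qed
  ultimately show ?thesis by blast
qed

end
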